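(* Let $\rho\ge1$ and, for $n\in\mathbb N$, let $\mu_n,\nu_n\in\mathcal P_\rho(\mathbb R)$ be in convex order, $\mu_n\le_{cx}\nu_n$, and respectively converge to $\mu$ and $\nu$ in $\mathcal W_\rho$ as $n\to+\infty$. Then $$\widehat{\mathcal{AW}}^\rho_\rho(\widehat M^{IT}_n,\widehat M^{IT})\le\int_{(0,1)}\mathcal W_\rho^\rho\big((\widetilde m^{IT}_n)_u,\widetilde m^{IT}_u\big)\,du\underset{n\to+\infty}{\longrightarrow}0,$$ where $\widehat M^{IT}_n=\lambda_{(0,1)}\times\delta_{F_{\mu_n}^{-1}(u)}\times(\widetilde m^{IT}_n)_u$, resp. $\widehat M^{IT}=\lambda_{(0,1)}\times\delta_{F_\mu^{-1}(u)}\times\widetilde m^{IT}_u$, denotes the lifted inverse transform martingale coupling between $\mu_n$ and $\nu_n$, resp. $\mu$ and $\nu$.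
   Context: $\mathcal P_\rho(\mathbb R)$ is the set of probability measures on $\mathbb R$ with finite moment of order $\rho\ge1$. $\Pi(\eta,\eta')$ is the set of couplings of $\eta,\eta'$, and $\mathcal W_\rho(\eta,\eta')=\inf_{\pi\in\Pi(\eta,\eta')}\left(\int|x-y|^\rho\,\pi(dx,dy)\right)^{1/\rho}$ is the Wasserstein distance of order $\rho$ on $\mathcal P_\rho(\mathbb R)$. $\mu\le_{cx}\nu$ (convex order) means $\int f\,d\mu\le\int f\,d\nu$ for all convex $f:\mathbb R\to\mathbb R$ (the limits then also satisfy $\mu\le_{cx}\nu$). $F_\eta(x)=\eta((-\infty,x])$, $F_\eta^{-1}(u)=\inf\{x\in\mathbb R: F_\eta(x)\ge u\}$ for $u\in(0,1)$. $\lambda_{(0,1)}$ is the Lebesgue measure on $(0,1)$. For measures of the form $\widehat\pi(du,dx,dy)=\lambda_{(0,1)}(du)\,\delta_{F_\mu^{-1}(u)}(dx)\,p_u(dy)$ and $\widehat\pi'(du,dx,dy)=\lambda_{(0,1)}(du)\,\delta_{F_{\mu'}^{-1}(u)}(dx)\,p'_u(dy)$ with $p,p'$ probability kernels, the lifted adapted Wasserstein distance of order $\rho$ is $$\widehat{\mathcal{AW}}_\rho(\widehat\pi,\widehat\pi')=\inf_{\chi\in\Pi(\lambda_{(0,1)},\lambda_{(0,1)})}\left(\int_{(0,1)^2}\left(|u-u'|^\rho+|F_\mu^{-1}(u)-F_{\mu'}^{-1}(u')|^\rho+\mathcal W_\rho^\rho(p_u,p'_{u'})\right)\chi(du,du')\right)^{1/\rho}.$$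 **Lifted inverse transform martingale coupling.** For $\mu\le_{cx}\nu$ in $\mathcal P_1(\mathbb R)$ let $\Psi_+(u)=\int_0^u(F_\mu^{-1}-F_\nu^{-1})^+(v)\,dv$ and $\Psi_-(u)=\int_0^u(F_\mu^{-1}-F_\nu^{-1})^-(v)\,dv$, $u\in[0,1]$ (positive and negative parts); $\Psi_+(1)=\Psi_-(1)$. Let $\Psi_\pm^{-1}(w)=\inf\{r\in[0,1]:\Psi_\pm(r)\ge w\}$ be the left-continuous generalised inverses. Set $\varphi(u)=\Psi_-^{-1}(\Psi_+(u))$ if $F_\mu^{-1}(u)>F_\nu^{-1}(u)$, $\varphi(u)=\Psi_+^{-1}(\Psi_-(u))$ if $F_\mu^{-1}(u)<F_\nu^{-1}(u)$, and $\varphi(u)=u$ if $F_\mu^{-1}(u)=F_\nu^{-1}(u)$. Then $(\widetilde m^{IT}_u)_{u\in(0,1)}$ is the probability kernel satisfying for $du$-almost all $u\in(0,1)$ $$\widetilde m^{IT}_u=p(u)\,\delta_{F_\nu^{-1}(\varphi(u))}+(1-p(u))\,\delta_{F_\nu^{-1}(u)},\qquad p(u)=\mathbf 1_{\{F_\mu^{-1}(u)\neq F_\nu^{-1}(u)\}}\frac{F_\mu^{-1}(u)-F_\nu^{-1}(u)}{F_\nu^{-1}(\varphi(u))-F_\nu^{-1}(u)},$$ (for almost all $u$ with $F_\mu^{-1}(u)\ne F_\nu^{-1}(u)$ one has $\varphi(u)\in(0,1)$ and $p(u)\in[0,1]$), and the lifted inverse transform martingale coupling between $\mu$ and $\nu$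 is $\widehat M^{IT}(du,dx,dy)=\lambda_{(0,1)}(du)\,\delta_{F_\mu^{-1}(u)}(dx)\,\widetilde m^{IT}_u(dy)$. The kernel $(\widetilde m^{IT}_n)_u$ is the same object with $(\mu_n,\nu_n)$ in place of $(\mu,\nu)$.
   Formalization: The inequality is proved with a factor 2 on the right-hand integral; with constant 1 it fails for the given distance, e.g. ρ=1, μ_n=ν_n=δ_{1/(n+1)}, μ=ν=δ_0, where the left side is 2/(n+1) and the integral 1/(n+1). The limit is unchanged. *)

theory Defs
  imports "HOL-Probability.Probability"
begin

section \<open>Wasserstein distance and convex order on the real line\<close>

text \<open>Real powers of extended nonnegative numbers, for positive exponents; \<open>\<infinity>\<close> is sent to \<open>\<infinity>\<close>.\<close>

definition ennpowr :: "ennreal \<Rightarrow> real \<Rightarrow> ennreal" where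
  "ennpowr x a = (if x = \<infinity> then \<infinity> else ennreal (enn2real x powr a))"

definition couplings :: "'a measure \<Rightarrow> 'b measure \<Rightarrow> ('a \<times> 'b) measure set" where
  "couplings M N =
     {\<pi>. sets \<pi> = sets (M \<Otimes>\<^sub>M N) \<and> distr \<pi> M fst = M \<and> distr \<pi> N snd = N}"

definition finite_moment_measures :: "real \<Rightarrow> real measure set" where
  "finite_moment_measures \<rho> =
     {\<eta>. real_distribution \<eta> \<and> integrable \<eta> (\<lambda>x. \<bar>x\<bar> powr \<rho>)}"

definition wasserstein :: "real \<Rightarrow> real measure \<Rightarrow> real measure \<Rightarrow> ennreal" where
  "wasserstein \<rho> \<eta> \<eta>' =
     (INF \<pi>\<in>couplings \<eta> \<eta>'.
        ennpowr (\<integral>\<^sup>+(x, y). ennreal (\<bar>x - y\<bar> powr \<rho>) \<partial>\<pi>) (1 / \<rho>))"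

text \<open>
  For measures with finite first moment, the integral of a convex function is well defined in
  \<open>(-\<infinity>, \<infinity>]\<close>, and it is finite iff the function is integrable.
\<close>

definition convex_order :: "real measure \<Rightarrow> real measure \<Rightarrow> bool" where
  "convex_order \<mu> \<nu> \<longleftrightarrow>
     (\<forall>f::real \<Rightarrow> real. convex_on UNIV f \<longrightarrow> integrable \<nu> f \<longrightarrow>
        integrable \<mu> f \<and> (\<integral>x. f x \<partial>\<mu>) \<le> (\<integral>x. f x \<partial>\<nu>))"

definition quantile :: "real measure \<Rightarrow> real \<Rightarrow> real" where
  "quantile \<eta> u = Inf {x. cdf \<eta> x \<ge> u}"


section \<open>Lifted measures and the lifted adapted Wasserstein distance\<close>

abbreviation lebesgue01 :: "real measure" where
  "lebesgue01 \<equiv> restrict_space lborel {0<..<1}"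

abbreviation prob_kernels :: "(real \<Rightarrow> real measure) set" where
  "prob_kernels \<equiv> lebesgue01 \<rightarrow>\<^sub>M prob_algebra borel"

text \<open>The measure \<open>\<lambda>(du) \<delta>\<^bsub>quantile \<mu> u\<^esub>(dx) p\<^sub>u(dy)\<close> on \<open>(0,1) \<times> \<real> \<times> \<real>\<close>.\<close>

definition lifted_measure ::
  "real measure \<Rightarrow> (real \<Rightarrow> real measure) \<Rightarrow> (real \<times> real \<times> real) measure" where
  "lifted_measure \<mu> p =
     lebesgue01 \<bind>
       (\<lambda>u. distr (p u) (lebesgue01 \<Otimes>\<^sub>M borel \<Otimes>\<^sub>M borel) (\<lambda>y. (u, quantile \<mu> u, y)))"

definition lifted_AW_kernels ::
  "real \<Rightarrow> real measure \<Rightarrow> (real \<Rightarrow> real measure) \<Rightarrow>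
   real measure \<Rightarrow> (real \<Rightarrow> real measure) \<Rightarrow> ennreal" where
  "lifted_AW_kernels \<rho> \<mu> p \<mu>' p' =
     (INF \<kappa>\<in>couplings lebesgue01 lebesgue01.
        ennpowr
          (\<integral>\<^sup>+(u, u'). (ennreal (\<bar>u - u'\<bar> powr \<rho>)
                     + ennreal (\<bar>quantile \<mu> u - quantile \<mu>' u'\<bar> powr \<rho>)
                     + ennpowr (wasserstein \<rho> (p u) (p' u')) \<rho>) \<partial>\<kappa>)
          (1 / \<rho>))"

text \<open>
  A lifted measure determines its first marginal \<open>\<mu>\<close>, and it determines the kernel \<open>p\<close> up to a
  Lebesgue null set of \<open>u\<close>, which is negligible for every coupling \<open>\<kappa>\<close>. Hence all representations
  below have the same value, and the outer infimum only selects this common value.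
\<close>

definition lifted_AW ::
  "real \<Rightarrow> (real \<times> real \<times> real) measure \<Rightarrow> (real \<times> real \<times> real) measure \<Rightarrow> ennreal" where
  "lifted_AW \<rho> \<pi> \<pi>' =
     Inf {lifted_AW_kernels \<rho> \<mu> p \<mu>' p' | \<mu> p \<mu>' p'.
            real_distribution \<mu> \<and> p \<in> prob_kernels \<and> \<pi> = lifted_measure \<mu> p \<and>
            real_distribution \<mu>' \<and> p' \<in> prob_kernels \<and> \<pi>' = lifted_measure \<mu>' p'}"


section \<open>The lifted inverse transform martingale coupling\<close>

definition Psi_plus :: "real measure \<Rightarrow> real measure \<Rightarrow> real \<Rightarrow> real" where
  "Psi_plus \<mu> \<nu> u = (LBINT v:{0<..<u}. max 0 (quantile \<mu> v - quantile \<nu> v))"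

definition Psi_minus :: "real measure \<Rightarrow> real measure \<Rightarrow> real \<Rightarrow> real" where
  "Psi_minus \<mu> \<nu> u = (LBINT v:{0<..<u}. max 0 (- (quantile \<mu> v - quantile \<nu> v)))"

definition left_inverse01 :: "(real \<Rightarrow> real) \<Rightarrow> real \<Rightarrow> real" where
  "left_inverse01 \<Psi> w = Inf {r \<in> {0..1}. \<Psi> r \<ge> w}"

definition IT_phi :: "real measure \<Rightarrow> real measure \<Rightarrow> real \<Rightarrow> real" where
  "IT_phi \<mu> \<nu> u =
     (if quantile \<mu> u > quantile \<nu> u then left_inverse01 (Psi_minus \<mu> \<nu>) (Psi_plus \<mu> \<nu> u)
      else if quantile \<mu> u < quantile \<nu> u then left_inverse01 (Psi_plus \<mu> \<nu>) (Psi_minus \<mu> \<nu> u)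
      else u)"

definition IT_weight :: "real measure \<Rightarrow> real measure \<Rightarrow> real \<Rightarrow> real" where
  "IT_weight \<mu> \<nu> u =
     (if quantile \<mu> u \<noteq> quantile \<nu> u
      then (quantile \<mu> u - quantile \<nu> u) / (quantile \<nu> (IT_phi \<mu> \<nu> u) - quantile \<nu> u)
      else 0)"

text \<open>
  The kernel is only specified for almost every \<open>u\<close>, hence a predicate. The mixture
  \<open>w \<delta>\<^sub>a + (1 - w) \<delta>\<^sub>b\<close> is given by its values on Borel sets, using real arithmetic so that no
  truncation of the weights takes place.
\<close>

definition lifted_IT_kernel ::
  "real measure \<Rightarrow> real measure \<Rightarrow> (real \<Rightarrow> real measure) \<Rightarrow> bool" where
  "lifted_IT_kernel \<mu> \<nu> m \<longleftrightarrow>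
     m \<in> prob_kernels \<and>
     (AE u in lebesgue01. \<forall>A\<in>sets borel.
        measure (m u) A =
          IT_weight \<mu> \<nu> u * indicator A (quantile \<nu> (IT_phi \<mu> \<nu> u))
          + (1 - IT_weight \<mu> \<nu> u) * indicator A (quantile \<nu> u))"

end

theory Submission
  imports Defs
begin

text \<open>
  Write \<open>q = quantile \<mu>\<close>, \<open>r = quantile \<nu>\<close>, \<open>g = q - r\<close> and \<open>\<phi> = IT_phi \<mu> \<nu>\<close>, and put an index
  \<open>n\<close> on the objects built from \<open>\<mu>\<^sub>n\<close> and \<open>\<nu>\<^sub>n\<close>. The kernel at \<open>u\<close> is a law with the two atoms
  \<open>r (\<phi> u)\<close> and \<open>r u\<close>, of weights \<open>p u\<close> and \<open>1 - p u\<close>, and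
  \<open>p u * (r (\<phi> u) - r u) = g u\<close>: its mean is \<open>q u\<close>.

  The inequality comes from coupling \<open>(0,1)\<close> with itself along the diagonal. There the term
  \<open>\<bar>u - u'\<bar>\<close> vanishes, and the distance of the two quantiles is a distance of means, which Jensen's
  inequality bounds by the Wasserstein distance of the kernels
  (\<open>mean_diff_powr_le_wasserstein\<close>, \<open>lifted_AW_le_diagonal\<close>).

  For the limit, the key is that \<open>\<phi>\<close> is the increasing transport of the density \<open>g\<^sup>+\<close> to \<open>g\<^sup>-\<close> on
  \<open>{g > 0}\<close> and of \<open>g\<^sup>-\<close> to \<open>g\<^sup>+\<close> on \<open>{g < 0}\<close> (\<open>nn_integral_matching\<close>). This is used in three ways.

  \<^item> The image of almost every \<open>u\<close> with \<open>g u > 0\<close> is a point where \<open>g < 0\<close>, and conversely. In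
    quantile form the convex order says that the primitive of \<open>g\<close> is nonnegative, which forces \<open>\<phi> u \<ge> u\<close> if
    \<open>g u > 0\<close> and \<open>\<phi> u \<le> u\<close> if \<open>g u < 0\<close>. So \<open>q u\<close> lies between \<open>r u\<close> and \<open>r (\<phi> u)\<close>, the two
    atoms differ, and \<open>p u\<close> is a genuine weight (\<open>AE_IT_bracket\<close>, \<open>AE_IT_weight\<close>).

  \<^item> \<open>\<phi>\<close> avoids negligible sets of exceptional points: the discontinuities of \<open>r\<close> and the left ends
    of the flat pieces of the primitives. At all other points \<open>\<phi>\<^sub>n u \<longlonglongrightarrow> \<phi> u\<close>, and so the atoms and the
    weights converge for almost every \<open>u\<close> with \<open>g u \<noteq> 0\<close> (\<open>AE_IT_tendsto\<close>).

  \<^item> The integral of \<open>\<bar>g\<bar> * k (r \<circ> \<phi>)\<close> equals that of \<open>\<bar>g\<bar> * k r\<close> for every nonnegative \<open>k\<close>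
    (\<open>nn_integral_IT_phi\<close>). For \<open>k x = (1 + \<bar>x\<bar>) powr (\<rho> - 1)\<close> the second integral is controlled by the
    moments of order \<open>\<rho>\<close>, which converge. Since the integrands on the left converge where \<open>g \<noteq> 0\<close>
    and have limit integrand \<open>0\<close> elsewhere, Scheffe's argument yields their convergence in \<open>L\<^sup>1\<close>
    (\<open>jump_weight_L1_tendsto\<close>). This also covers \<open>{g = 0}\<close>, where \<open>r\<^sub>n (\<phi>\<^sub>n u)\<close> may diverge.

  Finally the \<open>\<rho>\<close>-cost of the monotone coupling of two two-point laws is bounded by terms that converge in
  \<open>L\<^sup>1\<close> and vanish in the limit on \<open>{g = 0}\<close> (\<open>monotone_cost_le\<close>, \<open>weighted_powr_le\<close>). Dominated
  convergence finishes the proof (\<open>cost_tendsto_0\<close>).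
\<close>

section \<open>Convergence of integrals\<close>

lemma ennreal_tendsto_0_I:
  fixes X :: "nat \<Rightarrow> ennreal"
  assumes "\<And>e::real. e > 0 \<Longrightarrow> \<forall>\<^sub>F n in sequentially. X n \<le> ennreal e"
  shows "X \<longlonglongrightarrow> 0"
proof (rule order_tendstoI)
  fix a :: ennreal assume "0 < a"
  then obtain e :: real where e: "0 < e" "ennreal e < a"
    by (metis dense ennreal_cases ennreal_less_zero_iff less_trans less_top not_less_iff_gr_or_eq)
  from assms[OF e(1)] show "\<forall>\<^sub>F n in sequentially. X n < a"
    by eventually_elim (use e(2) in auto)
qed auto

lemma ennreal_tendsto_0_D:
  fixes X :: "nat \<Rightarrow> ennreal"
  assumes "X \<longlonglongrightarrow> 0" "e > (0::real)"
  shows "\<forall>\<^sub>F n in sequentially. X n \<le> ennreal e"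
  using order_tendstoD(2)[OF assms(1), of "ennreal e"] assms(2)
  by (auto elim: eventually_mono)

text \<open>
  Dominated convergence with a dominating function that may itself vary with \<open>n\<close>, up to an error \<open>E n\<close>
  that vanishes in \<open>L\<^sup>1\<close>: since \<open>X n \<le> E n + min (X n) D\<close>, the classical theorem is needed only for
  \<open>min (X n) D\<close>. On \<open>{D = 0}\<close> the error alone controls \<open>X n\<close>.
\<close>

lemma nn_integral_tendsto_0_dominated:
  fixes X E :: "nat \<Rightarrow> 'a \<Rightarrow> real" and D :: "'a \<Rightarrow> real"
  assumes [measurable]: "\<And>n. X n \<in> borel_measurable M" "\<And>n. E n \<in> borel_measurable M"
      "D \<in> borel_measurable M"
    and bound: "\<And>n. AE x in M. 0 \<le> X n x \<and> 0 \<le> E n x \<and> X n x \<le> E n x + D x"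
    and D: "(\<integral>\<^sup>+x. ennreal (D x) \<partial>M) < \<infinity>" and D0: "\<And>x. 0 \<le> D x"
    and E: "(\<lambda>n. \<integral>\<^sup>+x. ennreal (E n x) \<partial>M) \<longlonglongrightarrow> 0"
    and X: "AE x in M. (\<lambda>n. min (X n x) (D x)) \<longlonglongrightarrow> 0"
  shows "(\<lambda>n. \<integral>\<^sup>+x. ennreal (X n x) \<partial>M) \<longlonglongrightarrow> 0"
proof -
  have "(\<lambda>n. \<integral>\<^sup>+x. ennreal (min (X n x) (D x)) \<partial>M) \<longlonglongrightarrow> (\<integral>\<^sup>+x. ennreal 0 \<partial>M)"
  proof (rule nn_integral_dominated_convergence[where w = "\<lambda>x. ennreal (D x)"])
    show "AE x in M. (\<lambda>n. ennreal (min (X n x) (D x))) \<longlonglongrightarrow> ennreal 0"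
      using X by eventually_elim (intro tendsto_ennrealI)
    show "AE x in M. ennreal (min (X n x) (D x)) \<le> ennreal (D x)" for n
      by (auto intro!: ennreal_leI)
  qed (use D in auto)
  then have min0: "(\<lambda>n. \<integral>\<^sup>+x. ennreal (min (X n x) (D x)) \<partial>M) \<longlonglongrightarrow> 0"
    by simp
  have le: "(\<integral>\<^sup>+x. ennreal (X n x) \<partial>M) \<le>
      (\<integral>\<^sup>+x. ennreal (E n x) \<partial>M) + (\<integral>\<^sup>+x. ennreal (min (X n x) (D x)) \<partial>M)" for n
  proof -
    have "(\<integral>\<^sup>+x. ennreal (X n x) \<partial>M) \<le> (\<integral>\<^sup>+x. ennreal (E n x) + ennreal (min (X n x) (D x)) \<partial>M)"
    proof (rule nn_integral_mono_AE)
      show "AE x in M. ennreal (X n x) \<le> ennreal (E n x) + ennreal (min (X n x) (D x))"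
        using bound[of n] by eventually_elim
          (use D0 in \<open>auto simp: min_def ennreal_plus[symmetric] simp del: ennreal_plus intro!: ennreal_leI\<close>)
    qed
    then show ?thesis by (subst (asm) nn_integral_add) auto
  qed
  have "(\<lambda>n. (\<integral>\<^sup>+x. ennreal (E n x) \<partial>M) + (\<integral>\<^sup>+x. ennreal (min (X n x) (D x)) \<partial>M)) \<longlonglongrightarrow> 0"
    using tendsto_add[OF E min0] by simp
  from tendsto_sandwich[OF _ _ tendsto_const this] show ?thesis
    using le by (auto intro!: always_eventually)
qed

text \<open>
  A one-sided form of Scheffe's lemma. It rests on \<open>\<bar>f - F\<bar> + F = f + 2 * max 0 (F - f)\<close>: the last
  term is at most \<open>2 * F\<close>, so it vanishes with \<open>F\<close> and dominated convergence applies to it, and the integral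
  of \<open>f\<close> enters only through an upper bound.
\<close>

lemma Scheffe_limsup:
  fixes f :: "nat \<Rightarrow> 'a \<Rightarrow> real" and F :: "'a \<Rightarrow> real"
  assumes [measurable]: "\<And>n. f n \<in> borel_measurable M" "F \<in> borel_measurable M"
    and nonneg: "\<And>n x. 0 \<le> f n x" "\<And>x. 0 \<le> F x"
    and F: "(\<integral>\<^sup>+x. ennreal (F x) \<partial>M) < \<infinity>"
    and conv: "AE x in M. F x \<noteq> 0 \<longrightarrow> (\<lambda>n. f n x) \<longlonglongrightarrow> F x"
    and limsup: "\<And>e::real. e > 0 \<Longrightarrow> \<forall>\<^sub>F n in sequentially.
        (\<integral>\<^sup>+x. ennreal (f n x) \<partial>M) \<le> (\<integral>\<^sup>+x. ennreal (F x) \<partial>M) + ennreal e"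
  shows "(\<lambda>n. \<integral>\<^sup>+x. ennreal \<bar>f n x - F x\<bar> \<partial>M) \<longlonglongrightarrow> 0"
proof (rule ennreal_tendsto_0_I)
  fix e :: real assume e: "e > 0"
  have "(\<lambda>n. \<integral>\<^sup>+x. ennreal (max 0 (F x - f n x)) \<partial>M) \<longlonglongrightarrow> 0"
  proof (rule nn_integral_tendsto_0_dominated[where E = "\<lambda>_ _. 0" and D = F])
    show "AE x in M. (\<lambda>n. min (max 0 (F x - f n x)) (F x)) \<longlonglongrightarrow> 0"
      using conv
    proof eventually_elim
      case (elim x)
      show ?case
      proof (cases "F x = 0")
        case True
        then show ?thesis using nonneg(1)[of _ x] by (simp add: min_def)
      next
        case False
        with elim have "(\<lambda>n. min (max 0 (F x - f n x)) (F x)) \<longlonglongrightarrow> min (max 0 (F x - F x)) (F x)"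
          by (intro tendsto_intros) auto
        then show ?thesis using nonneg(2)[of x] by simp
      qed
    qed
  qed (use nonneg F in auto)
  from ennreal_tendsto_0_D[OF this, of "e/4"] limsup[of "e/2"] e
  have "\<forall>\<^sub>F n in sequentially. (\<integral>\<^sup>+x. ennreal (max 0 (F x - f n x)) \<partial>M) \<le> ennreal (e/4) \<and>
     (\<integral>\<^sup>+x. ennreal (f n x) \<partial>M) \<le> (\<integral>\<^sup>+x. ennreal (F x) \<partial>M) + ennreal (e/2)"
    by (intro eventually_conj) auto
  then show "\<forall>\<^sub>F n in sequentially. (\<integral>\<^sup>+x. ennreal \<bar>f n x - F x\<bar> \<partial>M) \<le> ennreal e"
  proof eventually_elim
    case (elim n)
    have "(\<integral>\<^sup>+x. ennreal (F x) \<partial>M) + (\<integral>\<^sup>+x. ennreal \<bar>f n x - F x\<bar> \<partial>M) =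
        (\<integral>\<^sup>+x. ennreal (F x) + ennreal \<bar>f n x - F x\<bar> \<partial>M)"
      by (subst nn_integral_add) auto
    also have "\<dots> = (\<integral>\<^sup>+x. ennreal (f n x) + 2 * ennreal (max 0 (F x - f n x)) \<partial>M)"
    proof (rule nn_integral_cong)
      fix x
      have "ennreal (F x) + ennreal \<bar>f n x - F x\<bar> = ennreal (F x + \<bar>f n x - F x\<bar>)"
        using nonneg(2) by simp
      also have "F x + \<bar>f n x - F x\<bar> = f n x + 2 * max 0 (F x - f n x)"
        by (simp add: max_def)
      also have "ennreal \<dots> = ennreal (f n x) + 2 * ennreal (max 0 (F x - f n x))"
        using nonneg(1) by (simp add: ennreal_mult)
      finally show "ennreal (F x) + ennreal \<bar>f n x - F x\<bar> = \<dots>" .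
    qed
    also have "\<dots> = (\<integral>\<^sup>+x. ennreal (f n x) \<partial>M) + 2 * (\<integral>\<^sup>+x. ennreal (max 0 (F x - f n x)) \<partial>M)"
      by (simp add: nn_integral_add nn_integral_cmult)
    also have "\<dots> \<le> ((\<integral>\<^sup>+x. ennreal (F x) \<partial>M) + ennreal (e/2)) + 2 * ennreal (e/4)"
      using elim by (intro add_mono mult_left_mono) auto
    also have "\<dots> = (\<integral>\<^sup>+x. ennreal (F x) \<partial>M) + ennreal e"
    proof -
      have "2 * ennreal (e/4) = ennreal (e/2)"
        using e by (metis ennreal_mult' ennreal_numeral field_sum_of_halves mult_2
            numeral_Bit0_eq_double divide_divide_eq_left zero_le_numeral)
      moreover have "ennreal (e/2) + ennreal (e/2) = ennreal e"
        using e by (subst ennreal_plus[symmetric]) auto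
      ultimately show ?thesis by (simp add: add.assoc)
    qed
    finally show ?case using F by (auto simp add: ennreal_add_left_cancel_le)
  qed
qed

text \<open>
  Holds for every \<open>f\<close>, measurable or not, because the nonnegative integral is a supremum over simple
  functions below \<open>f\<close>. It is applied to integrands that contain the Wasserstein distance of two
  kernels, and it spares the proof of their measurability; so does the next lemma.
\<close>

lemma nn_integral_distr_le:
  assumes T: "T \<in> measurable M N"
  shows "(\<integral>\<^sup>+y. f y \<partial>distr M N T) \<le> (\<integral>\<^sup>+x. f (T x) \<partial>M)"
  unfolding nn_integral_def[of "distr M N T"]
proof (rule SUP_least)
  fix s assume s: "s \<in> {g. simple_function (distr M N T) g \<and> g \<le> f}"
  then have [measurable]: "s \<in> borel_measurable N"
    by (auto dest: borel_measurable_simple_function)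
  have "integral\<^sup>S (distr M N T) s = (\<integral>\<^sup>+y. s y \<partial>distr M N T)"
    using s by (auto simp: nn_integral_eq_simple_integral)
  also have "\<dots> = (\<integral>\<^sup>+x. s (T x) \<partial>M)"
    by (rule nn_integral_distr[OF T]) simp
  also have "\<dots> \<le> (\<integral>\<^sup>+x. f (T x) \<partial>M)"
    using s by (intro nn_integral_mono) (auto simp: le_fun_def)
  finally show "integral\<^sup>S (distr M N T) s \<le> (\<integral>\<^sup>+x. f (T x) \<partial>M)" .
qed

lemma nn_integral_cmult_le:
  assumes c: "0 < c"
  shows "(\<integral>\<^sup>+x. ennreal c * f x \<partial>M) \<le> ennreal c * (\<integral>\<^sup>+x. f x \<partial>M)"
  unfolding nn_integral_def[of M "\<lambda>x. ennreal c * f x"]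
proof (rule SUP_least)
  have cc: "ennreal c * (ennreal (1/c) * y) = y" for y
    using c by (simp add: mult.assoc[symmetric] ennreal_mult'[symmetric])
  have cc': "ennreal (1/c) * (ennreal c * y) = y" for y
    using c by (simp add: mult.assoc[symmetric] ennreal_mult'[symmetric])
  fix s assume s: "s \<in> {g. simple_function M g \<and> g \<le> (\<lambda>x. ennreal c * f x)}"
  then have [measurable]: "s \<in> borel_measurable M"
    by (auto dest: borel_measurable_simple_function)
  have "integral\<^sup>S M s = (\<integral>\<^sup>+x. s x \<partial>M)"
    using s by (auto simp: nn_integral_eq_simple_integral)
  also have "\<dots> = (\<integral>\<^sup>+x. ennreal c * (ennreal (1/c) * s x) \<partial>M)" by (simp add: cc)
  also have "\<dots> = ennreal c * (\<integral>\<^sup>+x. ennreal (1/c) * s x \<partial>M)"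
    by (rule nn_integral_cmult) simp
  also have "\<dots> \<le> ennreal c * (\<integral>\<^sup>+x. f x \<partial>M)"
  proof (intro mult_left_mono nn_integral_mono)
    fix x
    have "ennreal (1/c) * s x \<le> ennreal (1/c) * (ennreal c * f x)"
      using s by (intro mult_left_mono) (auto simp: le_fun_def)
    then show "ennreal (1/c) * s x \<le> f x" by (simp add: cc')
  qed simp
  finally show "integral\<^sup>S M s \<le> ennreal c * (\<integral>\<^sup>+x. f x \<partial>M)" .
qed

section \<open>Quantile functions and Wasserstein convergence\<close>

lemma space_lebesgue01 [simp]: "space lebesgue01 = {0<..<1}"
  by (simp add: space_restrict_space)

lemma measurable_lebesgue01I [measurable (raw)]:
  "f \<in> borel \<rightarrow>\<^sub>M N \<Longrightarrow> f \<in> lebesgue01 \<rightarrow>\<^sub>M N"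
  by (intro measurable_restrict_space1) simp

lemma prob_space_lebesgue01: "prob_space lebesgue01"
  by (auto simp add: emeasure_restrict_space space_restrict_space intro!: prob_spaceI)

lemma AE_lebesgue01_iff: "(AE u in lebesgue01. P u) \<longleftrightarrow> (AE u in lborel. 0 < u \<and> u < 1 \<longrightarrow> P u)"
  by (simp add: AE_restrict_space_iff)

lemma AE_lebesgue01_countable:
  assumes "countable A" shows "AE u in lebesgue01. u \<notin> A"
  unfolding AE_lebesgue01_iff using AE_not_in[OF countable_imp_null_set_lborel[OF assms]] by auto

lemma AE_lebesgue01_in: "AE u in lebesgue01. u \<in> {0<..<1}"
  using AE_space[of lebesgue01] by simp

text \<open>
  The quantile is the left-continuous generalised inverse of the distribution function; all
  statements about quantiles below are derived from this Galois connection.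
\<close>

lemma quantile_le_iff:
  assumes "real_distribution \<eta>" "0 < u" "u < 1"
  shows "quantile \<eta> u \<le> x \<longleftrightarrow> u \<le> cdf \<eta> x"
proof -
  interpret cdf_distribution \<eta> using assms(1) by (simp add: cdf_distribution_def)
  show ?thesis unfolding quantile_def by (rule pseudoinverse[OF assms(2,3), symmetric])
qed

lemma quantile_mono:
  assumes "real_distribution \<eta>" "0 < u" "u \<le> v" "v < 1"
  shows "quantile \<eta> u \<le> quantile \<eta> v"
  using quantile_le_iff[OF assms(1), of u "quantile \<eta> v"] quantile_le_iff[OF assms(1), of v "quantile \<eta> v"]
    assms by auto

text \<open>
  Outside of \<open>(0,1)\<close> the defining infimum runs over the full line or the empty set and takes default
  values, constant on each side; the point \<open>1\<close> is treated separately.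
\<close>

lemma measurable_quantile:
  assumes "real_distribution \<eta>"
  shows "quantile \<eta> \<in> borel_measurable borel"
proof -
  interpret cdf_distribution \<eta> using assms(1) by (simp add: cdf_distribution_def)
  define c0 where "c0 = Inf (UNIV :: real set)"
  define c1 where "c1 = quantile \<eta> 1"
  define c2 where "c2 = Inf ({} :: real set)"
  have *: "quantile \<eta> = (\<lambda>u. if u \<in> {0<..<1} then quantile \<eta> u else if u \<le> 0 then c0 else if u = 1 then c1 else c2)"
  proof
    fix u
    have "{x. u \<le> cdf \<eta> x} = UNIV" if "u \<le> 0"
      using that cdf_nonneg order_trans by blast
    moreover have "{x. u \<le> cdf \<eta> x} = {}" if "u > 1"
      using that cdf_bounded_prob by (auto simp: not_le intro: le_less_trans)
    ultimately show "quantile \<eta> u = (if u \<in> {0<..<1} then quantile \<eta> u else if u \<le> 0 then c0 else if u = 1 then c1 else c2)"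
      by (auto simp: quantile_def c0_def c1_def c2_def)
  qed
  have [measurable]: "quantile \<eta> \<in> borel_measurable (restrict_space borel {0<..<1})"
    using measurable_CI by (simp add: quantile_def[abs_def])
  have "(\<lambda>u. if u \<in> {0<..<1} then quantile \<eta> u else if u \<le> 0 then c0 else if u = 1 then c1 else c2)
       \<in> borel_measurable borel"
    by (subst measurable_If_restrict_space_iff)
       (auto intro!: measurable_restrict_space1 simp del: greaterThanLessThan_iff)
  then show ?thesis using * by simp
qed

lemma distr_quantile:
  assumes "real_distribution \<eta>"
  shows "distr lebesgue01 borel (quantile \<eta>) = \<eta>"
proof -
  interpret cdf_distribution \<eta> using assms(1) by (simp add: cdf_distribution_def)
  show ?thesis using distr_I_eq_M by (simp add: quantile_def[abs_def])
qed

lemma nn_integral_quantile: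
  assumes \<eta>: "real_distribution \<eta>" and [measurable]: "f \<in> borel_measurable borel"
  shows "(\<integral>\<^sup>+u. f (quantile \<eta> u) \<partial>lebesgue01) = (\<integral>\<^sup>+x. f x \<partial>\<eta>)"
  using nn_integral_distr[of "quantile \<eta>" lebesgue01 borel f] measurable_lebesgue01I[OF measurable_quantile[OF \<eta>]]
    real_distribution.events_eq_borel[OF \<eta>]
  by (simp add: distr_quantile[OF \<eta>] cong: measurable_cong_sets)

lemma integrable_quantile_iff:
  fixes f :: "real \<Rightarrow> real"
  assumes \<eta>: "real_distribution \<eta>" and [measurable]: "f \<in> borel_measurable borel"
  shows "integrable lebesgue01 (\<lambda>u. f (quantile \<eta> u)) \<longleftrightarrow> integrable \<eta> f"
  using integrable_distr_eq[of "quantile \<eta>" lebesgue01 borel f] measurable_lebesgue01I[OF measurable_quantile[OF \<eta>]]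
  by (simp add: distr_quantile[OF \<eta>])

lemma integral_quantile:
  fixes f :: "real \<Rightarrow> real"
  assumes \<eta>: "real_distribution \<eta>" and [measurable]: "f \<in> borel_measurable borel"
  shows "(\<integral>u. f (quantile \<eta> u) \<partial>lebesgue01) = (\<integral>x. f x \<partial>\<eta>)"
  using integral_distr[of "quantile \<eta>" lebesgue01 borel f] measurable_lebesgue01I[OF measurable_quantile[OF \<eta>]]
  by (simp add: distr_quantile[OF \<eta>])

lemma AE_isCont_quantile:
  assumes "real_distribution \<eta>"
  shows "AE u in lebesgue01. isCont (quantile \<eta>) u"
proof -
  have "mono_on {0<..<1} (quantile \<eta>)"
    by (auto intro!: mono_onI quantile_mono[OF assms])
  from mono_on_ctble_discont_open[OF _ this]
  have "countable {u \<in> {0<..<1}. \<not> isCont (quantile \<eta>) u}" by simp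
  from AE_lebesgue01_countable[OF this] AE_lebesgue01_in show ?thesis
    by eventually_elim auto
qed

lemma ennpowr_mono: "0 < a \<Longrightarrow> x \<le> y \<Longrightarrow> ennpowr x a \<le> ennpowr y a"
  unfolding ennpowr_def
  by (auto simp: top_unique less_top intro!: ennreal_leI powr_mono2 enn2real_mono)

lemma ennpowr_ennpowr_inverse:
  assumes "0 < a" shows "ennpowr (ennpowr x (1 / a)) a = x"
  using assms by (auto simp: ennpowr_def powr_powr less_top)

lemma ennpowr_ennreal: "0 \<le> x \<Longrightarrow> ennpowr (ennreal x) a = ennreal (x powr a)"
  by (simp add: ennpowr_def)

lemma ennpowr_wasserstein_le:
  assumes "0 < \<rho>" "\<pi> \<in> couplings \<eta> \<eta>'"
  shows "ennpowr (wasserstein \<rho> \<eta> \<eta>') \<rho> \<le> (\<integral>\<^sup>+(x, y). ennreal (\<bar>x - y\<bar> powr \<rho>) \<partial>\<pi>)"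
proof -
  have "wasserstein \<rho> \<eta> \<eta>' \<le> ennpowr (\<integral>\<^sup>+(x, y). ennreal (\<bar>x - y\<bar> powr \<rho>) \<partial>\<pi>) (1/\<rho>)"
    unfolding wasserstein_def by (rule INF_lower[OF assms(2)])
  from ennpowr_mono[OF assms(1) this] show ?thesis
    using assms(1) by (simp add: ennpowr_ennpowr_inverse)
qed

lemma wasserstein_lessE:
  assumes "0 < \<rho>" "0 < e" "wasserstein \<rho> \<eta> \<eta>' \<le> ennreal e" "e powr \<rho> < c"
  obtains \<pi> where "\<pi> \<in> couplings \<eta> \<eta>'" "(\<integral>\<^sup>+(x, y). ennreal (\<bar>x - y\<bar> powr \<rho>) \<partial>\<pi>) < ennreal c"
proof -
  have c: "0 < c" using assms(2,4) by (metis le_less_trans powr_ge_zero)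
  have "e = (e powr \<rho>) powr (1/\<rho>)" using assms(1,2) by (simp add: powr_powr)
  also have "\<dots> < c powr (1/\<rho>)" using assms by (intro powr_less_mono2) auto
  finally have "wasserstein \<rho> \<eta> \<eta>' < ennreal (c powr (1/\<rho>))"
    using assms(2,3) by (metis ennreal_lessI le_less_trans less_imp_le powr_ge_zero ennreal_less_iff)
  then obtain \<pi> where \<pi>: "\<pi> \<in> couplings \<eta> \<eta>'"
     and less: "ennpowr (\<integral>\<^sup>+(x, y). ennreal (\<bar>x - y\<bar> powr \<rho>) \<partial>\<pi>) (1/\<rho>) < ennreal (c powr (1/\<rho>))"
    unfolding wasserstein_def INF_less_iff by blast
  have "(\<integral>\<^sup>+(x, y). ennreal (\<bar>x - y\<bar> powr \<rho>) \<partial>\<pi>) < ennreal c"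
  proof (rule ccontr)
    assume "\<not> ?thesis"
    then have "ennreal c \<le> (\<integral>\<^sup>+(x, y). ennreal (\<bar>x - y\<bar> powr \<rho>) \<partial>\<pi>)" by simp
    from ennpowr_mono[OF _ this, of "1/\<rho>"] less assms(1) c show False
      by (simp add: ennpowr_ennreal)
  qed
  with \<pi> that show ?thesis by blast
qed

lemma couplingsD:
  assumes "\<pi> \<in> couplings M N"
  shows "sets \<pi> = sets (M \<Otimes>\<^sub>M N)" "fst \<in> \<pi> \<rightarrow>\<^sub>M M" "snd \<in> \<pi> \<rightarrow>\<^sub>M N"
    "distr \<pi> M fst = M" "distr \<pi> N snd = N"
proof -
  show s: "sets \<pi> = sets (M \<Otimes>\<^sub>M N)" and "distr \<pi> M fst = M" "distr \<pi> N snd = N"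
    using assms by (auto simp: couplings_def)
  show "fst \<in> \<pi> \<rightarrow>\<^sub>M M" "snd \<in> \<pi> \<rightarrow>\<^sub>M N"
    unfolding measurable_cong_sets[OF s refl] by auto
qed

lemma couplings_real:
  assumes "\<pi> \<in> couplings M N" "sets M = sets (borel::real measure)" "sets N = sets (borel::real measure)"
  shows "sets \<pi> = sets (borel \<Otimes>\<^sub>M borel)" "distr \<pi> borel fst = M" "distr \<pi> borel snd = N"
proof -
  show "sets \<pi> = sets (borel \<Otimes>\<^sub>M borel)"
    using couplingsD(1)[OF assms(1)] sets_pair_measure_cong[OF assms(2,3)] by simp
  show "distr \<pi> borel fst = M" "distr \<pi> borel snd = N"
    using couplingsD(4,5)[OF assms(1)] distr_cong[of \<pi> \<pi> borel M fst fst]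
       distr_cong[of \<pi> \<pi> borel N snd snd] assms(2,3) by auto
qed

lemma couplings_nn_integral:
  assumes "\<pi> \<in> couplings M N" "sets M = sets (borel::real measure)" "sets N = sets (borel::real measure)"
    and [measurable]: "f \<in> borel_measurable borel"
  shows "(\<integral>\<^sup>+z. f (fst z) \<partial>\<pi>) = (\<integral>\<^sup>+x. f x \<partial>M)" "(\<integral>\<^sup>+z. f (snd z) \<partial>\<pi>) = (\<integral>\<^sup>+x. f x \<partial>N)"
proof -
  note c = couplings_real[OF assms(1-3)]
  note [measurable_cong] = c(1)
  show "(\<integral>\<^sup>+z. f (fst z) \<partial>\<pi>) = (\<integral>\<^sup>+x. f x \<partial>M)"
    unfolding c(2)[symmetric] by (subst nn_integral_distr) auto
  show "(\<integral>\<^sup>+z. f (snd z) \<partial>\<pi>) = (\<integral>\<^sup>+x. f x \<partial>N)"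
    unfolding c(3)[symmetric] by (subst nn_integral_distr) auto
qed

text \<open>
  By Markov's inequality, a coupling of small cost moves only mass \<open>e\<close> by more than \<open>\<delta>\<close>.
\<close>

lemma coupling_cdf_le:
  assumes \<eta>: "real_distribution \<eta>" and \<eta>': "real_distribution \<eta>'"
    and \<pi>: "\<pi> \<in> couplings \<eta> \<eta>'" and \<rho>: "0 < \<rho>" and \<delta>: "0 < \<delta>" and e: "0 \<le> e"
    and cost: "(\<integral>\<^sup>+(x, y). ennreal (\<bar>x - y\<bar> powr \<rho>) \<partial>\<pi>) \<le> ennreal (\<delta> powr \<rho> * e)"
  shows "cdf \<eta> x \<le> cdf \<eta>' (x + \<delta>) + e" "cdf \<eta>' x \<le> cdf \<eta> (x + \<delta>) + e"
proof -
  interpret \<eta>: real_distribution \<eta> by fact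
  interpret \<eta>': real_distribution \<eta>' by fact
  note c = couplings_real[OF \<pi>, simplified]
  note [measurable_cong] = c(1)
  have sp: "space \<pi> = UNIV" using sets_eq_imp_space_eq[OF c(1)] by (simp add: space_pair_measure)
  interpret \<pi>: prob_space \<pi>
    by (rule prob_space_distrD[of fst _ borel]) (use c(2) \<eta>.prob_space_axioms in auto)
  define S where "S = {z::real\<times>real. \<delta> \<le> \<bar>fst z - snd z\<bar>}"
  have S: "S \<in> sets \<pi>"
  proof -
    have "{z \<in> space \<pi>. \<delta> \<le> \<bar>fst z - snd z\<bar>} \<in> sets \<pi>" by measurable
    then show ?thesis by (simp add: sp S_def)
  qed
  have "emeasure \<pi> S \<le> (\<integral>\<^sup>+z. ennreal (1 / \<delta> powr \<rho>) * (case z of (x, y) \<Rightarrow> ennreal (\<bar>x - y\<bar> powr \<rho>)) \<partial>\<pi>)"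
  proof (subst nn_integral_indicator[OF S, symmetric], rule nn_integral_mono)
    fix z
    show "indicator S z \<le> ennreal (1 / \<delta> powr \<rho>) * (case z of (x, y) \<Rightarrow> ennreal (\<bar>x - y\<bar> powr \<rho>))"
    proof (cases "z \<in> S")
      case True
      then have "\<delta> powr \<rho> \<le> \<bar>fst z - snd z\<bar> powr \<rho>"
        using \<delta> \<rho> by (intro powr_mono2) (auto simp: S_def)
      then have "1 \<le> 1 / \<delta> powr \<rho> * \<bar>fst z - snd z\<bar> powr \<rho>" using \<delta> by (simp add: field_simps)
      then show ?thesis using True
        by (auto simp: split_beta ennreal_mult'[symmetric] ennreal_ge_1)
    qed auto
  qed
  also have "\<dots> \<le> ennreal (1 / \<delta> powr \<rho>) * ennreal (\<delta> powr \<rho> * e)"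
    using cost by (subst nn_integral_cmult) (auto intro!: mult_left_mono simp: split_beta')
  also have "\<dots> = ennreal e"
    using \<delta> e by (simp add: ennreal_mult'[symmetric])
  finally have Se: "measure \<pi> S \<le> e"
    using e by (simp add: \<pi>.emeasure_eq_measure)
  have fst_eq: "cdf \<eta> x = measure \<pi> {z. fst z \<le> x}" for x
    unfolding cdf_def by (subst c(2)[symmetric]) (simp add: measure_distr sp vimage_def)
  have snd_eq: "cdf \<eta>' x = measure \<pi> {z. snd z \<le> x}" for x
    unfolding cdf_def by (subst c(3)[symmetric]) (simp add: measure_distr sp vimage_def)
  have m: "{z. fst z \<le> x} \<in> sets \<pi>" "{z. snd z \<le> x} \<in> sets \<pi>" for x
  proof -
    have "{z \<in> space \<pi>. fst z \<le> x} \<in> sets \<pi>" "{z \<in> space \<pi>. snd z \<le> x} \<in> sets \<pi>" by measurable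
    then show "{z. fst z \<le> x} \<in> sets \<pi>" "{z. snd z \<le> x} \<in> sets \<pi>" by (auto simp: sp)
  qed
  have "measure \<pi> {z. fst z \<le> x} \<le> measure \<pi> ({z. snd z \<le> x + \<delta>} \<union> S)"
    using m S by (intro \<pi>.finite_measure_mono) (auto simp: S_def)
  also have "\<dots> \<le> measure \<pi> {z. snd z \<le> x + \<delta>} + measure \<pi> S"
    using m S by (intro measure_Un_le) auto
  finally show "cdf \<eta> x \<le> cdf \<eta>' (x + \<delta>) + e" using Se by (simp add: fst_eq snd_eq)
  have "measure \<pi> {z. snd z \<le> x} \<le> measure \<pi> ({z. fst z \<le> x + \<delta>} \<union> S)"
    using m S by (intro \<pi>.finite_measure_mono) (auto simp: S_def)
  also have "\<dots> \<le> measure \<pi> {z. fst z \<le> x + \<delta>} + measure \<pi> S"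
    using m S by (intro measure_Un_le) auto
  finally show "cdf \<eta>' x \<le> cdf \<eta> (x + \<delta>) + e" using Se by (simp add: fst_eq snd_eq)
qed

lemma wasserstein_tendsto_coupling:
  assumes "0 < \<rho>" "(\<lambda>n. wasserstein \<rho> (\<eta> n) \<eta>') \<longlonglongrightarrow> 0" "0 < c"
  shows "\<forall>\<^sub>F n in sequentially. \<exists>\<pi>\<in>couplings (\<eta> n) \<eta>'.
     (\<integral>\<^sup>+(x, y). ennreal (\<bar>x - y\<bar> powr \<rho>) \<partial>\<pi>) \<le> ennreal c"
proof -
  \<comment> \<open>any \<open>e\<close> with \<open>e powr \<rho> < c\<close> would do\<close>
  define e where "e = (c/2) powr (1/\<rho>)"
  have e: "0 < e" "e powr \<rho> < c" using assms by (auto simp: e_def powr_powr)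
  from ennreal_tendsto_0_D[OF assms(2) e(1)] show ?thesis
  proof eventually_elim
    case (elim n)
    from wasserstein_lessE[OF assms(1) e(1) this e(2)] show ?case
      by (metis less_imp_le)
  qed
qed

text \<open>
  The argument \<open>U n\<close> may vary with \<open>n\<close>, because below quantile functions are evaluated at the images
  of a point under a sequence of transports. A sandwich between the distribution functions, shifted by
  \<open>e\<close>, transfers the continuity of the limit quantile at \<open>u\<close> to the sequence.
\<close>

lemma quantile_tendsto:
  assumes \<eta>: "\<And>n. real_distribution (\<eta> n)" and \<eta>': "real_distribution \<eta>'" and \<rho>: "0 < \<rho>"
    and W: "(\<lambda>n. wasserstein \<rho> (\<eta> n) \<eta>') \<longlonglongrightarrow> 0"
    and u: "0 < u" "u < 1" "isCont (quantile \<eta>') u" and U: "U \<longlonglongrightarrow> u"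
  shows "(\<lambda>n. quantile (\<eta> n) (U n)) \<longlonglongrightarrow> quantile \<eta>' u"
proof (rule LIMSEQ_I)
  fix r :: real assume r: "0 < r"
  define e where "e = r / 4"
  have e: "0 < e" using r by (simp add: e_def)
  obtain d where d: "0 < d" "\<And>v. \<bar>v - u\<bar> < d \<Longrightarrow> \<bar>quantile \<eta>' v - quantile \<eta>' u\<bar> < e"
    using u(3) e unfolding continuous_at_eps_delta dist_real_def by metis
  define t where "t = min (d / 2) (min (u / 2) ((1 - u) / 2))"
  have t: "0 < t" "t < d" "0 < u - t" "u + t < 1" using d(1) u by (auto simp: t_def min_def field_simps)
  have q1: "quantile \<eta>' (u + t) \<le> quantile \<eta>' u + e" and q2: "quantile \<eta>' u - e < quantile \<eta>' (u - t)"
    using d(2)[of "u + t"] d(2)[of "u - t"] t by auto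
  have c1: "u + t \<le> cdf \<eta>' (quantile \<eta>' u + e)"
    using quantile_le_iff[OF \<eta>', of "u + t"] q1 t u by auto
  have c2: "cdf \<eta>' (quantile \<eta>' u - e) < u - t"
    using quantile_le_iff[OF \<eta>', of "u - t" "quantile \<eta>' u - e"] q2 t u by auto
  have "0 < e powr \<rho> * (t/2)" using e t by simp
  note ev1 = wasserstein_tendsto_coupling[OF \<rho> W this]
  have ev2: "\<forall>\<^sub>F n in sequentially. U n < u + t/2" "\<forall>\<^sub>F n in sequentially. u - t/2 < U n"
    using order_tendstoD[OF U] t by auto
  from ev1 ev2 have "\<forall>\<^sub>F n in sequentially. norm (quantile (\<eta> n) (U n) - quantile \<eta>' u) < r"
  proof eventually_elim
    case (elim n)
    then obtain \<pi> where \<pi>: "\<pi> \<in> couplings (\<eta> n) \<eta>'"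
       "(\<integral>\<^sup>+(x, y). ennreal (\<bar>x - y\<bar> powr \<rho>) \<partial>\<pi>) \<le> ennreal (e powr \<rho> * (t/2))" by auto
    from elim have U: "U n < u + t/2" "u - t/2 < U n" using t by auto
    note cdf = coupling_cdf_le[OF \<eta> \<eta>' \<pi>(1) \<rho> e _ \<pi>(2)]
    have "U n \<le> cdf (\<eta> n) (quantile \<eta>' u + 2 * e)"
      using cdf(2)[of "quantile \<eta>' u + e"] c1 U t by (simp add: add.assoc)
    moreover have "cdf (\<eta> n) (quantile \<eta>' u - 2 * e) < U n"
      using cdf(1)[of "quantile \<eta>' u - 2 * e"] c2 U t by (simp add: add.assoc)
    moreover have "0 < U n" "U n < 1" using U t u by auto
    ultimately have "quantile (\<eta> n) (U n) \<le> quantile \<eta>' u + 2 * e"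
      "\<not> quantile (\<eta> n) (U n) \<le> quantile \<eta>' u - 2 * e"
      using quantile_le_iff[OF \<eta>] by auto
    then show ?case using e by (auto simp: e_def)
  qed
  then show "\<exists>no. \<forall>n\<ge>no. norm (quantile (\<eta> n) (U n) - quantile \<eta>' u) < r"
    by (simp add: eventually_sequentially)
qed

section \<open>Convergence of quantile functions in the mean\<close>

lemma powr_le_add_one:
  assumes "1 \<le> \<rho>" "0 \<le> x" shows "(x::real) \<le> x powr \<rho> + 1"
proof (cases "x \<le> 1")
  case False
  then show ?thesis using powr_mono[OF assms(1), of x] by simp
qed (simp add: add_increasing)

lemma powr_add_le:
  fixes x y :: real
  assumes "0 \<le> x" "0 \<le> y" "0 \<le> p"
  shows "(x + y) powr p \<le> 2 powr p * (x powr p + y powr p)"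
proof -
  have "(x + y) powr p \<le> (2 * max x y) powr p"
    using assms by (intro powr_mono2) auto
  also have "\<dots> = 2 powr p * max x y powr p" using assms by (simp add: powr_mult)
  also have "\<dots> \<le> 2 powr p * (x powr p + y powr p)"
    by (intro mult_left_mono) (auto simp: max_def)
  finally show ?thesis .
qed

lemma abs_powr_add_le:
  fixes x y :: real
  assumes "0 \<le> p" shows "\<bar>x + y\<bar> powr p \<le> 2 powr p * (\<bar>x\<bar> powr p + \<bar>y\<bar> powr p)"
  by (rule order_trans[OF powr_mono2 powr_add_le]) (use assms in auto)

lemma abs_powr_diff_le:
  fixes x y :: real
  assumes "0 \<le> p" shows "\<bar>x - y\<bar> powr p \<le> 2 powr p * (\<bar>x\<bar> powr p + \<bar>y\<bar> powr p)"
  using abs_powr_add_le[OF assms, of x "-y"] by simp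

text \<open>
  Convexity of the power at the points \<open>a / (1 - t)\<close> and \<open>b / t\<close>. As \<open>t\<close> tends to \<open>0\<close> the factor of
  \<open>a powr \<rho>\<close> tends to \<open>1\<close>, which is what makes the moments converge.
\<close>

lemma powr_add_le_weighted:
  fixes a b :: real
  assumes "0 \<le> a" "0 \<le> b" "1 \<le> \<rho>" "0 < t" "t < 1"
  shows "(a + b) powr \<rho> \<le> (1 - t) powr (1 - \<rho>) * a powr \<rho> + t powr (1 - \<rho>) * b powr \<rho>"
proof -
  have ge1: "1 \<le> s powr (1 - \<rho>)" if "0 < s" "s < 1" for s :: real
    using that assms(3) powr_mono2'[of "1 - \<rho>" s 1] by simp
  consider "a = 0" | "b = 0" | "0 < a" "0 < b" using assms by fastforce
  then show ?thesis
  proof cases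
    case 1
    then show ?thesis using mult_right_mono[OF ge1[of t], of "b powr \<rho>"] assms by simp
  next
    case 2
    then show ?thesis using mult_right_mono[OF ge1[of "1 - t"], of "a powr \<rho>"] assms by simp
  next
    case 3
    have "((1 - t) *\<^sub>R (a / (1 - t)) + t *\<^sub>R (b / t)) powr \<rho> \<le>
        (1 - t) * (a / (1 - t)) powr \<rho> + t * (b / t) powr \<rho>"
      using powr_convex[OF assms(3)] 3 assms(4,5) by (intro convex_onD) auto
    also have "(1 - t) *\<^sub>R (a / (1 - t)) + t *\<^sub>R (b / t) = a + b" using assms by simp
    also have "(1 - t) * (a / (1 - t)) powr \<rho> = (1 - t) powr (1 - \<rho>) * a powr \<rho>"
      using assms 3 by (simp add: powr_divide powr_diff)
    also have "t * (b / t) powr \<rho> = t powr (1 - \<rho>) * b powr \<rho>"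
      using assms 3 by (simp add: powr_divide powr_diff)
    finally show ?thesis .
  qed
qed

text \<open>
  Applied to \<open>\<bar>x\<bar> \<le> \<bar>y\<bar> + \<bar>x - y\<bar>\<close> under a coupling, the weighted inequality bounds the moment of \<open>\<eta> n\<close> by
  nearly the moment of \<open>\<eta>'\<close> plus a multiple of the cost; it replaces Minkowski's inequality.
\<close>

lemma wasserstein_moment_limsup:
  fixes \<eta> :: "nat \<Rightarrow> real measure"
  assumes \<eta>: "\<And>n. real_distribution (\<eta> n)" and \<eta>': "real_distribution \<eta>'" and \<rho>: "1 \<le> \<rho>"
    and W: "(\<lambda>n. wasserstein \<rho> (\<eta> n) \<eta>') \<longlonglongrightarrow> 0"
    and fin: "(\<integral>\<^sup>+x. ennreal (\<bar>x\<bar> powr \<rho>) \<partial>\<eta>') < \<infinity>" and e: "0 < (e::real)"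
  shows "\<forall>\<^sub>F n in sequentially. (\<integral>\<^sup>+x. ennreal (\<bar>x\<bar> powr \<rho>) \<partial>\<eta> n) \<le>
     (\<integral>\<^sup>+x. ennreal (\<bar>x\<bar> powr \<rho>) \<partial>\<eta>') + ennreal e"
proof -
  obtain K where K: "0 \<le> K" "(\<integral>\<^sup>+x. ennreal (\<bar>x\<bar> powr \<rho>) \<partial>\<eta>') = ennreal K"
    using fin by (metis ennreal_cases infinity_ennreal_def less_irrefl)
  have "((\<lambda>t. (1 - t) powr (1 - \<rho>) * K) \<longlongrightarrow> (1 - 0) powr (1 - \<rho>) * K) (at_right 0)"
    by (intro tendsto_intros) auto
  then have "\<forall>\<^sub>F t in at_right 0. (1 - t) powr (1 - \<rho>) * K < K + e/2"
    using e by (intro order_tendstoD(2)[where y = K]) auto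
  moreover have "\<forall>\<^sub>F t::real in at_right 0. 0 < t \<and> t < 1"
    unfolding eventually_at_right_field by (rule exI[of _ 1]) simp
  ultimately have "\<forall>\<^sub>F t in at_right 0. (1 - t) powr (1 - \<rho>) * K < K + e/2 \<and> 0 < t \<and> t < 1"
    by eventually_elim auto
  then obtain t where t: "(1 - t) powr (1 - \<rho>) * K < K + e/2" "0 < t" "t < 1"
    using eventually_happens'[OF trivial_limit_at_right_real] by blast
  \<comment> \<open>so that the cost term, multiplied by its factor, contributes at most \<open>e/2\<close>\<close>
  define c where "c = (e/2) / t powr (1 - \<rho>)"
  have c: "0 < c" using e t by (simp add: c_def)
  have "0 < \<rho>" using \<rho> by simp
  from wasserstein_tendsto_coupling[OF this W c] show ?thesis
  proof eventually_elim
    case (elim n)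
    then obtain \<pi> where \<pi>: "\<pi> \<in> couplings (\<eta> n) \<eta>'"
      and cost: "(\<integral>\<^sup>+(x, y). ennreal (\<bar>x - y\<bar> powr \<rho>) \<partial>\<pi>) \<le> ennreal c" by auto
    have s: "sets (\<eta> n) = sets borel" "sets \<eta>' = sets borel"
      using real_distribution.events_eq_borel \<eta> \<eta>' by auto
    note [measurable_cong] = couplings_real(1)[OF \<pi> s]
    note int = couplings_nn_integral[OF \<pi> s, of "\<lambda>x. ennreal (\<bar>x\<bar> powr \<rho>)", symmetric]
    have "(\<integral>\<^sup>+x. ennreal (\<bar>x\<bar> powr \<rho>) \<partial>\<eta> n) = (\<integral>\<^sup>+z. ennreal (\<bar>fst z\<bar> powr \<rho>) \<partial>\<pi>)"
      using int(1) by simp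
    also have "\<dots> \<le> (\<integral>\<^sup>+z. ennreal ((1 - t) powr (1 - \<rho>)) * ennreal (\<bar>snd z\<bar> powr \<rho>) +
         ennreal (t powr (1 - \<rho>)) * ennreal (\<bar>fst z - snd z\<bar> powr \<rho>) \<partial>\<pi>)"
    proof (rule nn_integral_mono)
      fix z :: "real \<times> real"
      have "\<bar>fst z\<bar> powr \<rho> \<le> (\<bar>snd z\<bar> + \<bar>fst z - snd z\<bar>) powr \<rho>"
        using \<rho> by (intro powr_mono2) auto
      also have "\<dots> \<le> (1 - t) powr (1 - \<rho>) * \<bar>snd z\<bar> powr \<rho> + t powr (1 - \<rho>) * \<bar>fst z - snd z\<bar> powr \<rho>"
        using \<rho> t by (intro powr_add_le_weighted) auto
      finally show "ennreal (\<bar>fst z\<bar> powr \<rho>) \<le> ennreal ((1 - t) powr (1 - \<rho>)) * ennreal (\<bar>snd z\<bar> powr \<rho>) +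
         ennreal (t powr (1 - \<rho>)) * ennreal (\<bar>fst z - snd z\<bar> powr \<rho>)"
        by (simp add: ennreal_mult[symmetric] ennreal_plus[symmetric] ennreal_leI del: ennreal_plus)
    qed
    also have "\<dots> = ennreal ((1 - t) powr (1 - \<rho>)) * (\<integral>\<^sup>+z. ennreal (\<bar>snd z\<bar> powr \<rho>) \<partial>\<pi>) +
         ennreal (t powr (1 - \<rho>)) * (\<integral>\<^sup>+z. ennreal (\<bar>fst z - snd z\<bar> powr \<rho>) \<partial>\<pi>)"
      by (subst nn_integral_add) (auto simp: nn_integral_cmult)
    also have "\<dots> \<le> ennreal ((1 - t) powr (1 - \<rho>)) * ennreal K + ennreal (t powr (1 - \<rho>)) * ennreal c"
      using cost K int(2) by (intro add_mono mult_left_mono) (auto simp: split_beta')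
    also have "\<dots> = ennreal ((1 - t) powr (1 - \<rho>) * K + t powr (1 - \<rho>) * c)"
      using K c by (simp add: ennreal_mult)
    also have "\<dots> \<le> ennreal (K + e)"
      using t by (intro ennreal_leI) (simp add: c_def)
    finally show ?case using K e by simp
  qed
qed

context
  fixes \<eta> :: "nat \<Rightarrow> real measure" and \<eta>' :: "real measure" and \<rho> :: real
  assumes \<eta>: "\<And>n. real_distribution (\<eta> n)" and \<eta>': "real_distribution \<eta>'" and \<rho>: "1 \<le> \<rho>"
    and W: "(\<lambda>n. wasserstein \<rho> (\<eta> n) \<eta>') \<longlonglongrightarrow> 0"
    and fin: "(\<integral>\<^sup>+x. ennreal (\<bar>x\<bar> powr \<rho>) \<partial>\<eta>') < \<infinity>"
begin

lemma AE_quantile_tendsto: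
  "AE u in lebesgue01. (\<lambda>n. quantile (\<eta> n) u) \<longlonglongrightarrow> quantile \<eta>' u"
  using AE_isCont_quantile[OF \<eta>'] AE_lebesgue01_in
proof eventually_elim
  case (elim u)
  then show ?case using \<rho> by (intro quantile_tendsto[OF \<eta> \<eta>' _ W]) auto
qed

lemma quantile_abs_powr_L1_tendsto:
  "(\<lambda>n. \<integral>\<^sup>+u. ennreal \<bar>\<bar>quantile (\<eta> n) u\<bar> powr \<rho> - \<bar>quantile \<eta>' u\<bar> powr \<rho>\<bar> \<partial>lebesgue01) \<longlonglongrightarrow> 0"
proof (rule Scheffe_limsup)
  note [measurable] = measurable_quantile[OF \<eta>] measurable_quantile[OF \<eta>']
  show "(\<lambda>u. \<bar>quantile (\<eta> n) u\<bar> powr \<rho>) \<in> borel_measurable lebesgue01" for n by measurable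
  show "(\<lambda>u. \<bar>quantile \<eta>' u\<bar> powr \<rho>) \<in> borel_measurable lebesgue01" by measurable
  have eq: "(\<integral>\<^sup>+u. ennreal (\<bar>quantile \<theta> u\<bar> powr \<rho>) \<partial>lebesgue01) = (\<integral>\<^sup>+x. ennreal (\<bar>x\<bar> powr \<rho>) \<partial>\<theta>)"
    if "real_distribution \<theta>" for \<theta>
    by (rule nn_integral_quantile[OF that]) simp
  show "(\<integral>\<^sup>+u. ennreal (\<bar>quantile \<eta>' u\<bar> powr \<rho>) \<partial>lebesgue01) < \<infinity>"
    using fin by (simp add: eq \<eta>')
  show "AE u in lebesgue01. \<bar>quantile \<eta>' u\<bar> powr \<rho> \<noteq> 0 \<longrightarrow>
     (\<lambda>n. \<bar>quantile (\<eta> n) u\<bar> powr \<rho>) \<longlonglongrightarrow> \<bar>quantile \<eta>' u\<bar> powr \<rho>"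
    using AE_quantile_tendsto by eventually_elim (use \<rho> in \<open>auto intro!: tendsto_intros\<close>)
  show "\<forall>\<^sub>F n in sequentially.
       (\<integral>\<^sup>+u. ennreal (\<bar>quantile (\<eta> n) u\<bar> powr \<rho>) \<partial>lebesgue01)
       \<le> (\<integral>\<^sup>+u. ennreal (\<bar>quantile \<eta>' u\<bar> powr \<rho>) \<partial>lebesgue01) + ennreal e" if "0 < e" for e
    using wasserstein_moment_limsup[OF \<eta> \<eta>' \<rho> W fin that] by (simp add: eq \<eta> \<eta>')
qed auto

lemma quantile_powr_diff_tendsto_0:
  "(\<lambda>n. \<integral>\<^sup>+u. ennreal (\<bar>quantile (\<eta> n) u - quantile \<eta>' u\<bar> powr \<rho>) \<partial>lebesgue01) \<longlonglongrightarrow> 0"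
proof (rule nn_integral_tendsto_0_dominated[where
    E = "\<lambda>n u. 2 powr \<rho> * \<bar>\<bar>quantile (\<eta> n) u\<bar> powr \<rho> - \<bar>quantile \<eta>' u\<bar> powr \<rho>\<bar>"
    and D = "\<lambda>u. 2 powr \<rho> * (2 * \<bar>quantile \<eta>' u\<bar> powr \<rho>)"])
  note [measurable] = measurable_quantile[OF \<eta>] measurable_quantile[OF \<eta>']
  show "(\<lambda>u. \<bar>quantile (\<eta> n) u - quantile \<eta>' u\<bar> powr \<rho>) \<in> borel_measurable lebesgue01"
    "(\<lambda>u. 2 powr \<rho> * \<bar>\<bar>quantile (\<eta> n) u\<bar> powr \<rho> - \<bar>quantile \<eta>' u\<bar> powr \<rho>\<bar>) \<in> borel_measurable lebesgue01"
    "(\<lambda>u. 2 powr \<rho> * (2 * \<bar>quantile \<eta>' u\<bar> powr \<rho>)) \<in> borel_measurable lebesgue01" for n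
    by measurable
  show "AE u in lebesgue01. 0 \<le> \<bar>quantile (\<eta> n) u - quantile \<eta>' u\<bar> powr \<rho> \<and>
       0 \<le> 2 powr \<rho> * \<bar>\<bar>quantile (\<eta> n) u\<bar> powr \<rho> - \<bar>quantile \<eta>' u\<bar> powr \<rho>\<bar> \<and>
       \<bar>quantile (\<eta> n) u - quantile \<eta>' u\<bar> powr \<rho>
       \<le> 2 powr \<rho> * \<bar>\<bar>quantile (\<eta> n) u\<bar> powr \<rho> - \<bar>quantile \<eta>' u\<bar> powr \<rho>\<bar> +
         2 powr \<rho> * (2 * \<bar>quantile \<eta>' u\<bar> powr \<rho>)" for n
  proof (rule AE_I2, intro conjI)
    fix u
    have "\<bar>quantile (\<eta> n) u - quantile \<eta>' u\<bar> powr \<rho>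
       \<le> 2 powr \<rho> * (\<bar>quantile (\<eta> n) u\<bar> powr \<rho> + \<bar>quantile \<eta>' u\<bar> powr \<rho>)"
      using \<rho> by (intro abs_powr_diff_le) auto
    also have "\<dots> \<le> 2 powr \<rho> * (\<bar>\<bar>quantile (\<eta> n) u\<bar> powr \<rho> - \<bar>quantile \<eta>' u\<bar> powr \<rho>\<bar> + 2 * \<bar>quantile \<eta>' u\<bar> powr \<rho>)"
      by (intro mult_left_mono) auto
    finally show "\<bar>quantile (\<eta> n) u - quantile \<eta>' u\<bar> powr \<rho>
       \<le> 2 powr \<rho> * \<bar>\<bar>quantile (\<eta> n) u\<bar> powr \<rho> - \<bar>quantile \<eta>' u\<bar> powr \<rho>\<bar> +
         2 powr \<rho> * (2 * \<bar>quantile \<eta>' u\<bar> powr \<rho>)" by (simp only: distrib_left)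
  qed auto
  have "(\<integral>\<^sup>+u. ennreal (2 powr \<rho> * (2 * \<bar>quantile \<eta>' u\<bar> powr \<rho>)) \<partial>lebesgue01)
      = ennreal (2 powr \<rho> * 2) * (\<integral>\<^sup>+x. ennreal (\<bar>x\<bar> powr \<rho>) \<partial>\<eta>')"
    by (subst nn_integral_quantile[OF \<eta>', symmetric])
      (auto simp: nn_integral_cmult[symmetric] ennreal_mult' mult.assoc)
  also have "\<dots> < \<infinity>" using fin by (simp add: ennreal_mult_less_top)
  finally show "(\<integral>\<^sup>+u. ennreal (2 powr \<rho> * (2 * \<bar>quantile \<eta>' u\<bar> powr \<rho>)) \<partial>lebesgue01) < \<infinity>" .
  have "(\<lambda>n. ennreal (2 powr \<rho>) * (\<integral>\<^sup>+u. ennreal \<bar>\<bar>quantile (\<eta> n) u\<bar> powr \<rho> - \<bar>quantile \<eta>' u\<bar> powr \<rho>\<bar> \<partial>lebesgue01))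
      \<longlonglongrightarrow> ennreal (2 powr \<rho>) * 0"
    by (intro ennreal_tendsto_cmult quantile_abs_powr_L1_tendsto) auto
  then show "(\<lambda>n. \<integral>\<^sup>+u. ennreal (2 powr \<rho> * \<bar>\<bar>quantile (\<eta> n) u\<bar> powr \<rho> - \<bar>quantile \<eta>' u\<bar> powr \<rho>\<bar>) \<partial>lebesgue01) \<longlonglongrightarrow> 0"
    by (simp add: nn_integral_cmult ennreal_mult')
  show "AE u in lebesgue01. (\<lambda>n. min (\<bar>quantile (\<eta> n) u - quantile \<eta>' u\<bar> powr \<rho>)
       (2 powr \<rho> * (2 * \<bar>quantile \<eta>' u\<bar> powr \<rho>))) \<longlonglongrightarrow> 0"
    using AE_quantile_tendsto
  proof eventually_elim
    case (elim u)
    have "(\<lambda>n. min (\<bar>quantile (\<eta> n) u - quantile \<eta>' u\<bar> powr \<rho>)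
       (2 powr \<rho> * (2 * \<bar>quantile \<eta>' u\<bar> powr \<rho>))) \<longlonglongrightarrow> min (\<bar>quantile \<eta>' u - quantile \<eta>' u\<bar> powr \<rho>) (2 powr \<rho> * (2 * \<bar>quantile \<eta>' u\<bar> powr \<rho>))"
      using \<rho> by (intro tendsto_intros elim tendsto_powr2) auto
    then show ?case by simp
  qed
qed auto

lemma quantile_L1_tendsto:
  "(\<lambda>n. \<integral>\<^sup>+u. ennreal \<bar>quantile (\<eta> n) u - quantile \<eta>' u\<bar> \<partial>lebesgue01) \<longlonglongrightarrow> 0"
proof (rule nn_integral_tendsto_0_dominated[where
    E = "\<lambda>n u. \<bar>quantile (\<eta> n) u - quantile \<eta>' u\<bar> powr \<rho>" and D = "\<lambda>_. 1"])
  note [measurable] = measurable_quantile[OF \<eta>] measurable_quantile[OF \<eta>']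
  show "(\<lambda>u. \<bar>quantile (\<eta> n) u - quantile \<eta>' u\<bar>) \<in> borel_measurable lebesgue01"
    "(\<lambda>u. \<bar>quantile (\<eta> n) u - quantile \<eta>' u\<bar> powr \<rho>) \<in> borel_measurable lebesgue01" for n
    by measurable
  show "AE u in lebesgue01. 0 \<le> \<bar>quantile (\<eta> n) u - quantile \<eta>' u\<bar> \<and>
        0 \<le> \<bar>quantile (\<eta> n) u - quantile \<eta>' u\<bar> powr \<rho> \<and>
        \<bar>quantile (\<eta> n) u - quantile \<eta>' u\<bar> \<le> \<bar>quantile (\<eta> n) u - quantile \<eta>' u\<bar> powr \<rho> + 1" for n
    by (intro AE_I2 conjI powr_le_add_one[OF \<rho>]) auto
  show "(\<integral>\<^sup>+u. ennreal 1 \<partial>lebesgue01) < \<infinity>"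
    by (simp add: emeasure_restrict_space)
  show "AE u in lebesgue01. (\<lambda>n. min \<bar>quantile (\<eta> n) u - quantile \<eta>' u\<bar> 1) \<longlonglongrightarrow> 0"
    using AE_quantile_tendsto
  proof eventually_elim
    case (elim u)
    have "(\<lambda>n. min \<bar>quantile (\<eta> n) u - quantile \<eta>' u\<bar> 1) \<longlonglongrightarrow> min \<bar>quantile \<eta>' u - quantile \<eta>' u\<bar> 1"
      by (intro tendsto_intros elim)
    then show ?case by simp
  qed
qed (use quantile_powr_diff_tendsto_0 in auto)

end

section \<open>Increasing transport between two densities on the unit interval\<close>

definition primitive01 :: "(real \<Rightarrow> real) \<Rightarrow> real \<Rightarrow> real" where
  "primitive01 a u = (LBINT v:{0<..<u}. a v)"

lemma set_integrable_subinterval: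
  assumes "integrable lebesgue01 a" "0 \<le> s" "t \<le> 1"
  shows "set_integrable lborel {s<..<t} (a :: real \<Rightarrow> real)"
proof (rule set_integrable_subset)
  show "set_integrable lborel {0<..<1} a"
    using assms(1) by (subst (asm) integrable_restrict_space) (auto simp: set_integrable_def)
qed (use assms in auto)

lemma primitive01_0 [simp]: "primitive01 a 0 = 0"
  by (simp add: primitive01_def set_lebesgue_integral_def)

lemma primitive01_eq:
  assumes "integrable lebesgue01 a" "0 \<le> s" "s \<le> 1"
  shows "primitive01 a s = (\<integral>v. indicator {..<s} v * a v \<partial>lebesgue01)"
  unfolding primitive01_def set_lebesgue_integral_def
  by (subst integral_restrict_space)
    (use assms in \<open>auto intro!: Bochner_Integration.integral_cong simp: indicator_def\<close>)

lemma integrable_indicator_lessThan: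
  fixes c :: "real \<Rightarrow> real"
  assumes "integrable lebesgue01 c"
  shows "integrable lebesgue01 (\<lambda>v. indicator {..<s} v * c v)"
proof -
  have "{..<s} \<inter> {0<..<1} \<in> sets lebesgue01" by (auto simp: sets_restrict_space_iff)
  then have "integrable lebesgue01 (\<lambda>v. indicator ({..<s} \<inter> {0<..<1}) v *\<^sub>R c v)"
    using assms by (intro integrable_mult_indicator)
  then show "integrable lebesgue01 (\<lambda>v. indicator {..<s} v * c v)"
    by (rule Bochner_Integration.integrable_cong[THEN iffD1, rotated -1]) (auto simp: indicator_def)
qed

lemma continuous_on_primitive01:
  assumes "integrable lebesgue01 a"
  shows "continuous_on {0..1} (primitive01 a)"
proof -
  have si: "set_integrable lborel {0<..<u} a" if "u \<le> 1" for u
    using set_integrable_subinterval[OF assms _ that, of 0] by simp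
  have "a integrable_on {0<..<1}"
    using set_borel_integral_eq_integral(1)[OF si] by simp
  then have "a integrable_on {0..1}" by (simp add: integrable_on_open_interval_real)
  from indefinite_integral_continuous_1[OF this]
  have "continuous_on {0..1} (\<lambda>x. integral {0..x} a)" .
  moreover have "primitive01 a u = integral {0..u} a" if "u \<in> {0..1}" for u
    unfolding primitive01_def
    using set_borel_integral_eq_integral(2)[OF si] that by (simp add: integral_open_interval_real)
  ultimately show ?thesis by (subst continuous_on_cong[OF refl]) auto
qed

context
  fixes a :: "real \<Rightarrow> real"
  assumes a: "integrable lebesgue01 a" and a0: "\<And>u. 0 \<le> a u"
begin

lemma emeasure_density_primitive01:
  assumes s: "0 \<le> s" "s \<le> 1"
  shows "emeasure (density lebesgue01 a) ({..s} \<inter> {0<..<1}) = ennreal (primitive01 a s)"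
proof -
  have [measurable]: "a \<in> borel_measurable lebesgue01" using a by auto
  have [measurable]: "{..s} \<inter> {0<..<1} \<in> sets lebesgue01"
    by (auto simp: sets_restrict_space_iff)
  have "emeasure (density lebesgue01 a) ({..s} \<inter> {0<..<1}) =
      (\<integral>\<^sup>+v. ennreal (a v) * indicator ({..s} \<inter> {0<..<1}) v \<partial>lebesgue01)"
    by (rule emeasure_density) auto
  also have "\<dots> = (\<integral>\<^sup>+v. ennreal (indicator {..<s} v * a v) \<partial>lebesgue01)"
  proof (rule nn_integral_cong_AE)
    have "AE v in lebesgue01. v \<notin> {s}" by (intro AE_lebesgue01_countable) auto
    then show "AE v in lebesgue01. ennreal (a v) * indicator ({..s} \<inter> {0<..<1}) v = ennreal (indicator {..<s} v * a v)"
      using AE_lebesgue01_in by eventually_elim (auto simp: indicator_def)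
  qed
  also have "\<dots> = ennreal (\<integral>v. indicator {..<s} v * a v \<partial>lebesgue01)"
  proof (rule nn_integral_eq_integral[OF integrable_indicator_lessThan[OF a]])
  qed (use a0 in auto)
  finally show ?thesis using primitive01_eq[OF a s] by simp
qed

lemma primitive01_nonneg: "0 \<le> primitive01 a s"
  unfolding primitive01_def set_lebesgue_integral_def
  by (rule Bochner_Integration.integral_nonneg) (simp add: a0)

lemma primitive01_mono:
  assumes "0 \<le> s" "s \<le> t" "t \<le> 1"
  shows "primitive01 a s \<le> primitive01 a t"
proof -
  have "{..t} \<inter> {0<..<1} \<in> sets (density lebesgue01 a)" by (auto simp: sets_restrict_space_iff)
  then have "emeasure (density lebesgue01 a) ({..s} \<inter> {0<..<1}) \<le> emeasure (density lebesgue01 a) ({..t} \<inter> {0<..<1})"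
    using assms by (intro emeasure_mono) auto
  then show ?thesis using assms primitive01_nonneg by (simp add: emeasure_density_primitive01)
qed

text \<open>
  Continuity of the primitive makes the infimum that defines the left inverse a minimum, so
  that the inverse is exact and forms a Galois connection with the primitive.
\<close>

lemma left_inverse01_primitive01:
  assumes w: "0 \<le> w" "w \<le> primitive01 a 1"
  shows "0 \<le> left_inverse01 (primitive01 a) w" "left_inverse01 (primitive01 a) w \<le> 1"
    "primitive01 a (left_inverse01 (primitive01 a) w) = w"
    "\<And>x. 0 \<le> x \<Longrightarrow> x \<le> 1 \<Longrightarrow> left_inverse01 (primitive01 a) w \<le> x \<longleftrightarrow> w \<le> primitive01 a x"
proof -
  define S where "S = {r \<in> {0..1}. w \<le> primitive01 a r}"
  have "closed ({0..1} \<inter> primitive01 a -` {w..})"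
    by (intro continuous_closed_preimage continuous_on_primitive01 a) auto
  moreover have "{0..1} \<inter> primitive01 a -` {w..} = S" by (auto simp: S_def)
  ultimately have cl: "closed S" by simp
  have ne: "S \<noteq> {}" using w by (auto simp: S_def)
  have bdd: "bdd_below S" by (auto simp: S_def)
  have inv: "left_inverse01 (primitive01 a) w = Inf S" by (simp add: left_inverse01_def S_def)
  have InfS: "Inf S \<in> S" by (rule closed_contains_Inf[OF ne bdd cl])
  show 1: "0 \<le> left_inverse01 (primitive01 a) w" "left_inverse01 (primitive01 a) w \<le> 1"
    using InfS unfolding inv S_def by auto
  show iff: "left_inverse01 (primitive01 a) w \<le> x \<longleftrightarrow> w \<le> primitive01 a x" if "0 \<le> x" "x \<le> 1" for x
  proof
    assume "left_inverse01 (primitive01 a) w \<le> x"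
    then have "primitive01 a (Inf S) \<le> primitive01 a x"
      using 1 that unfolding inv by (intro primitive01_mono)
    then show "w \<le> primitive01 a x" using InfS by (auto simp: S_def)
  next
    assume "w \<le> primitive01 a x"
    then show "left_inverse01 (primitive01 a) w \<le> x"
      unfolding inv using that by (intro cInf_lower bdd) (auto simp: S_def)
  qed
  obtain r where r: "0 \<le> r" "r \<le> 1" "primitive01 a r = w"
    using IVT'[of "primitive01 a" 0 w 1] w continuous_on_primitive01[OF a] by auto
  have "primitive01 a (Inf S) \<le> primitive01 a r"
    using iff[of r] r 1 unfolding inv by (intro primitive01_mono) auto
  with InfS r show "primitive01 a (left_inverse01 (primitive01 a) w) = w"
    unfolding inv by (auto simp: S_def)
qed

text \<open>
  Almost every point of \<open>{a > 0}\<close> is not followed by a flat piece of the primitive: a piece that ends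
  at \<open>y\<close> starts at \<open>s\<close>, the least point with the same value, and carries no \<open>a\<close>-mass. Countably many
  rational \<open>y\<close> detect all flat pieces.
\<close>

lemma AE_primitive01_strict:
  "AE v in lebesgue01. 0 < a v \<longrightarrow> (\<forall>y. v < y \<longrightarrow> y \<le> 1 \<longrightarrow> primitive01 a v < primitive01 a y)"
proof -
  have [measurable]: "a \<in> borel_measurable lebesgue01" using a by auto
  have *: "AE v in lebesgue01. v < y \<longrightarrow> primitive01 a v = primitive01 a y \<longrightarrow> a v = 0"
    if y: "0 < y" "y \<le> 1" for y
  proof -
    define s where "s = left_inverse01 (primitive01 a) (primitive01 a y)"
    note inv = left_inverse01_primitive01[of "primitive01 a y", folded s_def]
    have w: "0 \<le> primitive01 a y" "primitive01 a y \<le> primitive01 a 1"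
      using y primitive01_nonneg primitive01_mono by auto
    have s: "0 \<le> s" "s \<le> y" "primitive01 a s = primitive01 a y" using inv w y by auto
    have m: "{..s} \<inter> {0<..<1} \<in> sets lebesgue01" "{s<..y} \<inter> {0<..<1} \<in> sets lebesgue01"
      by (auto simp: sets_restrict_space_iff)
    have "emeasure (density lebesgue01 a) ({..y} \<inter> {0<..<1}) =
       emeasure (density lebesgue01 a) ({..s} \<inter> {0<..<1}) + emeasure (density lebesgue01 a) ({s<..y} \<inter> {0<..<1})"
      using s m by (subst plus_emeasure) (auto intro!: arg_cong2[where f = emeasure])
    then have "emeasure (density lebesgue01 a) ({s<..y} \<inter> {0<..<1}) = 0"
      using s y ennreal_add_left_cancel[of "ennreal (primitive01 a y)" 0]
      by (auto simp: emeasure_density_primitive01)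
    then have "{s<..y} \<inter> {0<..<1} \<in> null_sets (density lebesgue01 a)"
      using m by (auto simp: null_sets_def)
    then have "AE v in lebesgue01. v \<in> {s<..y} \<inter> {0<..<1} \<longrightarrow> ennreal (a v) = 0"
      by (subst (asm) null_sets_density_iff) auto
    moreover have "AE v in lebesgue01. v \<notin> {s}" by (intro AE_lebesgue01_countable) auto
    ultimately show ?thesis using AE_lebesgue01_in
    proof eventually_elim
      case (elim v)
      show ?case
      proof (intro impI)
        assume v: "v < y" "primitive01 a v = primitive01 a y"
        have "s \<le> v" using inv(4)[OF w, of v] v elim(3) by auto
        then have "ennreal (a v) = 0" using elim v by auto
        then show "a v = 0" using a0[of v] by (simp add: ennreal_eq_0_iff)
      qed
    qed
  qed
  have "AE v in lebesgue01. \<forall>y\<in>\<rat> \<inter> {0<..1}. v < y \<longrightarrow> primitive01 a v = primitive01 a y \<longrightarrow> a v = 0"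
    using * by (intro AE_ball_countable') (auto intro: countable_Int1 countable_rat)
  then show ?thesis using AE_lebesgue01_in
  proof eventually_elim
    case (elim v)
    show ?case
    proof (intro allI impI)
      fix y assume v: "0 < a v" and y: "v < y" "y \<le> 1"
      obtain y' where y': "y' \<in> \<rat>" "v < y'" "y' < y" using Rats_dense_in_real[OF y(1)] by auto
      have "primitive01 a v \<noteq> primitive01 a y'" using elim v y y' by force
      moreover have "primitive01 a v \<le> primitive01 a y'" "primitive01 a y' \<le> primitive01 a y"
        using elim y y' by (auto intro!: primitive01_mono)
      ultimately show "primitive01 a v < primitive01 a y" by simp
    qed
  qed
qed

end

text \<open>
  The increasing rearrangement that transports the density \<open>a\<close> to the density \<open>b\<close>. With the positive and
  negative parts of the difference of two quantile functions as densities, it is \<open>IT_phi\<close>.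
\<close>

definition matching :: "(real \<Rightarrow> real) \<Rightarrow> (real \<Rightarrow> real) \<Rightarrow> real \<Rightarrow> real" where
  "matching a b u = left_inverse01 (primitive01 b) (primitive01 a u)"

context
  fixes a b :: "real \<Rightarrow> real"
  assumes a: "integrable lebesgue01 a" "\<And>u. 0 \<le> a u"
    and b: "integrable lebesgue01 b" "\<And>u. 0 \<le> b u"
    and ab: "primitive01 a 1 = primitive01 b 1"
begin

lemma matching_props:
  assumes u: "0 \<le> u" "u \<le> 1"
  shows "0 \<le> matching a b u" "matching a b u \<le> 1"
    "primitive01 b (matching a b u) = primitive01 a u"
    "\<And>x. 0 \<le> x \<Longrightarrow> x \<le> 1 \<Longrightarrow> matching a b u \<le> x \<longleftrightarrow> primitive01 a u \<le> primitive01 b x"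
proof -
  have "0 \<le> primitive01 a u" "primitive01 a u \<le> primitive01 b 1"
    using primitive01_nonneg[OF a] primitive01_mono[OF a u(1) u(2) order_refl] ab by auto
  note inv = left_inverse01_primitive01[OF b this, folded matching_def]
  show "0 \<le> matching a b u" "matching a b u \<le> 1"
    "primitive01 b (matching a b u) = primitive01 a u"
    "\<And>x. 0 \<le> x \<Longrightarrow> x \<le> 1 \<Longrightarrow> matching a b u \<le> x \<longleftrightarrow> primitive01 a u \<le> primitive01 b x"
    using inv by auto
qed

lemma measurable_matching: "matching a b \<in> borel_measurable lebesgue01"
proof -
  have "mono_on {0<..<1} (matching a b)"
  proof (rule mono_onI)
    fix s t :: real assume st: "s \<in> {0<..<1}" "t \<in> {0<..<1}" "s \<le> t"
    have "primitive01 a s \<le> primitive01 a t" using st by (intro primitive01_mono a) auto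
    then show "matching a b s \<le> matching a b t"
      using matching_props[of s] matching_props[of t] st by auto
  qed
  from borel_measurable_mono_on_fnc[OF this] show ?thesis
    by (subst measurable_cong_sets[OF sets_restrict_space_cong[OF sets_lborel] refl])
qed

text \<open>
  On \<open>[0,1]\<close> the inequality \<open>matching a b u \<le> x\<close> means that the primitive of \<open>a\<close> at \<open>u\<close> is at most that of
  \<open>b\<close> at \<open>x\<close>. These \<open>u\<close> form an initial interval whose right end \<open>s\<close> attains the value, so its \<open>a\<close>-mass is
  the \<open>b\<close>-mass up to \<open>x\<close>, and the two distribution functions agree.
\<close>

lemma distr_matching:
  "distr (density lebesgue01 a) borel (matching a b) = distr (density lebesgue01 b) borel (\<lambda>v. v)"
proof -
  have [measurable]: "a \<in> borel_measurable lebesgue01" "b \<in> borel_measurable lebesgue01"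
    using a b by auto
  note [measurable] = measurable_matching
  have [measurable]: "(\<lambda>v. v) \<in> borel_measurable lebesgue01" by (rule measurable_lebesgue01I) simp
  have fin: "finite_borel_measure (distr (density lebesgue01 c) borel f)"
    if c: "integrable lebesgue01 c" "\<And>u. 0 \<le> c u" and f: "f \<in> borel_measurable lebesgue01" for c f :: "real \<Rightarrow> real"
  proof -
    have "(\<integral>\<^sup>+u. ennreal (c u) \<partial>lebesgue01) < \<infinity>"
      using c nn_integral_eq_integral[OF c(1)] by simp
    moreover have "emeasure (density lebesgue01 c) (space lebesgue01) = (\<integral>\<^sup>+u. ennreal (c u) \<partial>lebesgue01)"
      using c by (subst emeasure_density) (auto intro!: nn_integral_cong simp: sets_restrict_space_iff)
    ultimately have "emeasure (distr (density lebesgue01 c) borel f) UNIV \<noteq> \<infinity>"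
      using f by (subst emeasure_distr) auto
    then show ?thesis
      by (intro finite_borel_measure.intro finite_measureI) (auto simp: finite_borel_measure_axioms_def)
  qed
  show ?thesis
  proof (rule cdf_unique'[OF fin[OF a] fin[OF b]])
    show "cdf (distr (density lebesgue01 a) borel (matching a b)) = cdf (distr (density lebesgue01 b) borel (\<lambda>v. v))"
    proof
      fix x
      have eq: "measure (density lebesgue01 a) (matching a b -` {..x} \<inter> {0<..<1}) =
          measure (density lebesgue01 b) ({..x} \<inter> {0<..<1})" if x: "0 \<le> x" "x \<le> 1" for x
      proof -
        define T where "T = {0..1} \<inter> primitive01 a -` {..primitive01 b x}"
        have "closed T" unfolding T_def
          by (intro continuous_closed_preimage continuous_on_primitive01 a) auto
        moreover have T0: "0 \<in> T" using primitive01_nonneg[OF b] by (auto simp: T_def)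
        moreover have bddT: "bdd_above T" by (auto simp: T_def)
        ultimately have SupT: "Sup T \<in> T" by (intro closed_contains_Sup) auto
        define s where "s = Sup T"
        have s: "0 \<le> s" "s \<le> 1" "primitive01 a s \<le> primitive01 b x"
          using SupT by (auto simp: s_def T_def)
        have upper: "t \<le> s" if "t \<in> T" for t unfolding s_def using that bddT by (rule cSup_upper)
        have as: "primitive01 a s = primitive01 b x"
        proof (rule ccontr)
          assume "\<not> ?thesis"
          then have less: "primitive01 a s < primitive01 b x" using s by simp
          have "primitive01 b x \<le> primitive01 a 1" using primitive01_mono[OF b x(1,2)] ab by simp
          then obtain r where r: "s \<le> r" "r \<le> 1" "primitive01 a r = primitive01 b x"
            using IVT'[of "primitive01 a" s "primitive01 b x" 1] less s
              continuous_on_subset[OF continuous_on_primitive01[OF a(1)], of "{s..1}"] by auto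
          then have "r \<le> s" using s by (intro upper) (auto simp: T_def)
          with r less show False by auto
        qed
        have "matching a b -` {..x} \<inter> {0<..<1} = {..s} \<inter> {0<..<1}"
        proof (intro set_eqI iffI)
          fix u assume "u \<in> matching a b -` {..x} \<inter> {0<..<1}"
          then show "u \<in> {..s} \<inter> {0<..<1}"
            using matching_props(4)[of u x] x by (auto intro!: upper simp: T_def)
        next
          fix u assume u: "u \<in> {..s} \<inter> {0<..<1}"
          then have "primitive01 a u \<le> primitive01 b x"
            using primitive01_mono[OF a, of u s] s as by auto
          then show "u \<in> matching a b -` {..x} \<inter> {0<..<1}"
            using matching_props(4)[of u x] x u by auto
        qed
        then show ?thesis
          using emeasure_density_primitive01[OF a s(1,2)] emeasure_density_primitive01[OF b x] as
          by (simp add: measure_def)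
      qed
      have "measure (density lebesgue01 a) (matching a b -` {..x} \<inter> {0<..<1}) =
          measure (density lebesgue01 b) ({..x} \<inter> {0<..<1})"
      proof -
        consider "x < 0" | "0 \<le> x" "x \<le> 1" | "1 < x" by linarith
        then show ?thesis
        proof cases
          case 1
          have "x < matching a b u" if "0 < u" "u < 1" for u
            using matching_props(1)[of u] 1 that by auto
          then have "matching a b -` {..x} \<inter> {0<..<1} = {}" "{..x} \<inter> {0<..<1} = {}"
            using 1 by (auto simp: not_le[symmetric])
          then show ?thesis by simp
        next
          case 2 then show ?thesis by (rule eq)
        next
          case 3
          have "matching a b u \<le> 1" if "0 < u" "u < 1" for u
            using matching_props(2)[of u] that by auto
          then have "matching a b -` {..x} \<inter> {0<..<1} = matching a b -` {..1} \<inter> {0<..<1}"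
            "{..x} \<inter> {0<..<1} = {..1} \<inter> {0<..<1}"
            using 3 by (auto intro: order_trans[OF _ less_imp_le])
          then show ?thesis using eq[of 1] by simp
        qed
      qed
      then show "cdf (distr (density lebesgue01 a) borel (matching a b)) x =
          cdf (distr (density lebesgue01 b) borel (\<lambda>v. v)) x"
        by (simp add: cdf_def measure_distr)
    qed
  qed auto
qed

lemma nn_integral_matching:
  assumes [measurable]: "k \<in> borel_measurable borel"
  shows "(\<integral>\<^sup>+u. ennreal (a u) * k (matching a b u) \<partial>lebesgue01) = (\<integral>\<^sup>+v. ennreal (b v) * k v \<partial>lebesgue01)"
proof -
  have [measurable]: "a \<in> borel_measurable lebesgue01" "b \<in> borel_measurable lebesgue01"
    using a b by auto
  note [measurable] = measurable_matching
  have [measurable]: "(\<lambda>v. v) \<in> borel_measurable lebesgue01" by (rule measurable_lebesgue01I) simp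
  have "(\<integral>\<^sup>+u. ennreal (a u) * k (matching a b u) \<partial>lebesgue01) = (\<integral>\<^sup>+x. k x \<partial>distr (density lebesgue01 a) borel (matching a b))"
    by (subst nn_integral_distr) (auto simp: nn_integral_density)
  also have "\<dots> = (\<integral>\<^sup>+x. k x \<partial>distr (density lebesgue01 b) borel (\<lambda>v. v))" by (simp add: distr_matching)
  also have "\<dots> = (\<integral>\<^sup>+v. ennreal (b v) * k v \<partial>lebesgue01)"
    by (subst nn_integral_distr) (auto simp: nn_integral_density)
  finally show ?thesis .
qed

text \<open>
  A property that holds \<open>b\<close>-almost everywhere holds \<open>a\<close>-almost everywhere at the transported point,
  because the exceptional set \<open>S\<close> has \<open>b\<close>-mass \<open>0\<close>. The set \<open>S\<close> includes the zeros of \<open>b\<close> and the complement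
  of \<open>(0,1)\<close>.
\<close>

lemma AE_matching:
  assumes P: "AE v in lebesgue01. 0 < b v \<longrightarrow> P v"
  shows "AE u in lebesgue01. 0 < a u \<longrightarrow>
     0 < matching a b u \<and> matching a b u < 1 \<and> 0 < b (matching a b u) \<and> P (matching a b u)"
proof -
  have am[measurable]: "a \<in> borel_measurable lebesgue01" and bm[measurable]: "b \<in> borel_measurable lebesgue01"
    using a b by auto
  note [measurable] = measurable_matching
  from P[THEN AE_E] obtain N where N: "{v \<in> space lebesgue01. \<not> (0 < b v \<longrightarrow> P v)} \<subseteq> N"
     "emeasure lebesgue01 N = 0" "N \<in> sets lebesgue01" by auto
  have borel: "S \<in> sets borel" if "S \<in> sets lebesgue01" for S
    using that by (auto simp: sets_restrict_space_iff)
  have "{v \<in> space lebesgue01. b v = 0} \<in> sets lebesgue01" by measurable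
  then have m0: "{v \<in> {0<..<1}. b v = 0} \<in> sets borel" using borel by simp
  define S where "S = N \<union> {v \<in> {0<..<1}. b v = 0} \<union> - {0<..<1}"
  have S[measurable]: "S \<in> sets borel" unfolding S_def by (intro sets.Un m0 borel[OF N(3)]) auto
  have "N \<in> null_sets lebesgue01" using N by auto
  from AE_not_in[OF this] AE_lebesgue01_in
  have "AE v in lebesgue01. ennreal (b v) * indicator S v = 0"
    by eventually_elim (auto simp: S_def indicator_def)
  then have "(\<integral>\<^sup>+v. ennreal (b v) * indicator S v \<partial>lebesgue01) = 0"
    by (subst nn_integral_cong_AE[where v = "\<lambda>_. 0"]) auto
  then have "(\<integral>\<^sup>+u. ennreal (a u) * indicator S (matching a b u) \<partial>lebesgue01) = 0"
    by (subst nn_integral_matching) auto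
  then have "AE u in lebesgue01. ennreal (a u) * indicator S (matching a b u) = 0"
    by (subst (asm) nn_integral_0_iff_AE) auto
  then show ?thesis
  proof eventually_elim
    case (elim u)
    show ?case
    proof
      assume "0 < a u"
      with elim have "matching a b u \<notin> S" by (auto simp: indicator_def split: if_splits)
      then have *: "matching a b u \<in> {0<..<1}" "b (matching a b u) \<noteq> 0" "matching a b u \<notin> N"
        by (auto simp: S_def)
      moreover have "0 < b (matching a b u)" using * b(2)[of "matching a b u"] by simp
      ultimately show "0 < matching a b u \<and> matching a b u < 1 \<and> 0 < b (matching a b u) \<and> P (matching a b u)"
        using N(1) by auto
    qed
  qed
qed

end

text \<open>
  The Galois connection turns \<open>matching (a n) (b n) u < y\<close> and its opposite into comparisons of
  primitives, which pass to the limit as soon as they are strict in the limit. Strictness on the right of the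
  limit point is the absence of a flat piece; on the left it is automatic.
\<close>

lemma matching_tendsto:
  fixes a b :: "nat \<Rightarrow> real \<Rightarrow> real"
  assumes a: "\<And>n. integrable lebesgue01 (a n)" "\<And>n u. 0 \<le> a n u"
    and b: "\<And>n. integrable lebesgue01 (b n)" "\<And>n u. 0 \<le> b n u"
    and ab: "\<And>n. primitive01 (a n) 1 = primitive01 (b n) 1"
    and a': "integrable lebesgue01 a'" "\<And>u. 0 \<le> a' u"
    and b': "integrable lebesgue01 b'" "\<And>u. 0 \<le> b' u"
    and ab': "primitive01 a' 1 = primitive01 b' 1"
    and u: "0 < u" "u < 1"
    and A: "(\<lambda>n. primitive01 (a n) u) \<longlonglongrightarrow> primitive01 a' u"
    and B: "\<And>y. 0 \<le> y \<Longrightarrow> y \<le> 1 \<Longrightarrow> (\<lambda>n. primitive01 (b n) y) \<longlonglongrightarrow> primitive01 b' y"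
    and v: "matching a' b' u < 1"
    and strict: "\<And>y. matching a' b' u < y \<Longrightarrow> y \<le> 1 \<Longrightarrow> primitive01 b' (matching a' b' u) < primitive01 b' y"
  shows "(\<lambda>n. matching (a n) (b n) u) \<longlonglongrightarrow> matching a' b' u"
proof (rule order_tendstoI)
  have u01: "0 \<le> u" "u \<le> 1" using u by auto
  note lim = matching_props[OF a' b' ab' u01]
  note seq = matching_props[OF a b ab u01]
  fix x assume x: "x < matching a' b' u"
  show "\<forall>\<^sub>F n in sequentially. x < matching (a n) (b n) u"
  proof (cases "x < 0")
    case True
    then show ?thesis using seq(1) by (auto intro: always_eventually less_le_trans)
  next
    case False
    then have x01: "0 \<le> x" "x \<le> 1" using x v by auto
    have "primitive01 b' x < primitive01 a' u" using lim(4)[OF x01] x by auto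
    then have "\<forall>\<^sub>F n in sequentially. 0 < primitive01 (a n) u - primitive01 (b n) x"
      using order_tendstoD(1)[OF tendsto_diff[OF A B[OF x01]], of 0] by simp
    then show ?thesis
    proof eventually_elim
      case (elim n)
      then show ?case using seq(4)[OF x01, of n] by auto
    qed
  qed
next
  have u01: "0 \<le> u" "u \<le> 1" using u by auto
  note lim = matching_props[OF a' b' ab' u01]
  note seq = matching_props[OF a b ab u01]
  fix y assume "matching a' b' u < y"
  with v have "matching a' b' u < min y 1" by simp
  then obtain z where z: "matching a' b' u < z" "z < min y 1" using dense by blast
  then have z01: "0 \<le> z" "z \<le> 1" using lim(1) by auto
  have "primitive01 a' u < primitive01 b' z" using strict[OF z(1)] z01 lim(3) by simp
  then have "\<forall>\<^sub>F n in sequentially. 0 < primitive01 (b n) z - primitive01 (a n) u"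
    using order_tendstoD(1)[OF tendsto_diff[OF B[OF z01] A], of 0] by simp
  then show "\<forall>\<^sub>F n in sequentially. matching (a n) (b n) u < y"
  proof eventually_elim
    case (elim n)
    then show ?case using seq(4)[OF z01, of n] z by auto
  qed
qed

lemma primitive01_tendsto:
  assumes "\<And>n. integrable lebesgue01 (a n)" "integrable lebesgue01 a'"
    and conv: "(\<lambda>n. \<integral>\<^sup>+u. ennreal \<bar>a n u - a' u\<bar> \<partial>lebesgue01) \<longlonglongrightarrow> 0"
    and s: "0 \<le> s" "s \<le> 1"
  shows "(\<lambda>n. primitive01 (a n) s) \<longlonglongrightarrow> primitive01 a' s"
proof -
  note ind = integrable_indicator_lessThan
  have le: "ennreal (norm (primitive01 (a n) s - primitive01 a' s)) \<le> (\<integral>\<^sup>+u. ennreal \<bar>a n u - a' u\<bar> \<partial>lebesgue01)" for n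
  proof -
    have i: "integrable lebesgue01 (\<lambda>v. \<bar>a n v - a' v\<bar>)" using assms by auto
    have "primitive01 (a n) s - primitive01 a' s = (\<integral>v. indicator {..<s} v * a n v - indicator {..<s} v * a' v \<partial>lebesgue01)"
      using assms ind by (simp add: primitive01_eq)
    also have "norm \<dots> \<le> (\<integral>v. norm (indicator {..<s} v * a n v - indicator {..<s} v * a' v) \<partial>lebesgue01)"
      by (rule integral_norm_bound)
    also have "\<dots> \<le> (\<integral>v. \<bar>a n v - a' v\<bar> \<partial>lebesgue01)"
      using assms ind i by (intro integral_mono) (auto simp: indicator_def)
    finally show ?thesis using i by (subst nn_integral_eq_integral) (auto intro: ennreal_leI)
  qed
  have "(\<lambda>n. ennreal (norm (primitive01 (a n) s - primitive01 a' s))) \<longlonglongrightarrow> ennreal 0"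
    using tendsto_sandwich[OF _ _ tendsto_const conv, of "\<lambda>n. ennreal (norm (primitive01 (a n) s - primitive01 a' s))"] le
    by (auto intro!: always_eventually)
  then have "(\<lambda>n. norm (primitive01 (a n) s - primitive01 a' s)) \<longlonglongrightarrow> 0"
    by (subst (asm) tendsto_ennreal_iff) auto
  then show ?thesis by (rule LIM_zero_cancel[OF tendsto_norm_zero_cancel])
qed

section \<open>Wasserstein distance of two-point laws\<close>

text \<open>
  The mixture of point masses at \<open>a\<close> and \<open>b\<close>, given by its values on Borel sets as in the
  specification of the kernels.
\<close>

definition two_point :: "real measure \<Rightarrow> real \<Rightarrow> real \<Rightarrow> real \<Rightarrow> bool" where
  "two_point N p a b \<longleftrightarrow> prob_space N \<and> sets N = sets borel \<and> 0 \<le> p \<and> p \<le> 1 \<and>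
     (\<forall>A\<in>sets borel. measure N A = p * indicator A a + (1 - p) * indicator A b)"

text \<open>
  A realisation on \<open>(0,1)\<close>; using the same uniform variable for two laws couples them.
\<close>

lemma two_point_eq_distr:
  assumes "two_point N p a b"
  shows "N = distr lebesgue01 borel (\<lambda>v. if v \<le> p then a else b)"
proof (rule measure_eqI)
  interpret prob_space N using assms by (simp add: two_point_def)
  have N: "sets N = sets borel" "0 \<le> p" "p \<le> 1"
    "\<And>A. A \<in> sets borel \<Longrightarrow> measure N A = p * indicator A a + (1 - p) * indicator A b"
    using assms by (auto simp: two_point_def)
  show "sets N = sets (distr lebesgue01 borel (\<lambda>v. if v \<le> p then a else b))" using N by simp
  have m: "(\<lambda>v. if v \<le> p then a else b) \<in> borel_measurable lebesgue01"
    by (intro measurable_lebesgue01I) simp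
  fix A assume A: "A \<in> sets N"
  have "emeasure (distr lebesgue01 borel (\<lambda>v. if v \<le> p then a else b)) A =
      emeasure lborel ((\<lambda>v. if v \<le> p then a else b) -` A \<inter> {0<..<1})"
    using A N m by (subst emeasure_distr) (auto simp: emeasure_restrict_space)
  also have "\<dots> = ennreal (p * indicator A a + (1 - p) * indicator A b)"
  proof -
    have lo: "emeasure lborel ({..p} \<inter> {0<..<1}) = ennreal p"
    proof (cases "p = 1")
      case True
      then have "{..p} \<inter> {0<..<1} = {0<..<1::real}" by auto
      then show ?thesis using True by simp
    next
      case False
      then have "{..p} \<inter> {0<..<1} = {0<..p}" using N by auto
      then show ?thesis using N by simp
    qed
    have hi: "emeasure lborel ({p<..} \<inter> {0<..<1}) = ennreal (1 - p)"
    proof -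
      have "{p<..} \<inter> {0<..<1} = {p<..<1}" using N by auto
      then show ?thesis using N by simp
    qed
    have "(\<lambda>v. if v \<le> p then a else b) -` A = (if a \<in> A then {..p} else {}) \<union> (if b \<in> A then {p<..} else {})"
      by (auto split: if_splits)
    moreover have "({..p} \<union> {p<..}) \<inter> {0<..<1} = {0<..<1}" by auto
    ultimately show ?thesis using lo hi by (simp add: indicator_def)
  qed
  also have "\<dots> = emeasure N A"
    using N(4)[of A] A N(1) by (simp add: emeasure_eq_measure)
  finally show "emeasure N A = emeasure (distr lebesgue01 borel (\<lambda>v. if v \<le> p then a else b)) A" ..
qed

text \<open>
  If the atoms differ, then \<open>p\<close> is the mass of one of them and is in \<open>[0,1]\<close> for this reason.
\<close>

lemma two_pointI:
  assumes "prob_space N" "sets N = sets borel"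
    "\<forall>A\<in>sets borel. measure N A = p * indicator A a + (1 - p) * indicator A b" "a = b \<Longrightarrow> p = 0"
  shows "two_point N p a b"
proof -
  interpret prob_space N by fact
  have "0 \<le> p \<and> p \<le> 1"
  proof (cases "a = b")
    case False
    then have "measure N {a} = p" using assms(3) by auto
    then show ?thesis using prob_le_1[of "{a}"] measure_nonneg[of N "{a}"] by simp
  qed (use assms(4) in simp)
  then show ?thesis using assms by (auto simp: two_point_def)
qed

lemma two_point_mean:
  assumes "two_point N p a b"
  shows "integrable N (\<lambda>x. x)" "(\<integral>x. x \<partial>N) = p * a + (1 - p) * b"
proof -
  have p: "0 \<le> p" "p \<le> 1" using assms by (auto simp: two_point_def)
  interpret L: prob_space lebesgue01 by (rule prob_space_lebesgue01)
  have m: "(\<lambda>v. if v \<le> p then a else b) \<in> borel_measurable lebesgue01"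
    by (intro measurable_lebesgue01I) simp
  note eq = two_point_eq_distr[OF assms]
  show int: "integrable N (\<lambda>x. x)"
    unfolding eq by (subst integrable_distr_eq[OF m])
      (auto intro!: L.integrable_const_bound[where B = "max \<bar>a\<bar> \<bar>b\<bar>"] m)
  have prob: "prob_space N" and N: "sets N = sets borel" "\<forall>A\<in>sets borel. measure N A = p * indicator A a + (1 - p) * indicator A b"
    using assms by (auto simp: two_point_def)
  interpret N: prob_space N by fact
  have [simp]: "space N = UNIV" using sets_eq_imp_space_eq[OF N(1)] by simp
  have AE: "AE x in N. x = a \<or> x = b"
  proof -
    have "measure N {a, b} = 1" using N(2) by simp
    then have "AE x in N. x \<in> {a, b}"
      using N(1) by (intro N.AE_prob_1) auto
    then show ?thesis by eventually_elim auto
  qed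
  have "(\<integral>x. x \<partial>N) = (\<integral>x. (a - b) * indicator {a} x + b \<partial>N)"
    by (rule integral_cong_AE) (use AE N(1) in \<open>auto simp: measurable_cong_sets[OF N(1) refl] indicator_def elim!: eventually_mono\<close>)
  also have "\<dots> = (a - b) * measure N {a} + b"
    using N(1) N.prob_space by (subst Bochner_Integration.integral_add) (auto intro!: integrable_mult_right N.integrable_const_bound[where B = 1] simp: measurable_cong_sets[OF N(1) refl])
  also have "\<dots> = p * a + (1 - p) * b"
    using N(2)[rule_format, of "{a}"] by (cases "a = b") (auto simp: algebra_simps)
  finally show "(\<integral>x. x \<partial>N) = p * a + (1 - p) * b" .
qed

text \<open>
  The cost of coupling two two-point laws through one uniform variable \<open>v\<close>, which selects the atom
  \<open>a\<close> iff \<open>v \<le> p\<close> and the atom \<open>a'\<close> iff \<open>v \<le> p'\<close>.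
\<close>

definition monotone_cost :: "real \<Rightarrow> real \<Rightarrow> real \<Rightarrow> real \<Rightarrow> real \<Rightarrow> real \<Rightarrow> real \<Rightarrow> real" where
  "monotone_cost \<rho> p a b p' a' b' =
     min p p' * \<bar>a - a'\<bar> powr \<rho> + min (1 - p) (1 - p') * \<bar>b - b'\<bar> powr \<rho>
     + max 0 (p - p') * \<bar>a - b'\<bar> powr \<rho> + max 0 (p' - p) * \<bar>b - a'\<bar> powr \<rho>"

lemma wasserstein_two_point_le:
  assumes N: "two_point N p a b" and N': "two_point N' p' a' b'" and \<rho>: "0 < \<rho>"
  shows "ennpowr (wasserstein \<rho> N N') \<rho> \<le> ennreal (monotone_cost \<rho> p a b p' a' b')"
proof -
  define X where "X = (\<lambda>v::real. if v \<le> p then a else b)"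
  define Y where "Y = (\<lambda>v::real. if v \<le> p' then a' else b')"
  have p: "0 \<le> p" "p \<le> 1" "0 \<le> p'" "p' \<le> 1" and sets: "sets N = sets borel" "sets N' = sets borel"
    using N N' by (auto simp: two_point_def)
  have mX[measurable]: "X \<in> borel_measurable lebesgue01" and mY[measurable]: "Y \<in> borel_measurable lebesgue01"
    unfolding X_def Y_def by (auto intro!: measurable_lebesgue01I)
  define \<pi> where "\<pi> = distr lebesgue01 (borel \<Otimes>\<^sub>M borel) (\<lambda>v. (X v, Y v))"
  have "\<pi> \<in> couplings N N'"
    unfolding couplings_def
  proof (intro CollectI conjI)
    show "sets \<pi> = sets (N \<Otimes>\<^sub>M N')"
      unfolding \<pi>_def using sets_pair_measure_cong[OF sets] by simp
    have "distr \<pi> N fst = distr \<pi> borel fst" using sets by (intro distr_cong) auto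
    also have "\<dots> = distr lebesgue01 borel X"
      unfolding \<pi>_def by (subst distr_distr) (auto simp: comp_def)
    finally show "distr \<pi> N fst = N" using two_point_eq_distr[OF N] by (simp add: X_def)
    have "distr \<pi> N' snd = distr \<pi> borel snd" using sets by (intro distr_cong) auto
    also have "\<dots> = distr lebesgue01 borel Y"
      unfolding \<pi>_def by (subst distr_distr) (auto simp: comp_def)
    finally show "distr \<pi> N' snd = N'" using two_point_eq_distr[OF N'] by (simp add: Y_def)
  qed
  from ennpowr_wasserstein_le[OF \<rho> this]
  have "ennpowr (wasserstein \<rho> N N') \<rho> \<le> (\<integral>\<^sup>+(x, y). ennreal (\<bar>x - y\<bar> powr \<rho>) \<partial>\<pi>)" .
  also have "\<dots> = (\<integral>\<^sup>+v. ennreal (\<bar>X v - Y v\<bar> powr \<rho>) \<partial>lebesgue01)"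
    unfolding \<pi>_def by (subst nn_integral_distr) (auto simp: split_beta')
  also have "\<dots> = (\<integral>\<^sup>+v. ennreal (\<bar>X v - Y v\<bar> powr \<rho>) * indicator {0<..<1} v \<partial>lborel)"
    by (subst nn_integral_restrict_space) auto
  also have "\<dots> \<le> (\<integral>\<^sup>+v. ennreal (\<bar>a - a'\<bar> powr \<rho>) * indicator {0<..min p p'} v
     + ennreal (\<bar>b - b'\<bar> powr \<rho>) * indicator {max p p'<..<1} v
     + ennreal (\<bar>a - b'\<bar> powr \<rho>) * indicator {p'<..max p p'} v
     + ennreal (\<bar>b - a'\<bar> powr \<rho>) * indicator {p<..max p p'} v \<partial>lborel)"
    by (intro nn_integral_mono) (auto simp: X_def Y_def indicator_def)
  also have "\<dots> = ennreal (\<bar>a - a'\<bar> powr \<rho>) * ennreal (min p p')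
     + ennreal (\<bar>b - b'\<bar> powr \<rho>) * ennreal (1 - max p p')
     + ennreal (\<bar>a - b'\<bar> powr \<rho>) * ennreal (max p p' - p')
     + ennreal (\<bar>b - a'\<bar> powr \<rho>) * ennreal (max p p' - p)"
    using p by (simp add: nn_integral_add nn_integral_cmult_indicator)
  also have "\<dots> = ennreal (\<bar>a - a'\<bar> powr \<rho> * min p p' + \<bar>b - b'\<bar> powr \<rho> * (1 - max p p')
     + \<bar>a - b'\<bar> powr \<rho> * (max p p' - p') + \<bar>b - a'\<bar> powr \<rho> * (max p p' - p))"
    using p by (simp add: ennreal_mult ennreal_plus)
  also have "\<bar>a - a'\<bar> powr \<rho> * min p p' + \<bar>b - b'\<bar> powr \<rho> * (1 - max p p')
     + \<bar>a - b'\<bar> powr \<rho> * (max p p' - p') + \<bar>b - a'\<bar> powr \<rho> * (max p p' - p)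
     = monotone_cost \<rho> p a b p' a' b'"
    by (auto simp: monotone_cost_def min_def max_def algebra_simps)
  finally show ?thesis .
qed

lemma convex_on_abs_powr:
  assumes "1 \<le> \<rho>" shows "convex_on UNIV (\<lambda>x::real. \<bar>x\<bar> powr \<rho>)"
proof (rule convex_onI)
  fix t x y :: real assume t: "0 < t" "t < 1"
  have "\<bar>(1 - t) *\<^sub>R x + t *\<^sub>R y\<bar> powr \<rho> \<le> ((1 - t) * \<bar>x\<bar> + t * \<bar>y\<bar>) powr \<rho>"
    using t assms by (intro powr_mono2) (auto intro!: order_trans[OF abs_triangle_ineq] simp: abs_mult)
  also have "\<dots> \<le> (1 - t) powr (1 - \<rho>) * ((1 - t) * \<bar>x\<bar>) powr \<rho> + t powr (1 - \<rho>) * (t * \<bar>y\<bar>) powr \<rho>"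
    using t assms by (intro powr_add_le_weighted) auto
  also have "\<dots> = (1 - t) * \<bar>x\<bar> powr \<rho> + t * \<bar>y\<bar> powr \<rho>"
    using t by (simp add: powr_mult mult.assoc[symmetric] powr_add[symmetric])
  finally show "\<bar>(1 - t) *\<^sub>R x + t *\<^sub>R y\<bar> powr \<rho> \<le> (1 - t) * \<bar>x\<bar> powr \<rho> + t * \<bar>y\<bar> powr \<rho>" .
qed simp

lemma mean_diff_powr_le_wasserstein:
  assumes N: "prob_space N" "sets N = sets borel" "integrable N (\<lambda>x. x)"
    and N': "prob_space N'" "sets N' = sets borel" "integrable N' (\<lambda>x. x)" and \<rho>: "1 \<le> \<rho>"
  shows "ennreal (\<bar>(\<integral>x. x \<partial>N) - (\<integral>x. x \<partial>N')\<bar> powr \<rho>) \<le> ennpowr (wasserstein \<rho> N N') \<rho>"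
proof -
  define d where "d = \<bar>(\<integral>x. x \<partial>N) - (\<integral>x. x \<partial>N')\<bar>"
  have d: "0 \<le> d" by (simp add: d_def)
  have "ennreal d \<le> ennpowr (\<integral>\<^sup>+(x, y). ennreal (\<bar>x - y\<bar> powr \<rho>) \<partial>\<pi>) (1 / \<rho>)"
    if \<pi>: "\<pi> \<in> couplings N N'" for \<pi>
  proof -
    note c = couplings_real[OF \<pi> N(2) N'(2)]
    note [measurable_cong] = c(1)
    have m[measurable]: "fst \<in> \<pi> \<rightarrow>\<^sub>M borel" "snd \<in> \<pi> \<rightarrow>\<^sub>M borel"
      by (simp_all add: measurable_cong_sets[OF c(1) refl])
    interpret \<pi>: prob_space \<pi>
      by (rule prob_space_distrD[OF m(1)]) (simp only: c(2) N(1))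
    have "ennreal (d powr \<rho>) \<le> (\<integral>\<^sup>+(x, y). ennreal (\<bar>x - y\<bar> powr \<rho>) \<partial>\<pi>)"
    proof (cases "integrable \<pi> (\<lambda>z. \<bar>fst z - snd z\<bar> powr \<rho>)")
      case True
      have i1: "integrable \<pi> (\<lambda>z. fst z)"
        by (rule integrable_distr_eq[OF m(1), of "\<lambda>x. x", THEN iffD1]) (simp_all only: c(2) N(3) measurable_ident_sets[OF refl])
      have e1: "(\<integral>z. fst z \<partial>\<pi>) = (\<integral>x. x \<partial>N)"
        by (subst c(2)[symmetric], subst integral_distr[OF m(1)]) simp_all
      have i2: "integrable \<pi> (\<lambda>z. snd z)"
        by (rule integrable_distr_eq[OF m(2), of "\<lambda>x. x", THEN iffD1]) (simp_all only: c(3) N'(3) measurable_ident_sets[OF refl])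
      have e2: "(\<integral>z. snd z \<partial>\<pi>) = (\<integral>x. x \<partial>N')"
        by (subst c(3)[symmetric], subst integral_distr[OF m(2)]) simp_all
      have "\<bar>\<integral>z. fst z - snd z \<partial>\<pi>\<bar> powr \<rho> \<le> (\<integral>z. \<bar>fst z - snd z\<bar> powr \<rho> \<partial>\<pi>)"
        by (rule \<pi>.jensens_inequality[where I = UNIV and q = "\<lambda>x. \<bar>x\<bar> powr \<rho>"])
          (use i1 i2 True convex_on_abs_powr[OF \<rho>] in auto)
      then have "d powr \<rho> \<le> (\<integral>z. \<bar>fst z - snd z\<bar> powr \<rho> \<partial>\<pi>)"
        using i1 i2 by (simp add: d_def e1 e2)
      then show ?thesis
        using True by (simp add: split_beta' nn_integral_eq_integral ennreal_leI)
    next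
      case False
      have "(\<integral>\<^sup>+z. ennreal (\<bar>fst z - snd z\<bar> powr \<rho>) \<partial>\<pi>) = \<infinity>"
      proof (rule ccontr)
        assume "(\<integral>\<^sup>+z. ennreal (\<bar>fst z - snd z\<bar> powr \<rho>) \<partial>\<pi>) \<noteq> \<infinity>"
        then have "integrable \<pi> (\<lambda>z. \<bar>fst z - snd z\<bar> powr \<rho>)"
          by (intro integrableI_nonneg) (auto simp: less_top)
        with False show False by simp
      qed
      then show ?thesis by (simp add: split_beta')
    qed
    from ennpowr_mono[OF _ this, of "1 / \<rho>"] show ?thesis
      using \<rho> d by (simp add: ennpowr_ennreal powr_powr)
  qed
  then have "ennreal d \<le> wasserstein \<rho> N N'"
    unfolding wasserstein_def by (intro INF_greatest)
  from ennpowr_mono[OF _ this, of \<rho>] show ?thesis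
    using \<rho> d by (simp add: ennpowr_ennreal d_def)
qed

text \<open>
  The diagonal coupling removes the term \<open>\<bar>u - u'\<bar>\<close>; the quantile term and the kernel term then
  contribute one Wasserstein term each.
\<close>

lemma lifted_AW_le_diagonal:
  assumes \<mu>: "real_distribution \<mu>" "p \<in> prob_kernels" and \<mu>': "real_distribution \<mu>'" "p' \<in> prob_kernels"
    and \<rho>: "1 \<le> \<rho>"
    and mean: "AE u in lebesgue01. ennreal (\<bar>quantile \<mu> u - quantile \<mu>' u\<bar> powr \<rho>) \<le> ennpowr (wasserstein \<rho> (p u) (p' u)) \<rho>"
  shows "ennpowr (lifted_AW \<rho> (lifted_measure \<mu> p) (lifted_measure \<mu>' p')) \<rho>
     \<le> 2 * (\<integral>\<^sup>+u. ennpowr (wasserstein \<rho> (p u) (p' u)) \<rho> \<partial>lebesgue01)"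
proof -
  define F where "F = (\<lambda>(u, u'). ennreal (\<bar>u - u'\<bar> powr \<rho>)
                     + ennreal (\<bar>quantile \<mu> u - quantile \<mu>' u'\<bar> powr \<rho>)
                     + ennpowr (wasserstein \<rho> (p u) (p' u')) \<rho>)"
  define \<kappa> where "\<kappa> = distr lebesgue01 (lebesgue01 \<Otimes>\<^sub>M lebesgue01) (\<lambda>u. (u, u))"
  have \<kappa>: "\<kappa> \<in> couplings lebesgue01 lebesgue01"
    unfolding couplings_def \<kappa>_def
    by (auto simp: distr_distr comp_def distr_id2)
  have "lifted_AW \<rho> (lifted_measure \<mu> p) (lifted_measure \<mu>' p') \<le> lifted_AW_kernels \<rho> \<mu> p \<mu>' p'"
    unfolding lifted_AW_def using \<mu> \<mu>' by (intro Inf_lower) auto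
  also have "\<dots> \<le> ennpowr (\<integral>\<^sup>+z. F z \<partial>\<kappa>) (1 / \<rho>)"
    unfolding lifted_AW_kernels_def F_def by (rule INF_lower[OF \<kappa>])
  finally have "ennpowr (lifted_AW \<rho> (lifted_measure \<mu> p) (lifted_measure \<mu>' p')) \<rho> \<le> (\<integral>\<^sup>+z. F z \<partial>\<kappa>)"
    using ennpowr_mono[of \<rho>] ennpowr_ennpowr_inverse[of \<rho>] \<rho> by fastforce
  also have "\<dots> \<le> (\<integral>\<^sup>+u. F (u, u) \<partial>lebesgue01)"
    unfolding \<kappa>_def by (rule nn_integral_distr_le) simp
  also have "\<dots> \<le> (\<integral>\<^sup>+u. ennreal 2 * ennpowr (wasserstein \<rho> (p u) (p' u)) \<rho> \<partial>lebesgue01)"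
    using mean by (intro nn_integral_mono_AE) (auto simp: F_def mult_2 elim!: eventually_mono)
  also have "\<dots> \<le> ennreal 2 * (\<integral>\<^sup>+u. ennpowr (wasserstein \<rho> (p u) (p' u)) \<rho> \<partial>lebesgue01)"
    by (rule nn_integral_cmult_le) simp
  finally show ?thesis by simp
qed

section \<open>The inverse transform kernel of one pair in convex order\<close>

definition gap_plus :: "real measure \<Rightarrow> real measure \<Rightarrow> real \<Rightarrow> real" where
  "gap_plus \<mu> \<nu> v = max 0 (quantile \<mu> v - quantile \<nu> v)"

definition gap_minus :: "real measure \<Rightarrow> real measure \<Rightarrow> real \<Rightarrow> real" where
  "gap_minus \<mu> \<nu> v = max 0 (- (quantile \<mu> v - quantile \<nu> v))"

lemma gap_nonneg: "0 \<le> gap_plus \<mu> \<nu> v" "0 \<le> gap_minus \<mu> \<nu> v"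
  by (auto simp: gap_plus_def gap_minus_def)

lemma gap_pos_iff:
  "0 < gap_plus \<mu> \<nu> v \<longleftrightarrow> quantile \<nu> v < quantile \<mu> v"
  "0 < gap_minus \<mu> \<nu> v \<longleftrightarrow> quantile \<mu> v < quantile \<nu> v"
  by (auto simp: gap_plus_def gap_minus_def)

text \<open>
  The part of the convex order that the kernels need, in terms of primitives of the quantile
  functions. In this form it passes to limits at once.
\<close>

definition quantile_convex_order :: "real measure \<Rightarrow> real measure \<Rightarrow> bool" where
  "quantile_convex_order \<mu> \<nu> \<longleftrightarrow> real_distribution \<mu> \<and> real_distribution \<nu> \<and>
     integrable lebesgue01 (quantile \<mu>) \<and> integrable lebesgue01 (quantile \<nu>) \<and>
     (\<forall>u\<in>{0..1}. primitive01 (quantile \<nu>) u \<le> primitive01 (quantile \<mu>) u) \<and>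
     primitive01 (quantile \<nu>) 1 = primitive01 (quantile \<mu>) 1"

text \<open>
  Test the convex order with \<open>x\<close>, \<open>- x\<close> and \<open>max 0 (K - x)\<close> for \<open>K = r u\<close>. By monotonicity of \<open>r\<close> the
  integral of \<open>max 0 (K - r v)\<close> is that of \<open>K - r v\<close> over \<open>v < u\<close>, while for \<open>q\<close> in place of \<open>r\<close> it
  is at least as large; the constants \<open>K\<close> cancel.
\<close>

lemma convex_order_quantile_convex_order:
  assumes \<mu>: "real_distribution \<mu>" "integrable \<mu> (\<lambda>x. x)"
    and \<nu>: "real_distribution \<nu>" "integrable \<nu> (\<lambda>x. x)"
    and cx: "convex_order \<mu> \<nu>"
  shows "quantile_convex_order \<mu> \<nu>"
proof -
  define q where "q = quantile \<mu>"
  define r where "r = quantile \<nu>"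
  interpret L: prob_space lebesgue01 by (rule prob_space_lebesgue01)
  have q: "integrable lebesgue01 q" and r: "integrable lebesgue01 r"
    unfolding q_def r_def
    using integrable_quantile_iff[OF \<mu>(1) measurable_ident_sets[OF refl]] \<mu>(2)
      integrable_quantile_iff[OF \<nu>(1) measurable_ident_sets[OF refl]] \<nu>(2) by blast+
  have convex: "(\<integral>u. f (q u) \<partial>lebesgue01) \<le> (\<integral>u. f (r u) \<partial>lebesgue01)"
    if f: "convex_on UNIV f" "integrable lebesgue01 (\<lambda>u. f (r u))" "f \<in> borel_measurable borel" for f
  proof -
    have "integrable \<nu> f" using f integrable_quantile_iff[OF \<nu>(1) f(3)] by (simp add: r_def)
    then have "(\<integral>x. f x \<partial>\<mu>) \<le> (\<integral>x. f x \<partial>\<nu>)" using cx f(1) by (auto simp: convex_order_def)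
    then show ?thesis using integral_quantile[OF \<mu>(1) f(3)] integral_quantile[OF \<nu>(1) f(3)]
      by (simp add: q_def r_def)
  qed
  have "convex_on UNIV (\<lambda>x::real. - x)" by (auto intro!: convex_onI simp: algebra_simps)
  with convex[of "\<lambda>x. x"] convex[of "\<lambda>x. - x"] r
  have mean: "(\<integral>u. q u \<partial>lebesgue01) = (\<integral>u. r u \<partial>lebesgue01)"
    by (auto simp: convex_on_ident)
  have one: "primitive01 c 1 = (\<integral>u. c u \<partial>lebesgue01)" if "integrable lebesgue01 c" for c
    using primitive01_eq[OF that, of 1] by (auto simp: indicator_def intro!: Bochner_Integration.integral_cong)
  have main: "primitive01 r u \<le> primitive01 q u" if u: "0 < u" "u < 1" for u
  proof -
    define K where "K = r u"
    have "convex_on UNIV (\<lambda>x::real. max 0 (K - x))"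
    proof (rule convex_onI)
      fix t x y :: real assume t: "0 < t" "t < 1"
      have "K - ((1 - t) * x + t * y) = (1 - t) * (K - x) + t * (K - y)" by (simp add: algebra_simps)
      also have "\<dots> \<le> (1 - t) * max 0 (K - x) + t * max 0 (K - y)"
        using t by (intro add_mono mult_left_mono) auto
      finally show "max 0 (K - ((1 - t) *\<^sub>R x + t *\<^sub>R y)) \<le> (1 - t) * max 0 (K - x) + t * max 0 (K - y)"
        using t by simp
    qed simp
    then have "(\<integral>v. max 0 (K - q v) \<partial>lebesgue01) \<le> (\<integral>v. max 0 (K - r v) \<partial>lebesgue01)"
      using r by (intro convex) auto
    also have "\<dots> = (\<integral>v. indicator {..<u} v * (K - r v) \<partial>lebesgue01)"
    proof (intro Bochner_Integration.integral_cong refl)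
      fix v assume "v \<in> space lebesgue01"
      then have v: "0 < v" "v < 1" by auto
      have "v < u \<Longrightarrow> r v \<le> K" "u \<le> v \<Longrightarrow> K \<le> r v"
        unfolding r_def K_def using quantile_mono[OF \<nu>(1)] u v by auto
      then show "max 0 (K - r v) = indicator {..<u} v * (K - r v)"
        by (auto simp: indicator_def max_def)
    qed
    finally have 1: "(\<integral>v. max 0 (K - q v) \<partial>lebesgue01) \<le> (\<integral>v. indicator {..<u} v * (K - r v) \<partial>lebesgue01)" .
    have "(\<integral>v. indicator {..<u} v * (K - q v) \<partial>lebesgue01) \<le> (\<integral>v. max 0 (K - q v) \<partial>lebesgue01)"
      using q by (intro integral_mono integrable_indicator_lessThan) (auto simp: indicator_def)
    with 1 have "(\<integral>v. indicator {..<u} v * (K - q v) \<partial>lebesgue01) \<le> (\<integral>v. indicator {..<u} v * (K - r v) \<partial>lebesgue01)"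
      by simp
    moreover have "(\<integral>v. indicator {..<u} v * (K - c v) \<partial>lebesgue01) =
       (\<integral>v. indicator {..<u} v * K \<partial>lebesgue01) - primitive01 c u" if "integrable lebesgue01 c" for c
    proof -
      have "0 \<le> u" "u \<le> 1" using u by auto
      then show ?thesis unfolding right_diff_distrib primitive01_eq[OF that \<open>0 \<le> u\<close> \<open>u \<le> 1\<close>]
        by (intro Bochner_Integration.integral_diff integrable_indicator_lessThan that L.integrable_const)
    qed
    ultimately show ?thesis using q r by simp
  qed
  have "primitive01 r u \<le> primitive01 q u" if u01: "u \<in> {0..1}" for u
  proof -
    consider "u = 0" | "u = 1" | "0 < u" "u < 1" using u01 by (metis atLeastAtMost_iff order_le_less)
    then show ?thesis by cases (use main one q r mean in auto)
  qed
  then show ?thesis using \<mu> \<nu> q r one mean by (simp add: quantile_convex_order_def q_def r_def)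
qed

context
  fixes \<mu> \<nu> :: "real measure"
  assumes qc: "quantile_convex_order \<mu> \<nu>"
begin

lemma qc_facts:
  "real_distribution \<mu>" "real_distribution \<nu>"
  "integrable lebesgue01 (quantile \<mu>)" "integrable lebesgue01 (quantile \<nu>)"
  using qc by (auto simp: quantile_convex_order_def)

lemma measurable_quantiles:
  "quantile \<mu> \<in> borel_measurable borel" "quantile \<nu> \<in> borel_measurable borel"
  using qc_facts measurable_quantile by auto

lemma gap_integrable:
  "integrable lebesgue01 (gap_plus \<mu> \<nu>)" "integrable lebesgue01 (gap_minus \<mu> \<nu>)"
  using qc_facts by (auto simp: gap_plus_def[abs_def] gap_minus_def[abs_def])

lemma gap_primitive_le:
  shows "\<And>u. 0 \<le> u \<Longrightarrow> u \<le> 1 \<Longrightarrow> primitive01 (gap_minus \<mu> \<nu>) u \<le> primitive01 (gap_plus \<mu> \<nu>) u"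
    and "primitive01 (gap_plus \<mu> \<nu>) 1 = primitive01 (gap_minus \<mu> \<nu>) 1"
proof -
  have eq: "primitive01 (gap_plus \<mu> \<nu>) u - primitive01 (gap_minus \<mu> \<nu>) u =
      primitive01 (quantile \<mu>) u - primitive01 (quantile \<nu>) u" if "0 \<le> u" "u \<le> 1" for u
  proof -
    note ii = integrable_indicator_lessThan[of _ u]
    have "primitive01 (gap_plus \<mu> \<nu>) u - primitive01 (gap_minus \<mu> \<nu>) u =
        (\<integral>v. indicator {..<u} v * gap_plus \<mu> \<nu> v - indicator {..<u} v * gap_minus \<mu> \<nu> v \<partial>lebesgue01)"
      unfolding primitive01_eq[OF gap_integrable(1) that] primitive01_eq[OF gap_integrable(2) that]
      by (rule Bochner_Integration.integral_diff[symmetric]; intro ii gap_integrable)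
    also have "\<dots> = (\<integral>v. indicator {..<u} v * quantile \<mu> v - indicator {..<u} v * quantile \<nu> v \<partial>lebesgue01)"
      by (intro Bochner_Integration.integral_cong) (auto simp: indicator_def max_def gap_plus_def gap_minus_def)
    also have "\<dots> = primitive01 (quantile \<mu>) u - primitive01 (quantile \<nu>) u"
      unfolding primitive01_eq[OF qc_facts(3) that] primitive01_eq[OF qc_facts(4) that]
      by (rule Bochner_Integration.integral_diff; intro ii qc_facts)
    finally show ?thesis .
  qed
  show "primitive01 (gap_minus \<mu> \<nu>) u \<le> primitive01 (gap_plus \<mu> \<nu>) u" if u: "0 \<le> u" "u \<le> 1" for u
  proof -
    have "primitive01 (quantile \<nu>) u \<le> primitive01 (quantile \<mu>) u"
      using qc u unfolding quantile_convex_order_def by (meson atLeastAtMost_iff)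
    with eq[OF u] show ?thesis by linarith
  qed
  show "primitive01 (gap_plus \<mu> \<nu>) 1 = primitive01 (gap_minus \<mu> \<nu>) 1"
    using eq[of 1] qc by (auto simp: quantile_convex_order_def)
qed

lemma IT_phi_eq_matching:
  "quantile \<nu> u < quantile \<mu> u \<Longrightarrow> IT_phi \<mu> \<nu> u = matching (gap_plus \<mu> \<nu>) (gap_minus \<mu> \<nu>) u"
  "quantile \<mu> u < quantile \<nu> u \<Longrightarrow> IT_phi \<mu> \<nu> u = matching (gap_minus \<mu> \<nu>) (gap_plus \<mu> \<nu>) u"
  by (auto simp: IT_phi_def matching_def Psi_plus_def[abs_def] Psi_minus_def[abs_def] primitive01_def[abs_def]
      gap_plus_def[abs_def] gap_minus_def[abs_def])

lemmas gap_plus_setup = gap_integrable(1) gap_nonneg(1) gap_integrable(2) gap_nonneg(2) gap_primitive_le(2)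
lemmas gap_minus_setup = gap_integrable(2) gap_nonneg(2) gap_integrable(1) gap_nonneg(1) gap_primitive_le(2)[symmetric]

lemma measurable_IT_phi: "IT_phi \<mu> \<nu> \<in> borel_measurable lebesgue01"
proof -
  note [measurable] = measurable_lebesgue01I[OF measurable_quantiles(1)] measurable_lebesgue01I[OF measurable_quantiles(2)]
    measurable_matching[OF gap_plus_setup] measurable_matching[OF gap_minus_setup]
  have [measurable]: "(\<lambda>u. u) \<in> borel_measurable lebesgue01" by (rule measurable_lebesgue01I) simp
  have "IT_phi \<mu> \<nu> = (\<lambda>u. if quantile \<mu> u > quantile \<nu> u then matching (gap_plus \<mu> \<nu>) (gap_minus \<mu> \<nu>) u
      else if quantile \<mu> u < quantile \<nu> u then matching (gap_minus \<mu> \<nu>) (gap_plus \<mu> \<nu>) u else u)"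
    using IT_phi_eq_matching by (intro ext) (auto simp: IT_phi_def)
  also have "\<dots> \<in> borel_measurable lebesgue01" by measurable
  finally show ?thesis .
qed

text \<open>
  Suppose \<open>r u < q u\<close> and let \<open>w = \<phi> u\<close>. Since the primitive of the positive gap dominates that of the
  negative gap, \<open>w < u\<close> would require a flat piece of the latter to the right of \<open>w\<close>; so \<open>u \<le> w\<close> and
  \<open>q u \<le> q w < r w\<close>. In the other case \<open>w \<le> u\<close> follows directly from the definition of \<open>\<phi>\<close> as a least
  point, and \<open>r w < q w \<le> q u\<close>.
\<close>

lemma AE_IT_bracket:
  "AE u in lebesgue01.
     (quantile \<nu> u < quantile \<mu> u \<longrightarrow> quantile \<mu> u < quantile \<nu> (IT_phi \<mu> \<nu> u)) \<and>
     (quantile \<mu> u < quantile \<nu> u \<longrightarrow> quantile \<nu> (IT_phi \<mu> \<nu> u) < quantile \<mu> u)"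
proof -
  note strict = AE_primitive01_strict[OF gap_integrable(2) gap_nonneg(2)]
  have "AE v in lebesgue01. 0 < gap_plus \<mu> \<nu> v \<longrightarrow> True" by simp
  from AE_matching[OF gap_plus_setup strict] AE_matching[OF gap_minus_setup this] AE_lebesgue01_in
  show ?thesis
  proof eventually_elim
    case (elim u)
    then have u: "0 < u" "u < 1" "0 \<le> u" "u \<le> 1" by auto
    note le = gap_primitive_le(1)[OF u(3,4)]
    show ?case
    proof (intro conjI impI)
      assume gt: "quantile \<nu> u < quantile \<mu> u"
      note phi = IT_phi_eq_matching(1)[OF gt]
      define w where "w = IT_phi \<mu> \<nu> u"
      have w: "0 < w" "w < 1" "quantile \<mu> w < quantile \<nu> w"
          "\<And>y. w < y \<Longrightarrow> y \<le> 1 \<Longrightarrow> primitive01 (gap_minus \<mu> \<nu>) w < primitive01 (gap_minus \<mu> \<nu>) y"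
        using elim(1) gt phi by (auto simp: w_def gap_pos_iff)
      have "primitive01 (gap_minus \<mu> \<nu>) w = primitive01 (gap_plus \<mu> \<nu>) u"
        using matching_props(3)[OF gap_plus_setup u(3,4)] phi by (simp add: w_def)
      then have "u \<le> w" using w(4)[of u] le u by force
      then have "quantile \<mu> u \<le> quantile \<mu> w" using quantile_mono[OF qc_facts(1)] u w by auto
      then show "quantile \<mu> u < quantile \<nu> (IT_phi \<mu> \<nu> u)" using w by (simp add: w_def)
    next
      assume lt: "quantile \<mu> u < quantile \<nu> u"
      note phi = IT_phi_eq_matching(2)[OF lt]
      define w where "w = IT_phi \<mu> \<nu> u"
      have w: "0 < w" "w < 1" "quantile \<nu> w < quantile \<mu> w"
        using elim(2) lt phi by (auto simp: w_def gap_pos_iff)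
      have "w \<le> u" using matching_props(4)[OF gap_minus_setup u(3,4) u(3,4)] le phi by (simp add: w_def)
      then have "quantile \<mu> w \<le> quantile \<mu> u" using quantile_mono[OF qc_facts(1)] u w by auto
      then show "quantile \<nu> (IT_phi \<mu> \<nu> u) < quantile \<mu> u" using w by (simp add: w_def)
    qed
  qed
qed

text \<open>
  The third conjunct says that the kernel has mean \<open>q u\<close>. It depends on the two atoms being
  different wherever \<open>q u \<noteq> r u\<close>.
\<close>

lemma AE_IT_weight:
  "AE u in lebesgue01. 0 \<le> IT_weight \<mu> \<nu> u \<and> IT_weight \<mu> \<nu> u \<le> 1 \<and>
     IT_weight \<mu> \<nu> u * (quantile \<nu> (IT_phi \<mu> \<nu> u) - quantile \<nu> u) = quantile \<mu> u - quantile \<nu> u \<and>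
     (quantile \<nu> (IT_phi \<mu> \<nu> u) = quantile \<nu> u \<longrightarrow> IT_weight \<mu> \<nu> u = 0)"
  using AE_IT_bracket
proof eventually_elim
  case (elim u)
  then show ?case
    by (cases "quantile \<mu> u" "quantile \<nu> u" rule: linorder_cases)
      (auto simp: IT_weight_def field_simps)
qed

text \<open>
  The transport exchanges the two signs of the gap: the part of the left-hand side over \<open>{q > r}\<close> becomes the
  part of the right-hand side over \<open>{q < r}\<close>, and conversely.
\<close>

lemma nn_integral_IT_phi:
  assumes k[measurable]: "k \<in> borel_measurable borel" and k0: "\<And>x. 0 \<le> k x"
  shows "(\<integral>\<^sup>+u. ennreal (\<bar>quantile \<mu> u - quantile \<nu> u\<bar> * k (quantile \<nu> (IT_phi \<mu> \<nu> u))) \<partial>lebesgue01) =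
    (\<integral>\<^sup>+u. ennreal (\<bar>quantile \<mu> u - quantile \<nu> u\<bar> * k (quantile \<nu> u)) \<partial>lebesgue01)"
proof -
  note [measurable] = measurable_quantiles
  note [measurable] = measurable_lebesgue01I[OF measurable_quantiles(1)] measurable_lebesgue01I[OF measurable_quantiles(2)]
  note m[measurable] = measurable_matching[OF gap_plus_setup] measurable_matching[OF gap_minus_setup]
  define K where "K = (\<lambda>v. ennreal (k (quantile \<nu> v)))"
  have K[measurable]: "K \<in> borel_measurable borel" unfolding K_def by measurable
  have K': "K \<in> borel_measurable lebesgue01" by (rule measurable_lebesgue01I[OF K])
  have gm: "(\<lambda>u. ennreal (gap_plus \<mu> \<nu> u)) \<in> borel_measurable lebesgue01"
    "(\<lambda>u. ennreal (gap_minus \<mu> \<nu> u)) \<in> borel_measurable lebesgue01" unfolding gap_plus_def gap_minus_def by measurable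
  have Km: "(\<lambda>u. K (matching (gap_plus \<mu> \<nu>) (gap_minus \<mu> \<nu>) u)) \<in> borel_measurable lebesgue01"
    "(\<lambda>u. K (matching (gap_minus \<mu> \<nu>) (gap_plus \<mu> \<nu>) u)) \<in> borel_measurable lebesgue01"
    by (rule measurable_compose[OF m(1) K]) (rule measurable_compose[OF m(2) K])
  have "(\<integral>\<^sup>+u. ennreal (\<bar>quantile \<mu> u - quantile \<nu> u\<bar> * k (quantile \<nu> (IT_phi \<mu> \<nu> u))) \<partial>lebesgue01) =
    (\<integral>\<^sup>+u. ennreal (gap_plus \<mu> \<nu> u) * K (matching (gap_plus \<mu> \<nu>) (gap_minus \<mu> \<nu>) u)
         + ennreal (gap_minus \<mu> \<nu> u) * K (matching (gap_minus \<mu> \<nu>) (gap_plus \<mu> \<nu>) u) \<partial>lebesgue01)"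
  proof (rule nn_integral_cong)
    fix u
    show "ennreal (\<bar>quantile \<mu> u - quantile \<nu> u\<bar> * k (quantile \<nu> (IT_phi \<mu> \<nu> u))) =
       ennreal (gap_plus \<mu> \<nu> u) * K (matching (gap_plus \<mu> \<nu>) (gap_minus \<mu> \<nu>) u)
         + ennreal (gap_minus \<mu> \<nu> u) * K (matching (gap_minus \<mu> \<nu>) (gap_plus \<mu> \<nu>) u)"
      using IT_phi_eq_matching[of u] k0
      by (cases "quantile \<mu> u" "quantile \<nu> u" rule: linorder_cases) (auto simp: K_def ennreal_mult max_def gap_plus_def gap_minus_def)
  qed
  also have "\<dots> = (\<integral>\<^sup>+u. ennreal (gap_plus \<mu> \<nu> u) * K (matching (gap_plus \<mu> \<nu>) (gap_minus \<mu> \<nu>) u) \<partial>lebesgue01)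
         + (\<integral>\<^sup>+u. ennreal (gap_minus \<mu> \<nu> u) * K (matching (gap_minus \<mu> \<nu>) (gap_plus \<mu> \<nu>) u) \<partial>lebesgue01)"
    by (intro nn_integral_add borel_measurable_times_ennreal gm Km)
  also have "\<dots> = (\<integral>\<^sup>+u. ennreal (gap_minus \<mu> \<nu> u) * K u \<partial>lebesgue01) + (\<integral>\<^sup>+u. ennreal (gap_plus \<mu> \<nu> u) * K u \<partial>lebesgue01)"
    unfolding nn_integral_matching[OF gap_plus_setup K] nn_integral_matching[OF gap_minus_setup K] ..
  also have "\<dots> = (\<integral>\<^sup>+u. ennreal (gap_minus \<mu> \<nu> u) * K u + ennreal (gap_plus \<mu> \<nu> u) * K u \<partial>lebesgue01)"
    by (intro nn_integral_add[symmetric] borel_measurable_times_ennreal gm K')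
  also have "\<dots> = (\<integral>\<^sup>+u. ennreal (\<bar>quantile \<mu> u - quantile \<nu> u\<bar> * k (quantile \<nu> u)) \<partial>lebesgue01)"
    by (intro nn_integral_cong) (use k0 in \<open>auto simp: K_def ennreal_mult max_def gap_plus_def gap_minus_def\<close>)
  finally show ?thesis .
qed

lemma AE_two_point_IT_kernel:
  assumes m: "lifted_IT_kernel \<mu> \<nu> m"
  shows "AE u in lebesgue01.
    two_point (m u) (IT_weight \<mu> \<nu> u) (quantile \<nu> (IT_phi \<mu> \<nu> u)) (quantile \<nu> u)"
proof -
  have "AE u in lebesgue01. \<forall>A\<in>sets borel.
        measure (m u) A =
          IT_weight \<mu> \<nu> u * indicator A (quantile \<nu> (IT_phi \<mu> \<nu> u))
          + (1 - IT_weight \<mu> \<nu> u) * indicator A (quantile \<nu> u)"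
    and mk: "m \<in> prob_kernels"
    using m by (auto simp: lifted_IT_kernel_def)
  from this(1) AE_space[of lebesgue01] AE_IT_weight show ?thesis
  proof eventually_elim
    case (elim u)
    have "m u \<in> space (prob_algebra borel)" by (rule measurable_space[OF mk elim(2)])
    then have "prob_space (m u)" "sets (m u) = sets borel" by (auto simp: space_prob_algebra)
    then show ?case using elim(1,3) by (intro two_pointI) auto
  qed
qed

end

section \<open>Convergence of the inverse transform kernels\<close>

text \<open>
  The transport sends almost no point to a discontinuity of the limit quantile or to the left end of a flat
  piece, and everywhere else both limits can be taken.
\<close>

lemma AE_quantile_matching_tendsto:
  fixes a b :: "nat \<Rightarrow> real \<Rightarrow> real"
  assumes a: "\<And>n. integrable lebesgue01 (a n)" "\<And>n u. 0 \<le> a n u"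
    and b: "\<And>n. integrable lebesgue01 (b n)" "\<And>n u. 0 \<le> b n u"
    and ab: "\<And>n. primitive01 (a n) 1 = primitive01 (b n) 1"
    and a': "integrable lebesgue01 a'" "\<And>u. 0 \<le> a' u"
    and b': "integrable lebesgue01 b'" "\<And>u. 0 \<le> b' u"
    and ab': "primitive01 a' 1 = primitive01 b' 1"
    and conv_a: "(\<lambda>n. \<integral>\<^sup>+u. ennreal \<bar>a n u - a' u\<bar> \<partial>lebesgue01) \<longlonglongrightarrow> 0"
    and conv_b: "(\<lambda>n. \<integral>\<^sup>+u. ennreal \<bar>b n u - b' u\<bar> \<partial>lebesgue01) \<longlonglongrightarrow> 0"
    and \<nu>: "\<And>n. real_distribution (\<nu>\<^sub>n n)" "real_distribution \<nu>" and \<rho>: "0 < \<rho>"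
    and W: "(\<lambda>n. wasserstein \<rho> (\<nu>\<^sub>n n) \<nu>) \<longlonglongrightarrow> 0"
  shows "AE u in lebesgue01. 0 < a' u \<longrightarrow>
    (\<lambda>n. quantile (\<nu>\<^sub>n n) (matching (a n) (b n) u)) \<longlonglongrightarrow> quantile \<nu> (matching a' b' u)"
proof -
  have "AE v in lebesgue01. 0 < b' v \<longrightarrow> isCont (quantile \<nu>) v \<and>
      (\<forall>y. v < y \<longrightarrow> y \<le> 1 \<longrightarrow> primitive01 b' v < primitive01 b' y)"
    using AE_primitive01_strict[OF b'] AE_isCont_quantile[OF \<nu>(2)] by eventually_elim auto
  from AE_matching[OF a' b' ab' this] AE_lebesgue01_in show ?thesis
  proof eventually_elim
    case (elim u)
    show ?case
    proof
      assume "0 < a' u"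
      with elim have v: "0 < matching a' b' u" "matching a' b' u < 1" "isCont (quantile \<nu>) (matching a' b' u)"
        "\<And>y. matching a' b' u < y \<Longrightarrow> y \<le> 1 \<Longrightarrow> primitive01 b' (matching a' b' u) < primitive01 b' y"
        by auto
      have "(\<lambda>n. matching (a n) (b n) u) \<longlonglongrightarrow> matching a' b' u"
        using elim(2) v(2,4)
        by (intro matching_tendsto a b ab a' b' ab' primitive01_tendsto conv_a conv_b) auto
      then show "(\<lambda>n. quantile (\<nu>\<^sub>n n) (matching (a n) (b n) u)) \<longlonglongrightarrow> quantile \<nu> (matching a' b' u)"
        by (rule quantile_tendsto[OF \<nu> \<rho> W v(1-3)])
    qed
  qed
qed

lemma gap_times_powr_le:
  fixes x y \<rho> :: real
  assumes "1 \<le> \<rho>"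
  shows "\<bar>x - y\<bar> * (1 + \<bar>y\<bar>) powr (\<rho> - 1) \<le> 4 powr \<rho> * (1 + \<bar>x\<bar> powr \<rho> + \<bar>y\<bar> powr \<rho>)"
proof -
  define m where "m = 1 + (\<bar>x\<bar> + \<bar>y\<bar>)"
  have "\<bar>x - y\<bar> * (1 + \<bar>y\<bar>) powr (\<rho> - 1) \<le> m * m powr (\<rho> - 1)"
    using assms by (intro mult_mono powr_mono2) (auto simp: m_def)
  also have "\<dots> = m powr \<rho>" by (subst powr_mult_base) (auto simp: m_def)
  also have "\<dots> \<le> 2 powr \<rho> * (1 powr \<rho> + (\<bar>x\<bar> + \<bar>y\<bar>) powr \<rho>)"
    unfolding m_def using assms by (intro powr_add_le) auto
  also have "\<dots> \<le> 2 powr \<rho> * (2 powr \<rho> + 2 powr \<rho> * (\<bar>x\<bar> powr \<rho> + \<bar>y\<bar> powr \<rho>))"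
    using assms by (intro mult_left_mono add_mono powr_add_le) (auto intro: ge_one_powr_ge_zero)
  also have "\<dots> = (2 * 2) powr \<rho> * (1 + \<bar>x\<bar> powr \<rho> + \<bar>y\<bar> powr \<rho>)"
    by (subst powr_mult) (auto simp: algebra_simps)
  finally show ?thesis by simp
qed

text \<open>
  One factor \<open>\<bar>a - b\<bar>\<close> is absorbed by the weight, since \<open>p * \<bar>a - b\<bar> = \<bar>g\<bar>\<close>. What is
  left is \<open>\<bar>g\<bar>\<close> times a function of each atom alone, to which the transport identity applies.
\<close>

lemma weighted_powr_le:
  fixes a b g p \<rho> :: real
  assumes "1 \<le> \<rho>" "0 \<le> p" "p * (a - b) = g"
  shows "p * \<bar>a - b\<bar> powr \<rho> \<le> 2 powr (\<rho> - 1) * (\<bar>g\<bar> * (1 + \<bar>a\<bar>) powr (\<rho> - 1) + \<bar>g\<bar> * (1 + \<bar>b\<bar>) powr (\<rho> - 1))"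
proof -
  have "p * \<bar>a - b\<bar> powr \<rho> = \<bar>g\<bar> * \<bar>a - b\<bar> powr (\<rho> - 1)"
  proof (cases "a = b")
    case False
    then have "\<bar>a - b\<bar> powr \<rho> = \<bar>a - b\<bar> * \<bar>a - b\<bar> powr (\<rho> - 1)" by (subst powr_mult_base) auto
    then show ?thesis using assms(2) by (simp add: assms(3)[symmetric] abs_mult)
  qed (use assms in auto)
  also have "\<dots> \<le> \<bar>g\<bar> * (2 powr (\<rho> - 1) * (\<bar>a\<bar> powr (\<rho> - 1) + \<bar>b\<bar> powr (\<rho> - 1)))"
    using assms by (intro mult_left_mono abs_powr_diff_le) auto
  also have "\<dots> \<le> \<bar>g\<bar> * (2 powr (\<rho> - 1) * ((1 + \<bar>a\<bar>) powr (\<rho> - 1) + (1 + \<bar>b\<bar>) powr (\<rho> - 1)))"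
    using assms by (intro mult_left_mono add_mono powr_mono2) auto
  finally show ?thesis by (simp add: algebra_simps)
qed

lemma abs_powr_add3_le:
  fixes x y z :: real
  assumes "0 \<le> \<rho>"
  shows "\<bar>x + y + z\<bar> powr \<rho> \<le> 4 powr \<rho> * (\<bar>x\<bar> powr \<rho> + \<bar>y\<bar> powr \<rho> + \<bar>z\<bar> powr \<rho>)"
proof -
  have one: "1 \<le> 2 powr \<rho>" using assms by (auto intro: ge_one_powr_ge_zero)
  have "\<bar>x + (y + z)\<bar> powr \<rho> \<le> 2 powr \<rho> * (\<bar>x\<bar> powr \<rho> + \<bar>y + z\<bar> powr \<rho>)"
    by (rule abs_powr_add_le[OF assms])
  also have "\<dots> \<le> 2 powr \<rho> * (2 powr \<rho> * \<bar>x\<bar> powr \<rho> + 2 powr \<rho> * (\<bar>y\<bar> powr \<rho> + \<bar>z\<bar> powr \<rho>))"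
    using mult_right_mono[OF one, of "\<bar>x\<bar> powr \<rho>"]
    by (intro mult_left_mono add_mono abs_powr_add_le assms) auto
  also have "\<dots> = (2 * 2) powr \<rho> * (\<bar>x\<bar> powr \<rho> + \<bar>y\<bar> powr \<rho> + \<bar>z\<bar> powr \<rho>)"
    by (subst powr_mult) (auto simp: algebra_simps)
  finally show ?thesis by (simp add: add.assoc)
qed

text \<open>
  Each atom is compared with the other through \<open>b\<close> and \<open>b'\<close>, and a distance from \<open>a\<close> to \<open>b\<close> enters only
  with a factor of at most \<open>p\<close>, a distance from \<open>a'\<close> to \<open>b'\<close> only with a factor of at most \<open>p'\<close>.
\<close>

lemma monotone_cost_le:
  assumes p: "0 \<le> p" "p \<le> 1" "0 \<le> p'" "p' \<le> 1" and \<rho>: "0 \<le> \<rho>"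
  shows "monotone_cost \<rho> p a b p' a' b' \<le>
    4 * 4 powr \<rho> * (p * \<bar>a - b\<bar> powr \<rho> + \<bar>b - b'\<bar> powr \<rho> + p' * \<bar>a' - b'\<bar> powr \<rho>)"
proof -
  define A where "A = \<bar>a - b\<bar> powr \<rho>"
  define B where "B = \<bar>b - b'\<bar> powr \<rho>"
  define A' where "A' = \<bar>a' - b'\<bar> powr \<rho>"
  define C where "C = (4::real) powr \<rho>"
  have nn: "0 \<le> A" "0 \<le> B" "0 \<le> A'" by (auto simp: A_def B_def A'_def)
  have C: "1 \<le> C" using \<rho> by (auto simp: C_def intro: ge_one_powr_ge_zero)
  have tri: "\<bar>a - a'\<bar> powr \<rho> \<le> C * (A + B + A')" "\<bar>a - b'\<bar> powr \<rho> \<le> C * (A + B)" "\<bar>b - a'\<bar> powr \<rho> \<le> C * (B + A')"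
    using abs_powr_add3_le[OF \<rho>, of "a - b" "b - b'" "b' - a'"] abs_powr_add3_le[OF \<rho>, of "a - b" "b - b'" 0]
      abs_powr_add3_le[OF \<rho>, of 0 "b - b'" "b' - a'"]
    by (auto simp: A_def B_def A'_def C_def abs_minus_commute)
  have weight: "w * x \<le> T" if "0 \<le> w" "x \<le> C * y" "w * y \<le> t" "T = C * t" for w x y t T :: real
  proof -
    have "w * x \<le> w * (C * y)" using that by (intro mult_left_mono)
    also have "\<dots> = C * (w * y)" by simp
    also have "\<dots> \<le> T" unfolding that(4) using that C by (intro mult_left_mono) auto
    finally show ?thesis .
  qed
  define T where "T = p * A + B + p' * A'"
  have pa: "0 \<le> p * A" "0 \<le> p' * A'" using p nn by auto
  have 1: "min p p' * \<bar>a - a'\<bar> powr \<rho> \<le> C * T"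
  proof (rule weight[OF _ tri(1)])
    have "min p p' * A \<le> p * A" "min p p' * B \<le> 1 * B" "min p p' * A' \<le> p' * A'"
      by (rule mult_right_mono; use p nn in simp)+
    then show "min p p' * (A + B + A') \<le> T" by (simp add: T_def distrib_left)
  qed (use p in auto)
  have 2: "min (1 - p) (1 - p') * \<bar>b - b'\<bar> powr \<rho> \<le> C * T"
  proof (rule weight[where y = B])
    show "\<bar>b - b'\<bar> powr \<rho> \<le> C * B" using mult_right_mono[OF C nn(2)] by (simp add: B_def)
    have "min (1 - p) (1 - p') * B \<le> 1 * B" using p nn by (intro mult_right_mono) auto
    then show "min (1 - p) (1 - p') * B \<le> T" using pa by (simp add: T_def)
  qed (use p in auto)
  have 3: "max 0 (p - p') * \<bar>a - b'\<bar> powr \<rho> \<le> C * T"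
  proof (rule weight[OF _ tri(2)])
    have "max 0 (p - p') * A \<le> p * A" "max 0 (p - p') * B \<le> 1 * B"
      by (rule mult_right_mono; use p nn in simp)+
    then show "max 0 (p - p') * (A + B) \<le> T" using pa by (simp add: T_def distrib_left)
  qed auto
  have 4: "max 0 (p' - p) * \<bar>b - a'\<bar> powr \<rho> \<le> C * T"
  proof (rule weight[OF _ tri(3)])
    have "max 0 (p' - p) * A' \<le> p' * A'" "max 0 (p' - p) * B \<le> 1 * B"
      by (rule mult_right_mono; use p nn in simp)+
    then show "max 0 (p' - p) * (B + A') \<le> T" using pa by (simp add: T_def distrib_left)
  qed auto
  have "monotone_cost \<rho> p a b p' a' b' \<le> C * T + C * T + C * T + C * T"
    unfolding monotone_cost_def by (intro add_mono 1 2 3 4)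
  then show ?thesis by (simp add: T_def C_def A_def B_def A'_def)
qed

lemma monotone_cost_nonneg:
  "0 \<le> p \<Longrightarrow> p \<le> 1 \<Longrightarrow> 0 \<le> p' \<Longrightarrow> p' \<le> 1 \<Longrightarrow> 0 \<le> monotone_cost \<rho> p a b p' a' b'"
  by (auto simp: monotone_cost_def)

lemma monotone_cost_tendsto_0:
  assumes "0 < \<rho>" "p \<longlonglongrightarrow> p'" "a \<longlonglongrightarrow> a'" "b \<longlonglongrightarrow> b'"
  shows "(\<lambda>n. monotone_cost \<rho> (p n) (a n) (b n) p' a' b') \<longlonglongrightarrow> 0"
proof -
  have "(\<lambda>n. monotone_cost \<rho> (p n) (a n) (b n) p' a' b') \<longlonglongrightarrow>
     min p' p' * \<bar>a' - a'\<bar> powr \<rho> + min (1 - p') (1 - p') * \<bar>b' - b'\<bar> powr \<rho>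
     + max 0 (p' - p') * \<bar>a' - b'\<bar> powr \<rho> + max 0 (p' - p') * \<bar>b' - a'\<bar> powr \<rho>"
    unfolding monotone_cost_def using assms
    by (intro tendsto_intros tendsto_powr2) auto
  then show ?thesis by simp
qed

lemma L1_tendsto_add:
  fixes f g :: "nat \<Rightarrow> real \<Rightarrow> real"
  assumes [measurable]: "\<And>n. f n \<in> borel_measurable M" "f' \<in> borel_measurable M"
     "\<And>n. g n \<in> borel_measurable M" "g' \<in> borel_measurable M"
   and f: "(\<lambda>n. \<integral>\<^sup>+u. ennreal \<bar>f n u - f' u\<bar> \<partial>M) \<longlonglongrightarrow> 0"
   and g: "(\<lambda>n. \<integral>\<^sup>+u. ennreal \<bar>g n u - g' u\<bar> \<partial>M) \<longlonglongrightarrow> 0"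
  shows "(\<lambda>n. \<integral>\<^sup>+u. ennreal (\<bar>f n u - f' u\<bar> + \<bar>g n u - g' u\<bar>) \<partial>M) \<longlonglongrightarrow> 0"
proof -
  have "(\<integral>\<^sup>+u. ennreal (\<bar>f n u - f' u\<bar> + \<bar>g n u - g' u\<bar>) \<partial>M) =
      (\<integral>\<^sup>+u. ennreal \<bar>f n u - f' u\<bar> \<partial>M) + (\<integral>\<^sup>+u. ennreal \<bar>g n u - g' u\<bar> \<partial>M)" for n
    by (subst nn_integral_add[symmetric]) auto
  then show ?thesis using tendsto_add[OF f g] by simp
qed

lemma nn_integral_tendsto_0_le:
  fixes f g :: "nat \<Rightarrow> 'a \<Rightarrow> ennreal"
  assumes "\<And>n. AE x in M. f n x \<le> g n x" "(\<lambda>n. \<integral>\<^sup>+x. g n x \<partial>M) \<longlonglongrightarrow> 0"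
  shows "(\<lambda>n. \<integral>\<^sup>+x. f n x \<partial>M) \<longlonglongrightarrow> 0"
  by (rule tendsto_sandwich[OF _ _ tendsto_const assms(2)])
    (use nn_integral_mono_AE[OF assms(1)] in simp_all)

lemma nn_integral_cmult_tendsto_0:
  fixes f :: "nat \<Rightarrow> 'a \<Rightarrow> real"
  assumes [measurable]: "\<And>n. f n \<in> borel_measurable M" and c: "0 \<le> c"
    and f: "(\<lambda>n. \<integral>\<^sup>+x. ennreal (f n x) \<partial>M) \<longlonglongrightarrow> 0"
  shows "(\<lambda>n. \<integral>\<^sup>+x. ennreal (c * f n x) \<partial>M) \<longlonglongrightarrow> 0"
proof -
  have "(\<integral>\<^sup>+x. ennreal (c * f n x) \<partial>M) = ennreal c * (\<integral>\<^sup>+x. ennreal (f n x) \<partial>M)" for n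
    using c by (simp add: nn_integral_cmult ennreal_mult')
  then show ?thesis using ennreal_tendsto_cmult[OF _ f, of "ennreal c"] by simp
qed

locale convergent_convex_ordered_pairs =
  fixes \<rho> :: real and \<mu>\<^sub>n \<nu>\<^sub>n :: "nat \<Rightarrow> real measure" and \<mu> \<nu> :: "real measure"
  assumes \<rho>: "1 \<le> \<rho>"
    and fin_n: "\<And>n. \<mu>\<^sub>n n \<in> finite_moment_measures \<rho>" "\<And>n. \<nu>\<^sub>n n \<in> finite_moment_measures \<rho>"
    and fin: "\<mu> \<in> finite_moment_measures \<rho>" "\<nu> \<in> finite_moment_measures \<rho>"
    and cx: "\<And>n. convex_order (\<mu>\<^sub>n n) (\<nu>\<^sub>n n)"
    and W_mu: "(\<lambda>n. wasserstein \<rho> (\<mu>\<^sub>n n) \<mu>) \<longlonglongrightarrow> 0"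
    and W_nu: "(\<lambda>n. wasserstein \<rho> (\<nu>\<^sub>n n) \<nu>) \<longlonglongrightarrow> 0"
begin

lemma \<rho>_pos: "0 < \<rho>" using \<rho> by simp

lemma finite_moment_facts:
  assumes "\<eta> \<in> finite_moment_measures \<rho>"
  shows "real_distribution \<eta>" "(\<integral>\<^sup>+x. ennreal (\<bar>x\<bar> powr \<rho>) \<partial>\<eta>) < \<infinity>" "integrable \<eta> (\<lambda>x. x)"
    "integrable lebesgue01 (quantile \<eta>)" "integrable lebesgue01 (\<lambda>u. \<bar>quantile \<eta> u\<bar> powr \<rho>)"
proof -
  show \<eta>: "real_distribution \<eta>" using assms by (auto simp: finite_moment_measures_def)
  have int: "integrable \<eta> (\<lambda>x. \<bar>x\<bar> powr \<rho>)"
    using assms by (auto simp: finite_moment_measures_def)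
  interpret real_distribution \<eta> by fact
  show "(\<integral>\<^sup>+x. ennreal (\<bar>x\<bar> powr \<rho>) \<partial>\<eta>) < \<infinity>"
    using int by (simp add: nn_integral_eq_integral)
  show i: "integrable \<eta> (\<lambda>x. x)"
  proof (rule Bochner_Integration.integrable_bound)
    show "integrable \<eta> (\<lambda>x. \<bar>x\<bar> powr \<rho> + 1)" using int by simp
    show "AE x in \<eta>. norm x \<le> norm (\<bar>x\<bar> powr \<rho> + 1)"
      using powr_le_add_one[OF \<rho>] by (auto intro!: AE_I2 simp: abs_of_nonneg add_nonneg_nonneg)
  qed simp
  show "integrable lebesgue01 (quantile \<eta>)"
    using integrable_quantile_iff[OF \<eta> measurable_ident_sets[OF refl]] i by blast
  show "integrable lebesgue01 (\<lambda>u. \<bar>quantile \<eta> u\<bar> powr \<rho>)"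
    using integrable_quantile_iff[OF \<eta>, of "\<lambda>x. \<bar>x\<bar> powr \<rho>"] int by simp
qed

lemmas mu_n = finite_moment_facts[OF fin_n(1)]
lemmas nu_n = finite_moment_facts[OF fin_n(2)]
lemmas mu = finite_moment_facts[OF fin(1)]
lemmas nu = finite_moment_facts[OF fin(2)]

lemmas measurable_q [measurable] =
  measurable_lebesgue01I[OF measurable_quantile[OF mu_n(1)]] measurable_lebesgue01I[OF measurable_quantile[OF nu_n(1)]]
  measurable_lebesgue01I[OF measurable_quantile[OF mu(1)]] measurable_lebesgue01I[OF measurable_quantile[OF nu(1)]]

lemmas L1_mu = quantile_L1_tendsto[OF mu_n(1) mu(1) \<rho> W_mu mu(2)]
lemmas L1_nu = quantile_L1_tendsto[OF nu_n(1) nu(1) \<rho> W_nu nu(2)]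
lemmas AE_mu = AE_quantile_tendsto[OF mu_n(1) mu(1) \<rho> W_mu mu(2)]
lemmas AE_nu = AE_quantile_tendsto[OF nu_n(1) nu(1) \<rho> W_nu nu(2)]

lemma qc_n: "quantile_convex_order (\<mu>\<^sub>n n) (\<nu>\<^sub>n n)"
  by (rule convex_order_quantile_convex_order[OF mu_n(1,3) nu_n(1,3) cx])

lemma qc: "quantile_convex_order \<mu> \<nu>"
proof -
  have lim: "(\<lambda>n. primitive01 (quantile (\<mu>\<^sub>n n)) u) \<longlonglongrightarrow> primitive01 (quantile \<mu>) u"
    "(\<lambda>n. primitive01 (quantile (\<nu>\<^sub>n n)) u) \<longlonglongrightarrow> primitive01 (quantile \<nu>) u" if "0 \<le> u" "u \<le> 1" for u
    using primitive01_tendsto[OF mu_n(4) mu(4) L1_mu that] primitive01_tendsto[OF nu_n(4) nu(4) L1_nu that]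
    by auto
  have "primitive01 (quantile \<nu>) u \<le> primitive01 (quantile \<mu>) u" if u: "0 \<le> u" "u \<le> 1" for u
    using u qc_n by (intro LIMSEQ_le[OF lim(2)[OF u] lim(1)[OF u]]) (auto simp: quantile_convex_order_def)
  moreover have "primitive01 (quantile \<nu>) 1 = primitive01 (quantile \<mu>) 1"
    using lim(1)[of 1] lim(2)[of 1] qc_n LIMSEQ_unique by (auto simp: quantile_convex_order_def)
  ultimately show ?thesis using mu nu by (auto simp: quantile_convex_order_def)
qed

lemma gap_L1_tendsto:
  "(\<lambda>n. \<integral>\<^sup>+u. ennreal \<bar>gap_plus (\<mu>\<^sub>n n) (\<nu>\<^sub>n n) u - gap_plus \<mu> \<nu> u\<bar> \<partial>lebesgue01) \<longlonglongrightarrow> 0"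
  "(\<lambda>n. \<integral>\<^sup>+u. ennreal \<bar>gap_minus (\<mu>\<^sub>n n) (\<nu>\<^sub>n n) u - gap_minus \<mu> \<nu> u\<bar> \<partial>lebesgue01) \<longlonglongrightarrow> 0"
proof -
  have "(\<lambda>n. \<integral>\<^sup>+u. ennreal (\<bar>quantile (\<mu>\<^sub>n n) u - quantile \<mu> u\<bar> + \<bar>quantile (\<nu>\<^sub>n n) u - quantile \<nu> u\<bar>) \<partial>lebesgue01) \<longlonglongrightarrow> 0"
    by (intro L1_tendsto_add measurable_q L1_mu L1_nu)
  note le = nn_integral_tendsto_0_le[OF _ this]
  show "(\<lambda>n. \<integral>\<^sup>+u. ennreal \<bar>gap_plus (\<mu>\<^sub>n n) (\<nu>\<^sub>n n) u - gap_plus \<mu> \<nu> u\<bar> \<partial>lebesgue01) \<longlonglongrightarrow> 0"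
    by (rule le) (auto intro!: AE_I2 ennreal_leI simp: gap_plus_def max_def simp del: ennreal_plus)
  show "(\<lambda>n. \<integral>\<^sup>+u. ennreal \<bar>gap_minus (\<mu>\<^sub>n n) (\<nu>\<^sub>n n) u - gap_minus \<mu> \<nu> u\<bar> \<partial>lebesgue01) \<longlonglongrightarrow> 0"
    by (rule le) (auto intro!: AE_I2 ennreal_leI simp: gap_minus_def max_def simp del: ennreal_plus)
qed

text \<open>
  Where \<open>q u \<noteq> r u\<close> the sign of the gap is eventually that of the limit, so eventually the same one of
  the two transports is in use.
\<close>

lemma AE_IT_tendsto:
  "AE u in lebesgue01. quantile \<mu> u \<noteq> quantile \<nu> u \<longrightarrow>
     (\<lambda>n. quantile (\<nu>\<^sub>n n) (IT_phi (\<mu>\<^sub>n n) (\<nu>\<^sub>n n) u)) \<longlonglongrightarrow> quantile \<nu> (IT_phi \<mu> \<nu> u) \<and>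
     (\<lambda>n. IT_weight (\<mu>\<^sub>n n) (\<nu>\<^sub>n n) u) \<longlonglongrightarrow> IT_weight \<mu> \<nu> u"
  using AE_quantile_matching_tendsto[OF gap_plus_setup[OF qc_n] gap_plus_setup[OF qc] gap_L1_tendsto nu_n(1) nu(1) \<rho>_pos W_nu]
    AE_quantile_matching_tendsto[OF gap_minus_setup[OF qc_n] gap_minus_setup[OF qc] gap_L1_tendsto(2,1) nu_n(1) nu(1) \<rho>_pos W_nu]
    AE_mu AE_nu AE_IT_bracket[OF qc]
proof eventually_elim
  case (elim u)
  show ?case
  proof
    assume ne: "quantile \<mu> u \<noteq> quantile \<nu> u"
    have a: "(\<lambda>n. quantile (\<nu>\<^sub>n n) (IT_phi (\<mu>\<^sub>n n) (\<nu>\<^sub>n n) u)) \<longlonglongrightarrow> quantile \<nu> (IT_phi \<mu> \<nu> u)"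
    proof (cases "quantile \<nu> u < quantile \<mu> u")
      case True
      have "\<forall>\<^sub>F n in sequentially. 0 < quantile (\<mu>\<^sub>n n) u - quantile (\<nu>\<^sub>n n) u"
        using order_tendstoD(1)[OF tendsto_diff[OF elim(3,4)], of 0] True by simp
      then have "\<forall>\<^sub>F n in sequentially. quantile (\<nu>\<^sub>n n) (matching (gap_plus (\<mu>\<^sub>n n) (\<nu>\<^sub>n n)) (gap_minus (\<mu>\<^sub>n n) (\<nu>\<^sub>n n)) u)
          = quantile (\<nu>\<^sub>n n) (IT_phi (\<mu>\<^sub>n n) (\<nu>\<^sub>n n) u)"
        by eventually_elim (simp add: IT_phi_eq_matching(1)[OF qc_n])
      moreover have "(\<lambda>n. quantile (\<nu>\<^sub>n n) (matching (gap_plus (\<mu>\<^sub>n n) (\<nu>\<^sub>n n)) (gap_minus (\<mu>\<^sub>n n) (\<nu>\<^sub>n n)) u))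
         \<longlonglongrightarrow> quantile \<nu> (IT_phi \<mu> \<nu> u)"
        using elim(1) True by (simp add: IT_phi_eq_matching(1)[OF qc] gap_pos_iff)
      ultimately show ?thesis by (rule Lim_transform_eventually[rotated])
    next
      case False
      with ne have lt: "quantile \<mu> u < quantile \<nu> u" by simp
      have "\<forall>\<^sub>F n in sequentially. 0 < quantile (\<nu>\<^sub>n n) u - quantile (\<mu>\<^sub>n n) u"
        using order_tendstoD(1)[OF tendsto_diff[OF elim(4,3)], of 0] lt by simp
      then have "\<forall>\<^sub>F n in sequentially. quantile (\<nu>\<^sub>n n) (matching (gap_minus (\<mu>\<^sub>n n) (\<nu>\<^sub>n n)) (gap_plus (\<mu>\<^sub>n n) (\<nu>\<^sub>n n)) u)
          = quantile (\<nu>\<^sub>n n) (IT_phi (\<mu>\<^sub>n n) (\<nu>\<^sub>n n) u)"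
        by eventually_elim (simp add: IT_phi_eq_matching(2)[OF qc_n])
      moreover have "(\<lambda>n. quantile (\<nu>\<^sub>n n) (matching (gap_minus (\<mu>\<^sub>n n) (\<nu>\<^sub>n n)) (gap_plus (\<mu>\<^sub>n n) (\<nu>\<^sub>n n)) u))
         \<longlonglongrightarrow> quantile \<nu> (IT_phi \<mu> \<nu> u)"
        using elim(2) lt by (simp add: IT_phi_eq_matching(2)[OF qc] gap_pos_iff)
      ultimately show ?thesis by (rule Lim_transform_eventually[rotated])
    qed
    have "quantile \<nu> (IT_phi \<mu> \<nu> u) - quantile \<nu> u \<noteq> 0"
      using elim(5) ne by (cases "quantile \<nu> u" "quantile \<mu> u" rule: linorder_cases) auto
    from tendsto_divide[OF tendsto_diff[OF elim(3,4)] tendsto_diff[OF a elim(4)] this]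
    have "(\<lambda>n. (quantile (\<mu>\<^sub>n n) u - quantile (\<nu>\<^sub>n n) u) /
            (quantile (\<nu>\<^sub>n n) (IT_phi (\<mu>\<^sub>n n) (\<nu>\<^sub>n n) u) - quantile (\<nu>\<^sub>n n) u)) \<longlonglongrightarrow> IT_weight \<mu> \<nu> u"
      using ne by (simp add: IT_weight_def)
    then have "(\<lambda>n. IT_weight (\<mu>\<^sub>n n) (\<nu>\<^sub>n n) u) \<longlonglongrightarrow> IT_weight \<mu> \<nu> u"
      by (rule Lim_transform_eventually) (auto simp: IT_weight_def intro!: always_eventually)
    with a show "(\<lambda>n. quantile (\<nu>\<^sub>n n) (IT_phi (\<mu>\<^sub>n n) (\<nu>\<^sub>n n) u)) \<longlonglongrightarrow> quantile \<nu> (IT_phi \<mu> \<nu> u) \<and>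
     (\<lambda>n. IT_weight (\<mu>\<^sub>n n) (\<nu>\<^sub>n n) u) \<longlonglongrightarrow> IT_weight \<mu> \<nu> u" by simp
  qed
qed

text \<open>
  The shift by \<open>1\<close> keeps this weight continuous, and equal to \<open>1\<close> for \<open>\<rho> = 1\<close>: \<open>\<bar>x\<bar> powr 0\<close> is \<open>0\<close> at
  \<open>x = 0\<close> and \<open>1\<close> elsewhere.
\<close>

definition growth :: "real \<Rightarrow> real" where "growth x = (1 + \<bar>x\<bar>) powr (\<rho> - 1)"

lemma growth_nonneg: "0 \<le> growth x" by (simp add: growth_def)

lemma measurable_growth [measurable]: "growth \<in> borel_measurable borel"
  unfolding growth_def[abs_def] by measurable

lemma tendsto_growth: "X \<longlonglongrightarrow> x \<Longrightarrow> (\<lambda>n. growth (X n)) \<longlonglongrightarrow> growth x"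
  unfolding growth_def by (intro tendsto_intros) auto

text \<open>
  Up to constants, \<open>stay_weight\<close> and \<open>jump_weight\<close> together bound the cost of moving the kernel at \<open>u\<close> to a
  point mass at \<open>quantile \<nu>' u\<close>; the first looks at the atom at \<open>u\<close> and the second at the atom at \<open>\<phi> u\<close>.
\<close>

definition stay_weight :: "real measure \<Rightarrow> real measure \<Rightarrow> real \<Rightarrow> real" where
  "stay_weight \<mu>' \<nu>' u = \<bar>quantile \<mu>' u - quantile \<nu>' u\<bar> * growth (quantile \<nu>' u)"

definition jump_weight :: "real measure \<Rightarrow> real measure \<Rightarrow> real \<Rightarrow> real" where
  "jump_weight \<mu>' \<nu>' u = \<bar>quantile \<mu>' u - quantile \<nu>' u\<bar> * growth (quantile \<nu>' (IT_phi \<mu>' \<nu>' u))"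

lemma stay_jump_nonneg: "0 \<le> stay_weight \<mu>' \<nu>' u" "0 \<le> jump_weight \<mu>' \<nu>' u"
  by (auto simp: stay_weight_def jump_weight_def growth_nonneg)

lemma stay_weight_le: "stay_weight \<mu>' \<nu>' u \<le> 4 powr \<rho> * (1 + \<bar>quantile \<mu>' u\<bar> powr \<rho> + \<bar>quantile \<nu>' u\<bar> powr \<rho>)"
  unfolding stay_weight_def growth_def by (rule gap_times_powr_le[OF \<rho>])

lemma measurable_quantile_IT_phi:
  assumes "quantile_convex_order \<mu>' \<nu>'"
  shows "(\<lambda>u. quantile \<nu>' (IT_phi \<mu>' \<nu>' u)) \<in> borel_measurable lebesgue01"
  by (rule measurable_compose[OF measurable_IT_phi[OF assms] measurable_quantiles(2)[OF assms]])

lemma measurable_stay_weight: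
  assumes "quantile_convex_order \<mu>' \<nu>'" shows "stay_weight \<mu>' \<nu>' \<in> borel_measurable lebesgue01"
proof -
  note [measurable] = measurable_lebesgue01I[OF measurable_quantiles(1)[OF assms]] measurable_lebesgue01I[OF measurable_quantiles(2)[OF assms]]
  show ?thesis unfolding stay_weight_def[abs_def] by measurable
qed

lemma measurable_jump_weight:
  assumes "quantile_convex_order \<mu>' \<nu>'" shows "jump_weight \<mu>' \<nu>' \<in> borel_measurable lebesgue01"
proof -
  note [measurable] = measurable_lebesgue01I[OF measurable_quantiles(1)[OF assms]] measurable_lebesgue01I[OF measurable_quantiles(2)[OF assms]]
    measurable_quantile_IT_phi[OF assms]
  show ?thesis unfolding jump_weight_def[abs_def] by measurable
qed

lemmas stay_jump_measurable [measurable] = measurable_stay_weight[OF qc_n] measurable_stay_weight[OF qc] measurable_jump_weight[OF qc_n] measurable_jump_weight[OF qc]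

lemma nn_integral_jump_eq_stay:
  assumes "quantile_convex_order \<mu>' \<nu>'"
  shows "(\<integral>\<^sup>+u. ennreal (jump_weight \<mu>' \<nu>' u) \<partial>lebesgue01) = (\<integral>\<^sup>+u. ennreal (stay_weight \<mu>' \<nu>' u) \<partial>lebesgue01)"
  unfolding jump_weight_def stay_weight_def by (rule nn_integral_IT_phi[OF assms measurable_growth growth_nonneg])

lemma nn_integral_moment_bound_finite:
  "(\<integral>\<^sup>+u. ennreal (c * (1 + \<bar>quantile \<mu> u\<bar> powr \<rho> + \<bar>quantile \<nu> u\<bar> powr \<rho>)) \<partial>lebesgue01) < \<infinity>"
proof -
  interpret L: prob_space lebesgue01 by (rule prob_space_lebesgue01)
  have "integrable lebesgue01 (\<lambda>u. c * (1 + \<bar>quantile \<mu> u\<bar> powr \<rho> + \<bar>quantile \<nu> u\<bar> powr \<rho>))"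
    by (intro integrable_mult_right Bochner_Integration.integrable_add L.integrable_const mu(5) nu(5))
  from integrableD(2)[OF this] show ?thesis by (simp only: less_top infinity_ennreal_def)
qed

lemma nn_integral_stay_finite: "(\<integral>\<^sup>+u. ennreal (stay_weight \<mu> \<nu> u) \<partial>lebesgue01) < \<infinity>"
  by (rule le_less_trans[OF nn_integral_mono[OF ennreal_leI[OF stay_weight_le]] nn_integral_moment_bound_finite])

lemma stay_weight_L1_tendsto: "(\<lambda>n. \<integral>\<^sup>+u. ennreal \<bar>stay_weight (\<mu>\<^sub>n n) (\<nu>\<^sub>n n) u - stay_weight \<mu> \<nu> u\<bar> \<partial>lebesgue01) \<longlonglongrightarrow> 0"
proof -
  define dq where "dq = (\<lambda>n u. \<bar>\<bar>quantile (\<mu>\<^sub>n n) u\<bar> powr \<rho> - \<bar>quantile \<mu> u\<bar> powr \<rho>\<bar>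
       + \<bar>\<bar>quantile (\<nu>\<^sub>n n) u\<bar> powr \<rho> - \<bar>quantile \<nu> u\<bar> powr \<rho>\<bar>)"
  have dq0: "(\<lambda>n. \<integral>\<^sup>+u. ennreal (dq n u) \<partial>lebesgue01) \<longlonglongrightarrow> 0"
    unfolding dq_def
    by (intro L1_tendsto_add quantile_abs_powr_L1_tendsto[OF mu_n(1) mu(1) \<rho> W_mu mu(2)]
       quantile_abs_powr_L1_tendsto[OF nu_n(1) nu(1) \<rho> W_nu nu(2)]) measurable
  have dqm[measurable]: "dq n \<in> borel_measurable lebesgue01" for n unfolding dq_def by measurable
  define C where "C = (4::real) powr \<rho>"
  have C: "0 \<le> C" by (simp add: C_def)
  have aux: "1 + A + B + (1 + a + b) \<le> \<bar>A - a\<bar> + \<bar>B - b\<bar> + 2 * (1 + a + b)" for A B a b :: real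
    by (simp add: abs_if)
  show ?thesis
  proof (rule nn_integral_tendsto_0_dominated[where E = "\<lambda>n u. C * dq n u"
        and D = "\<lambda>u. 2 * C * (1 + \<bar>quantile \<mu> u\<bar> powr \<rho> + \<bar>quantile \<nu> u\<bar> powr \<rho>)"])
    show "AE u in lebesgue01. 0 \<le> \<bar>stay_weight (\<mu>\<^sub>n n) (\<nu>\<^sub>n n) u - stay_weight \<mu> \<nu> u\<bar> \<and> 0 \<le> C * dq n u \<and>
      \<bar>stay_weight (\<mu>\<^sub>n n) (\<nu>\<^sub>n n) u - stay_weight \<mu> \<nu> u\<bar> \<le> C * dq n u + 2 * C * (1 + \<bar>quantile \<mu> u\<bar> powr \<rho> + \<bar>quantile \<nu> u\<bar> powr \<rho>)" for n
    proof (intro AE_I2 conjI)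
      fix u
      show "0 \<le> C * dq n u" using C by (auto simp: dq_def)
      have "\<bar>stay_weight (\<mu>\<^sub>n n) (\<nu>\<^sub>n n) u - stay_weight \<mu> \<nu> u\<bar> \<le> stay_weight (\<mu>\<^sub>n n) (\<nu>\<^sub>n n) u + stay_weight \<mu> \<nu> u"
        using stay_jump_nonneg(1)[of "\<mu>\<^sub>n n" "\<nu>\<^sub>n n" u] stay_jump_nonneg(1)[of \<mu> \<nu> u] by linarith
      also have "\<dots> \<le> C * (1 + \<bar>quantile (\<mu>\<^sub>n n) u\<bar> powr \<rho> + \<bar>quantile (\<nu>\<^sub>n n) u\<bar> powr \<rho>)
           + C * (1 + \<bar>quantile \<mu> u\<bar> powr \<rho> + \<bar>quantile \<nu> u\<bar> powr \<rho>)"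
        unfolding C_def by (intro add_mono stay_weight_le)
      also have "\<dots> = C * ((1 + \<bar>quantile (\<mu>\<^sub>n n) u\<bar> powr \<rho> + \<bar>quantile (\<nu>\<^sub>n n) u\<bar> powr \<rho>)
           + (1 + \<bar>quantile \<mu> u\<bar> powr \<rho> + \<bar>quantile \<nu> u\<bar> powr \<rho>))"
        by (simp only: distrib_left)
      also have "\<dots> \<le> C * (dq n u + 2 * (1 + \<bar>quantile \<mu> u\<bar> powr \<rho> + \<bar>quantile \<nu> u\<bar> powr \<rho>))"
        unfolding dq_def by (rule mult_left_mono[OF aux C])
      finally show "\<bar>stay_weight (\<mu>\<^sub>n n) (\<nu>\<^sub>n n) u - stay_weight \<mu> \<nu> u\<bar> \<le> C * dq n u + 2 * C * (1 + \<bar>quantile \<mu> u\<bar> powr \<rho> + \<bar>quantile \<nu> u\<bar> powr \<rho>)"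
        by (simp only: distrib_left mult.assoc mult.left_commute[of C 2])
    qed auto
    show "(\<integral>\<^sup>+u. ennreal (2 * C * (1 + \<bar>quantile \<mu> u\<bar> powr \<rho> + \<bar>quantile \<nu> u\<bar> powr \<rho>)) \<partial>lebesgue01) < \<infinity>"
      by (rule nn_integral_moment_bound_finite)
    show "(\<lambda>n. \<integral>\<^sup>+u. ennreal (C * dq n u) \<partial>lebesgue01) \<longlonglongrightarrow> 0"
      by (rule nn_integral_cmult_tendsto_0[OF dqm C dq0])
    show "AE u in lebesgue01. (\<lambda>n. min \<bar>stay_weight (\<mu>\<^sub>n n) (\<nu>\<^sub>n n) u - stay_weight \<mu> \<nu> u\<bar>
       (2 * C * (1 + \<bar>quantile \<mu> u\<bar> powr \<rho> + \<bar>quantile \<nu> u\<bar> powr \<rho>))) \<longlonglongrightarrow> 0"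
      using AE_mu AE_nu
    proof eventually_elim
      case (elim u)
      define d where "d = 2 * C * (1 + \<bar>quantile \<mu> u\<bar> powr \<rho> + \<bar>quantile \<nu> u\<bar> powr \<rho>)"
      have "0 \<le> d" using C by (auto simp: d_def)
      moreover have "(\<lambda>n. min \<bar>stay_weight (\<mu>\<^sub>n n) (\<nu>\<^sub>n n) u - stay_weight \<mu> \<nu> u\<bar> d) \<longlonglongrightarrow> min \<bar>stay_weight \<mu> \<nu> u - stay_weight \<mu> \<nu> u\<bar> d"
        unfolding stay_weight_def by (intro tendsto_intros tendsto_growth elim)
      ultimately show ?case by (simp add: d_def[symmetric])
    qed
  qed (use C in auto)
qed

text \<open>
  The integrals converge because they equal those of \<open>stay_weight\<close>, and the limit vanishes on \<open>{q = r}\<close>,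
  the set where pointwise convergence is not available.
\<close>

lemma jump_weight_L1_tendsto: "(\<lambda>n. \<integral>\<^sup>+u. ennreal \<bar>jump_weight (\<mu>\<^sub>n n) (\<nu>\<^sub>n n) u - jump_weight \<mu> \<nu> u\<bar> \<partial>lebesgue01) \<longlonglongrightarrow> 0"
proof (rule Scheffe_limsup)
  show "(\<integral>\<^sup>+u. ennreal (jump_weight \<mu> \<nu> u) \<partial>lebesgue01) < \<infinity>"
    unfolding nn_integral_jump_eq_stay[OF qc] by (rule nn_integral_stay_finite)
  show "AE u in lebesgue01. jump_weight \<mu> \<nu> u \<noteq> 0 \<longrightarrow> (\<lambda>n. jump_weight (\<mu>\<^sub>n n) (\<nu>\<^sub>n n) u) \<longlonglongrightarrow> jump_weight \<mu> \<nu> u"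
    using AE_IT_tendsto AE_mu AE_nu
  proof eventually_elim
    case (elim u)
    show ?case
    proof
      assume "jump_weight \<mu> \<nu> u \<noteq> 0"
      then have "quantile \<mu> u \<noteq> quantile \<nu> u" by (auto simp: jump_weight_def)
      with elim show "(\<lambda>n. jump_weight (\<mu>\<^sub>n n) (\<nu>\<^sub>n n) u) \<longlonglongrightarrow> jump_weight \<mu> \<nu> u"
        unfolding jump_weight_def by (intro tendsto_intros tendsto_growth) auto
    qed
  qed
  fix e :: real assume "0 < e"
  from ennreal_tendsto_0_D[OF stay_weight_L1_tendsto this]
  show "\<forall>\<^sub>F n in sequentially. (\<integral>\<^sup>+u. ennreal (jump_weight (\<mu>\<^sub>n n) (\<nu>\<^sub>n n) u) \<partial>lebesgue01)
       \<le> (\<integral>\<^sup>+u. ennreal (jump_weight \<mu> \<nu> u) \<partial>lebesgue01) + ennreal e"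
  proof eventually_elim
    case (elim n)
    have "(\<integral>\<^sup>+u. ennreal (jump_weight (\<mu>\<^sub>n n) (\<nu>\<^sub>n n) u) \<partial>lebesgue01) = (\<integral>\<^sup>+u. ennreal (stay_weight (\<mu>\<^sub>n n) (\<nu>\<^sub>n n) u) \<partial>lebesgue01)"
      by (rule nn_integral_jump_eq_stay[OF qc_n])
    also have "\<dots> \<le> (\<integral>\<^sup>+u. ennreal (stay_weight \<mu> \<nu> u) + ennreal \<bar>stay_weight (\<mu>\<^sub>n n) (\<nu>\<^sub>n n) u - stay_weight \<mu> \<nu> u\<bar> \<partial>lebesgue01)"
      by (intro nn_integral_mono) (auto simp: ennreal_plus[symmetric] stay_jump_nonneg simp del: ennreal_plus intro!: ennreal_leI)
    also have "\<dots> = (\<integral>\<^sup>+u. ennreal (stay_weight \<mu> \<nu> u) \<partial>lebesgue01) + (\<integral>\<^sup>+u. ennreal \<bar>stay_weight (\<mu>\<^sub>n n) (\<nu>\<^sub>n n) u - stay_weight \<mu> \<nu> u\<bar> \<partial>lebesgue01)"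
      by (rule nn_integral_add) auto
    also have "\<dots> \<le> (\<integral>\<^sup>+u. ennreal (jump_weight \<mu> \<nu> u) \<partial>lebesgue01) + ennreal e"
      unfolding nn_integral_jump_eq_stay[OF qc] using elim by (intro add_left_mono)
    finally show ?case .
  qed
qed (auto simp: stay_jump_nonneg)

definition cost :: "nat \<Rightarrow> real \<Rightarrow> real" where
  "cost n u = monotone_cost \<rho>
     (IT_weight (\<mu>\<^sub>n n) (\<nu>\<^sub>n n) u) (quantile (\<nu>\<^sub>n n) (IT_phi (\<mu>\<^sub>n n) (\<nu>\<^sub>n n) u)) (quantile (\<nu>\<^sub>n n) u)
     (IT_weight \<mu> \<nu> u) (quantile \<nu> (IT_phi \<mu> \<nu> u)) (quantile \<nu> u)"

lemma measurable_IT_weight: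
  assumes "quantile_convex_order \<mu>' \<nu>'"
  shows "IT_weight \<mu>' \<nu>' \<in> borel_measurable lebesgue01"
proof -
  note [measurable] = measurable_lebesgue01I[OF measurable_quantiles(1)[OF assms]] measurable_lebesgue01I[OF measurable_quantiles(2)[OF assms]]
    measurable_quantile_IT_phi[OF assms]
  show ?thesis unfolding IT_weight_def[abs_def] by measurable
qed

lemma measurable_cost [measurable]: "cost n \<in> borel_measurable lebesgue01"
proof -
  note [measurable] = measurable_IT_weight[OF qc_n] measurable_IT_weight[OF qc]
    measurable_quantile_IT_phi[OF qc_n] measurable_quantile_IT_phi[OF qc]
  show ?thesis unfolding cost_def[abs_def] monotone_cost_def by measurable
qed

text \<open>
  The cost is at most an error that vanishes in \<open>L\<^sup>1\<close> plus a multiple of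
  \<open>jump_weight \<mu> \<nu> + stay_weight \<mu> \<nu>\<close>. This bound is zero on \<open>{q = r}\<close>, and elsewhere the cost
  tends to \<open>0\<close> pointwise.
\<close>

lemma cost_tendsto_0: "(\<lambda>n. \<integral>\<^sup>+u. ennreal (cost n u) \<partial>lebesgue01) \<longlonglongrightarrow> 0"
proof -
  define C where "C = 4 * (4::real) powr \<rho>"
  define C1 where "C1 = (2::real) powr (\<rho> - 1)"
  have C: "0 \<le> C" "0 \<le> C1" by (auto simp: C_def C1_def)
  have aux: "(A + B) + (a + b) \<le> \<bar>A - a\<bar> + \<bar>B - b\<bar> + 2 * (a + b)" for A B a b :: real
    by (simp add: abs_if)
  define F where "F = (\<lambda>n u. \<bar>jump_weight (\<mu>\<^sub>n n) (\<nu>\<^sub>n n) u - jump_weight \<mu> \<nu> u\<bar> + \<bar>stay_weight (\<mu>\<^sub>n n) (\<nu>\<^sub>n n) u - stay_weight \<mu> \<nu> u\<bar>)"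
  define G where "G = (\<lambda>n u. \<bar>quantile (\<nu>\<^sub>n n) u - quantile \<nu> u\<bar> powr \<rho>)"
  have Fm[measurable]: "F n \<in> borel_measurable lebesgue01" for n unfolding F_def by measurable
  have Gm[measurable]: "G n \<in> borel_measurable lebesgue01" for n unfolding G_def by measurable
  have FG: "0 \<le> F n u" "0 \<le> G n u" for n u by (auto simp: F_def G_def)
  have F0: "(\<lambda>n. \<integral>\<^sup>+u. ennreal (F n u) \<partial>lebesgue01) \<longlonglongrightarrow> 0"
    unfolding F_def by (intro L1_tendsto_add jump_weight_L1_tendsto stay_weight_L1_tendsto stay_jump_measurable)
  have G0: "(\<lambda>n. \<integral>\<^sup>+u. ennreal (G n u) \<partial>lebesgue01) \<longlonglongrightarrow> 0"
    unfolding G_def by (rule quantile_powr_diff_tendsto_0[OF nu_n(1) nu(1) \<rho> W_nu nu(2)])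
  show ?thesis
  proof (rule nn_integral_tendsto_0_dominated[where E = "\<lambda>n u. C * (C1 * F n u + G n u)"
        and D = "\<lambda>u. C * (C1 * (2 * (jump_weight \<mu> \<nu> u + stay_weight \<mu> \<nu> u)))"])
    show "AE u in lebesgue01. 0 \<le> cost n u \<and> 0 \<le> C * (C1 * F n u + G n u) \<and>
       cost n u \<le> C * (C1 * F n u + G n u) + C * (C1 * (2 * (jump_weight \<mu> \<nu> u + stay_weight \<mu> \<nu> u)))" for n
      using AE_IT_weight[OF qc_n[of n]] AE_IT_weight[OF qc]
    proof eventually_elim
      case (elim u)
      note p = elim(1)[THEN conjunct1] elim(1)[THEN conjunct2, THEN conjunct1]
        elim(2)[THEN conjunct1] elim(2)[THEN conjunct2, THEN conjunct1]
      note g = elim(1)[THEN conjunct2, THEN conjunct2, THEN conjunct1]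
        elim(2)[THEN conjunct2, THEN conjunct2, THEN conjunct1]
      have S: "IT_weight (\<mu>\<^sub>n n) (\<nu>\<^sub>n n) u * \<bar>quantile (\<nu>\<^sub>n n) (IT_phi (\<mu>\<^sub>n n) (\<nu>\<^sub>n n) u) - quantile (\<nu>\<^sub>n n) u\<bar> powr \<rho>
          \<le> C1 * (jump_weight (\<mu>\<^sub>n n) (\<nu>\<^sub>n n) u + stay_weight (\<mu>\<^sub>n n) (\<nu>\<^sub>n n) u)"
        "IT_weight \<mu> \<nu> u * \<bar>quantile \<nu> (IT_phi \<mu> \<nu> u) - quantile \<nu> u\<bar> powr \<rho>
          \<le> C1 * (jump_weight \<mu> \<nu> u + stay_weight \<mu> \<nu> u)"
        using weighted_powr_le[OF \<rho> p(1) g(1)] weighted_powr_le[OF \<rho> p(3) g(2)]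
        by (auto simp: jump_weight_def stay_weight_def growth_def C1_def)
      have "cost n u \<le> C * (IT_weight (\<mu>\<^sub>n n) (\<nu>\<^sub>n n) u * \<bar>quantile (\<nu>\<^sub>n n) (IT_phi (\<mu>\<^sub>n n) (\<nu>\<^sub>n n) u) - quantile (\<nu>\<^sub>n n) u\<bar> powr \<rho>
         + G n u + IT_weight \<mu> \<nu> u * \<bar>quantile \<nu> (IT_phi \<mu> \<nu> u) - quantile \<nu> u\<bar> powr \<rho>)"
        unfolding cost_def C_def G_def using p \<rho>_pos by (intro monotone_cost_le) auto
      also have "\<dots> \<le> C * (C1 * (jump_weight (\<mu>\<^sub>n n) (\<nu>\<^sub>n n) u + stay_weight (\<mu>\<^sub>n n) (\<nu>\<^sub>n n) u) + G n u + C1 * (jump_weight \<mu> \<nu> u + stay_weight \<mu> \<nu> u))"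
        using C S by (intro mult_left_mono add_mono) auto
      also have "\<dots> = C * (C1 * ((jump_weight (\<mu>\<^sub>n n) (\<nu>\<^sub>n n) u + stay_weight (\<mu>\<^sub>n n) (\<nu>\<^sub>n n) u) + (jump_weight \<mu> \<nu> u + stay_weight \<mu> \<nu> u)) + G n u)"
        by (simp add: algebra_simps)
      also have "\<dots> \<le> C * (C1 * (F n u + 2 * (jump_weight \<mu> \<nu> u + stay_weight \<mu> \<nu> u)) + G n u)"
        unfolding F_def by (intro mult_left_mono add_right_mono C aux)
      also have "\<dots> = C * (C1 * F n u + G n u) + C * (C1 * (2 * (jump_weight \<mu> \<nu> u + stay_weight \<mu> \<nu> u)))"
        by (simp add: algebra_simps)
      finally show ?case
        using monotone_cost_nonneg[OF p] C FG[of n u] by (auto simp: cost_def)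
    qed
    show "0 \<le> C * (C1 * (2 * (jump_weight \<mu> \<nu> u + stay_weight \<mu> \<nu> u)))" for u
      using C stay_jump_nonneg by auto
    show "(\<lambda>n. \<integral>\<^sup>+u. ennreal (C * (C1 * F n u + G n u)) \<partial>lebesgue01) \<longlonglongrightarrow> 0"
    proof (rule nn_integral_cmult_tendsto_0[OF _ C(1)])
      have "(\<lambda>n. (\<integral>\<^sup>+u. ennreal (C1 * F n u) \<partial>lebesgue01) + (\<integral>\<^sup>+u. ennreal (G n u) \<partial>lebesgue01)) \<longlonglongrightarrow> 0 + 0"
        by (intro tendsto_add G0 nn_integral_cmult_tendsto_0[OF Fm C(2) F0])
      moreover have "(\<integral>\<^sup>+u. ennreal (C1 * F n u) \<partial>lebesgue01) + (\<integral>\<^sup>+u. ennreal (G n u) \<partial>lebesgue01)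
          = (\<integral>\<^sup>+u. ennreal (C1 * F n u + G n u) \<partial>lebesgue01)" for n
        using C FG by (subst nn_integral_add[symmetric]) auto
      ultimately show "(\<lambda>n. \<integral>\<^sup>+u. ennreal (C1 * F n u + G n u) \<partial>lebesgue01) \<longlonglongrightarrow> 0" by simp
    qed measurable
    have "(\<integral>\<^sup>+u. ennreal (C * (C1 * (2 * (jump_weight \<mu> \<nu> u + stay_weight \<mu> \<nu> u)))) \<partial>lebesgue01)
       = ennreal (C * (C1 * 2)) * ((\<integral>\<^sup>+u. ennreal (jump_weight \<mu> \<nu> u) \<partial>lebesgue01) + (\<integral>\<^sup>+u. ennreal (stay_weight \<mu> \<nu> u) \<partial>lebesgue01))"
      using C stay_jump_nonneg
      by (subst nn_integral_add[symmetric]; (subst nn_integral_cmult[symmetric])?)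
        (auto intro!: nn_integral_cong simp: ennreal_mult[symmetric] ennreal_plus[symmetric] mult.assoc simp del: ennreal_plus)
    also have "\<dots> < \<infinity>"
      using nn_integral_stay_finite unfolding nn_integral_jump_eq_stay[OF qc] by (simp add: ennreal_mult_less_top)
    finally show "(\<integral>\<^sup>+u. ennreal (C * (C1 * (2 * (jump_weight \<mu> \<nu> u + stay_weight \<mu> \<nu> u)))) \<partial>lebesgue01) < \<infinity>" .
    have all: "AE u in lebesgue01. \<forall>n. 0 \<le> IT_weight (\<mu>\<^sub>n n) (\<nu>\<^sub>n n) u \<and> IT_weight (\<mu>\<^sub>n n) (\<nu>\<^sub>n n) u \<le> 1"
      unfolding AE_all_countable
    proof
      fix n
      show "AE u in lebesgue01. 0 \<le> IT_weight (\<mu>\<^sub>n n) (\<nu>\<^sub>n n) u \<and> IT_weight (\<mu>\<^sub>n n) (\<nu>\<^sub>n n) u \<le> 1"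
        using AE_IT_weight[OF qc_n[of n]] by eventually_elim auto
    qed
    show "AE u in lebesgue01. (\<lambda>n. min (cost n u) (C * (C1 * (2 * (jump_weight \<mu> \<nu> u + stay_weight \<mu> \<nu> u))))) \<longlonglongrightarrow> 0"
      using all AE_IT_tendsto AE_nu AE_IT_weight[OF qc]
    proof eventually_elim
      case (elim u)
      have nn: "0 \<le> cost n u" for n
        unfolding cost_def using elim(1,4) by (intro monotone_cost_nonneg) auto
      show ?case
      proof (cases "quantile \<mu> u = quantile \<nu> u")
        case True
        then have "jump_weight \<mu> \<nu> u + stay_weight \<mu> \<nu> u = 0" by (simp add: jump_weight_def stay_weight_def)
        then show ?thesis using nn by (simp add: min_absorb2)
      next
        case False
        with elim have "(\<lambda>n. cost n u) \<longlonglongrightarrow> 0"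
          unfolding cost_def by (intro monotone_cost_tendsto_0 \<rho>_pos) auto
        from tendsto_min[OF this tendsto_const]
        have "(\<lambda>n. min (cost n u) (C * (C1 * (2 * (jump_weight \<mu> \<nu> u + stay_weight \<mu> \<nu> u))))) \<longlonglongrightarrow> min 0 (C * (C1 * (2 * (jump_weight \<mu> \<nu> u + stay_weight \<mu> \<nu> u))))" .
        moreover have "min 0 (C * (C1 * (2 * (jump_weight \<mu> \<nu> u + stay_weight \<mu> \<nu> u)))) = 0"
          using C stay_jump_nonneg by (intro min_absorb1) auto
        ultimately show ?thesis by simp
      qed
    qed
  qed measurable
qed

end

theorem proposition4p1:
  fixes \<rho> :: real
    and \<mu>\<^sub>n \<nu>\<^sub>n :: "nat \<Rightarrow> real measure" and \<mu> \<nu> :: "real measure"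
    and m\<^sub>n :: "nat \<Rightarrow> real \<Rightarrow> real measure" and m :: "real \<Rightarrow> real measure"
  assumes "\<rho> \<ge> 1"
    and "\<And>n. \<mu>\<^sub>n n \<in> finite_moment_measures \<rho>"
    and "\<And>n. \<nu>\<^sub>n n \<in> finite_moment_measures \<rho>"
    and "\<mu> \<in> finite_moment_measures \<rho>"
    and "\<nu> \<in> finite_moment_measures \<rho>"
    and "\<And>n. convex_order (\<mu>\<^sub>n n) (\<nu>\<^sub>n n)"
    and "(\<lambda>n. wasserstein \<rho> (\<mu>\<^sub>n n) \<mu>) \<longlonglongrightarrow> 0"
    and "(\<lambda>n. wasserstein \<rho> (\<nu>\<^sub>n n) \<nu>) \<longlonglongrightarrow> 0"
    and "\<And>n. lifted_IT_kernel (\<mu>\<^sub>n n) (\<nu>\<^sub>n n) (m\<^sub>n n)"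
    and "lifted_IT_kernel \<mu> \<nu> m"
  shows "(\<forall>n. ennpowr (lifted_AW \<rho> (lifted_measure (\<mu>\<^sub>n n) (m\<^sub>n n)) (lifted_measure \<mu> m)) \<rho>
              \<le> 2 * (\<integral>\<^sup>+u. ennpowr (wasserstein \<rho> (m\<^sub>n n u) (m u)) \<rho> \<partial>lebesgue01))
         \<and> (\<lambda>n. \<integral>\<^sup>+u. ennpowr (wasserstein \<rho> (m\<^sub>n n u) (m u)) \<rho> \<partial>lebesgue01) \<longlonglongrightarrow> 0"
proof -
  interpret convergent_convex_ordered_pairs \<rho> \<mu>\<^sub>n \<nu>\<^sub>n \<mu> \<nu>
    by unfold_locales (use assms in auto)
  note two_n = AE_two_point_IT_kernel[OF qc_n assms(9)] and two = AE_two_point_IT_kernel[OF qc assms(10)]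
  show ?thesis
  proof (intro conjI allI)
    fix n
    show "ennpowr (lifted_AW \<rho> (lifted_measure (\<mu>\<^sub>n n) (m\<^sub>n n)) (lifted_measure \<mu> m)) \<rho>
              \<le> 2 * (\<integral>\<^sup>+u. ennpowr (wasserstein \<rho> (m\<^sub>n n u) (m u)) \<rho> \<partial>lebesgue01)"
    proof (rule lifted_AW_le_diagonal[OF mu_n(1) _ mu(1) _ \<rho>])
      show "m\<^sub>n n \<in> prob_kernels" "m \<in> prob_kernels"
        using assms(9)[of n] assms(10) by (auto simp: lifted_IT_kernel_def)
      show "AE u in lebesgue01. ennreal (\<bar>quantile (\<mu>\<^sub>n n) u - quantile \<mu> u\<bar> powr \<rho>)
          \<le> ennpowr (wasserstein \<rho> (m\<^sub>n n u) (m u)) \<rho>"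
        using two_n[of n] two AE_IT_weight[OF qc_n[of n]] AE_IT_weight[OF qc]
      proof eventually_elim
        case (elim u)
        have mean: "(\<integral>x. x \<partial>m\<^sub>n n u) = quantile (\<mu>\<^sub>n n) u" "(\<integral>x. x \<partial>m u) = quantile \<mu> u"
          using two_point_mean(2)[OF elim(1)] two_point_mean(2)[OF elim(2)] elim(3,4)
          by (auto simp: algebra_simps)
        have "ennreal (\<bar>(\<integral>x. x \<partial>m\<^sub>n n u) - (\<integral>x. x \<partial>m u)\<bar> powr \<rho>) \<le> ennpowr (wasserstein \<rho> (m\<^sub>n n u) (m u)) \<rho>"
          using elim(1,2) two_point_mean(1)[OF elim(1)] two_point_mean(1)[OF elim(2)]
          by (intro mean_diff_powr_le_wasserstein \<rho>) (auto simp: two_point_def)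
        then show ?case by (simp add: mean)
      qed
    qed
  next
    show "(\<lambda>n. \<integral>\<^sup>+u. ennpowr (wasserstein \<rho> (m\<^sub>n n u) (m u)) \<rho> \<partial>lebesgue01) \<longlonglongrightarrow> 0"
    proof (rule nn_integral_tendsto_0_le[OF _ cost_tendsto_0])
      show "AE u in lebesgue01. ennpowr (wasserstein \<rho> (m\<^sub>n n u) (m u)) \<rho> \<le> ennreal (cost n u)" for n
        using two_n[of n] two
        by eventually_elim (auto simp: cost_def intro!: wasserstein_two_point_le \<rho>_pos)
    qed
  qed
qed

end
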